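(* Let $\omega\in\mathcal{DTBM}(\mathbb{R}^d)$. Then there exist unique distributions $\omega_{\mathrm s},\omega_{0a},\omega_{0s}\in\mathcal{DTBM}(\mathbb{R}^d)$ such that $\omega=\omega_{\mathrm s}+\omega_{0a}+\omega_{0s}$ and $$\widehat{\omega_{\mathrm s}}=(\widehat{\omega})_{\mathrm{pp}},\qquad \widehat{\omega_{0a}}=(\widehat{\omega})_{\mathrm{ac}},\qquad \widehat{\omega_{0s}}=(\widehat{\omega})_{\mathrm{sc}}.$$ Moreover, there exist functions $h_{\mathrm s},h_{0a},h_{0s}\in B(\mathbb{R}^d)$ such that $$\omega_{\mathrm s}=\Psi_d(h_{\mathrm s}\lambda),\qquad \omega_{0a}=\Psi_d(h_{0a}\lambda),\qquad \omega_{0s}=\Psi_d(h_{0s}\lambda).$$ Finally, with $\omega_0:=\omega_{0a}+\omega_{0s}$, the decomposition $\omega=\omega_{\mathrm s}+\omega_0$ is the Eberlein decomposition of $\omega$, that is, the unique decomposition of $\omega \in \mathsf{WAP}(\mathbb{R}^d)$ with $\omega_{\mathrm s}\in\mathsf{SAP}(\mathbb{R}^d)$ and $\omega_0\in\mathsf{WAP}_0(\mathbb{R}^d)$.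
   Context: $\lambda$ is Lebesgue measure on $\mathbb{R}^d$; $C_{\mathsf u}(\mathbb{R}^d)$ is the space of bounded uniformly continuous functions; $\mathcal{S}(\mathbb{R}^d)$ is the Schwartz space. Measures are complex Radon measures on $\mathbb{R}^d$; $\mu$ is translation bounded if $\sup_{t}|\mu|(t+K)<\infty$ for every compact $K$, and $\mathcal{M}^\infty(\mathbb{R}^d)$ is the space of such measures (each defines a tempered distribution). Fourier transform: $\widehat{f}(x)=\int e^{-2\pi i x\cdot y}f(y)\,dy$, similarly for finite measures, and $\widehat{\omega}(f)=\omega(\widehat f)$ for $\omega\in\mathcal{S}'(\mathbb{R}^d)$. $\mathcal{DTBM}(\mathbb{R}^d):=\{\omega\in\mathcal{S}'(\mathbb{R}^d):\widehat{\omega}\in\mathcal{M}^\infty(\mathbb{R}^d)\}$; $B(\mathbb{R}^d):=\{\widehat{\rho}:\rho\text{ a finite (complex) measure on }\mathbb{R}^d\}$; $\Psi_d:=(\partial_{x_1})^{2d}+\ldots+(\partial_{x_d})^{2d}+(-1)^d$. For a measure $\nu$, $\nu_{\mathrm{pp}},\nu_{\mathrm{ac}},\nu_{\mathrm{sc}}$ are its pure point, absolutely continuous and singular continuous parts (with respect to Lebesgue measure). Almost periodicity: $f\in C_{\mathsf u}(\mathbb{R}^d)$ is strongly (Bohr) almost periodic, $f\in SAP(\mathbb{R}^d)$, if the set of translates $\{f(\cdot-t):t\in\mathbb{R}^d\}$ has compact closure in $(C_{\mathsf u}(\mathbb{R}^d),\|\cdot\|_\infty)$; weakly almost periodic, $f\in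 WAP(\mathbb{R}^d)$, if this set has compact closure in the weak topology of this Banach space. For $f\in WAP(\mathbb{R}^d)$ the mean $M(f)=\lim_n(2n)^{-d}\int_{s+[-n,n]^d}f$ exists uniformly in $s$, and $|f|\in WAP(\mathbb{R}^d)$; $WAP_0(\mathbb{R}^d)=\{f\in WAP(\mathbb{R}^d):M(|f|)=0\}$. A tempered distribution $\omega$ is in $\mathsf{WAP}(\mathbb{R}^d)$, $\mathsf{SAP}(\mathbb{R}^d)$, $\mathsf{WAP}_0(\mathbb{R}^d)$ if for all $f\in\mathcal{S}(\mathbb{R}^d)$ the function $(f*\omega)(x)=\omega(f(x-\cdot))$ is in $WAP(\mathbb{R}^d)$, $SAP(\mathbb{R}^d)$, $WAP_0(\mathbb{R}^d)$, respectively. It is known that $\mathsf{WAP}(\mathbb{R}^d)=\mathsf{SAP}(\mathbb{R}^d)\oplus\mathsf{WAP}_0(\mathbb{R}^d)$ and $\mathcal{DTBM}(\mathbb{R}^d)\subseteq\mathsf{WAP}(\mathbb{R}^d)$. *)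

theory Defs
  imports "HOL-Analysis.Analysis"
begin

type_synonym 'n cfun = "real ^ 'n \<Rightarrow> complex"
type_synonym 'n distr = "'n cfun \<Rightarrow> complex"
type_synonym 'n cmeas = "(real ^ 'n) set \<Rightarrow> complex"


section \<open>Schwartz functions and tempered distributions\<close>

definition pderivative :: "'n::finite \<Rightarrow> 'n cfun \<Rightarrow> 'n cfun" where
  "pderivative i f = (\<lambda>x. vector_derivative (\<lambda>t. f (x + t *\<^sub>R axis i 1)) (at 0))"

definition pderivatives :: "'n::finite list \<Rightarrow> 'n cfun \<Rightarrow> 'n cfun" where
  "pderivatives js f = foldr pderivative js f"

definition schwartz_seminorm :: "nat \<Rightarrow> 'n::finite list \<Rightarrow> 'n cfun \<Rightarrow> real" where
  "schwartz_seminorm k js f = (SUP x. norm x ^ k * cmod (pderivatives js f x))"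

text \<open>Differentiability of the iterated partial derivatives of all orders is
  \<open>C\<^sup>\<infinity>\<close>-smoothness, since it makes all of them continuous.\<close>

definition schwartz :: "'n::finite cfun set" where
  "schwartz = {f. (\<forall>js x. pderivatives js f differentiable at x) \<and>
     (\<forall>k js. bounded (range (\<lambda>x. norm x ^ k * cmod (pderivatives js f x))))}"

definition schwartz_topology :: "'n::finite cfun topology" where
  "schwartz_topology = topology_generated_by
     {{g \<in> schwartz. schwartz_seminorm k js (\<lambda>x. g x - f x) < e} | f k js e.
        f \<in> schwartz \<and> 0 < e}"

text \<open>A distribution is extended by \<open>0\<close> to functions outside the Schwartz space, so that
  equality of HOL functions is equality of distributions.\<close>

definition tempered :: "'n::finite distr set" where
  "tempered = {\<omega>.
     (\<forall>f\<in>schwartz. \<forall>g\<in>schwartz. \<omega> (\<lambda>x. f x + g x) = \<omega> f + \<omega> g) \<and>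
     (\<forall>c. \<forall>f\<in>schwartz. \<omega> (\<lambda>x. c * f x) = c * \<omega> f) \<and>
     continuous_map schwartz_topology euclidean \<omega> \<and>
     (\<forall>f. f \<notin> schwartz \<longrightarrow> \<omega> f = 0)}"

definition fourier :: "'n::finite cfun \<Rightarrow> 'n cfun" where
  "fourier f = (\<lambda>x. LINT y|lborel. exp (- 2 * complex_of_real pi * \<i> * complex_of_real (x \<bullet> y)) * f y)"

definition distr_fourier :: "'n::finite distr \<Rightarrow> 'n distr" where
  "distr_fourier \<omega> = (\<lambda>f. if f \<in> schwartz then \<omega> (fourier f) else 0)"

definition distr_pderivative :: "'n::finite \<Rightarrow> 'n distr \<Rightarrow> 'n distr" where
  "distr_pderivative i \<omega> = (\<lambda>f. if f \<in> schwartz then - \<omega> (pderivative i f) else 0)"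

definition Psi :: "'n::finite distr \<Rightarrow> 'n distr" where
  "Psi \<omega> = (\<lambda>f. (\<Sum>i\<in>UNIV. (distr_pderivative i ^^ (2 * CARD('n))) \<omega> f)
     + (- 1) ^ CARD('n) * \<omega> f)"

definition distr_conv :: "'n::finite cfun \<Rightarrow> 'n distr \<Rightarrow> 'n cfun" where
  "distr_conv f \<omega> = (\<lambda>x. \<omega> (\<lambda>y. f (x - y)))"


section \<open>Complex Radon measures\<close>

text \<open>A complex Radon measure need not have a value on an unbounded set. It is a
  countably additive set function on the bounded Borel sets, and is extended by \<open>0\<close> to all
  other sets so that equality of HOL functions is equality of measures.\<close>

definition bounded_borel :: "(real ^ 'n::finite) set set" where
  "bounded_borel = {A. A \<in> sets borel \<and> bounded A}"

definition radon :: "'n::finite cmeas set" where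
  "radon = {\<mu>.
     (\<forall>A :: nat \<Rightarrow> (real ^ 'n) set. range A \<subseteq> sets borel \<longrightarrow> disjoint_family A \<longrightarrow> bounded (\<Union>n. A n)
        \<longrightarrow> (\<lambda>n. \<mu> (A n)) sums \<mu> (\<Union>n. A n)) \<and>
     (\<forall>A. A \<notin> bounded_borel \<longrightarrow> \<mu> A = 0)}"

definition total_variation :: "'n::finite cmeas \<Rightarrow> (real ^ 'n) set \<Rightarrow> ennreal" where
  "total_variation \<mu> A =
     (SUP P\<in>{P. finite P \<and> disjoint P \<and> P \<subseteq> bounded_borel \<and> \<Union>P \<subseteq> A}.
        \<Sum>B\<in>P. ennreal (cmod (\<mu> B)))"

definition finite_radon :: "'n::finite cmeas set" where
  "finite_radon = {\<mu> \<in> radon. total_variation \<mu> UNIV < \<infinity>}"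

definition translation_bounded :: "'n::finite cmeas set" where
  "translation_bounded = {\<mu> \<in> radon.
     \<forall>K. compact K \<longrightarrow> (SUP t. total_variation \<mu> ((+) t ` K)) < \<infinity>}"

text \<open>The integral is taken through the Jordan decompositions of the real and imaginary
  parts. Note that \<open>ennreal\<close> sends negative reals to \<open>0\<close>, and that \<open>B = {}\<close> is admitted.\<close>

definition pos_variation :: "((real ^ 'n::finite) set \<Rightarrow> real) \<Rightarrow> (real ^ 'n) measure" where
  "pos_variation r = measure_of UNIV (sets borel)
     (\<lambda>A. SUP B\<in>{B \<in> bounded_borel. B \<subseteq> A}. ennreal (r B))"

definition cmeas_integral :: "'n::finite cmeas \<Rightarrow> 'n cfun \<Rightarrow> complex" where
  "cmeas_integral \<mu> f =
     ((LINT x|pos_variation (\<lambda>A. Re (\<mu> A)). f x) - (LINT x|pos_variation (\<lambda>A. - Re (\<mu> A)). f x))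
     + \<i> * ((LINT x|pos_variation (\<lambda>A. Im (\<mu> A)). f x) - (LINT x|pos_variation (\<lambda>A. - Im (\<mu> A)). f x))"

definition distr_of_cmeas :: "'n::finite cmeas \<Rightarrow> 'n distr" where
  "distr_of_cmeas \<mu> = (\<lambda>f. if f \<in> schwartz then cmeas_integral \<mu> f else 0)"

text \<open>The measure \<open>h\<lambda>\<close> with density \<open>h\<close> with respect to Lebesgue measure.\<close>

definition density_cmeas :: "'n::finite cfun \<Rightarrow> 'n cmeas" where
  "density_cmeas h = (\<lambda>A. if A \<in> bounded_borel then (LINT x:A|lborel. h x) else 0)"

definition pure_point :: "'n::finite cmeas \<Rightarrow> bool" where
  "pure_point \<mu> \<longleftrightarrow> (\<exists>C. countable C \<and> (\<forall>A\<in>bounded_borel. \<mu> A = \<mu> (A \<inter> C)))"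

definition abs_continuous :: "'n::finite cmeas \<Rightarrow> bool" where
  "abs_continuous \<mu> \<longleftrightarrow> (\<forall>A\<in>bounded_borel. emeasure lborel A = 0 \<longrightarrow> \<mu> A = 0)"

definition sing_continuous :: "'n::finite cmeas \<Rightarrow> bool" where
  "sing_continuous \<mu> \<longleftrightarrow> (\<forall>x. \<mu> {x} = 0) \<and>
     (\<exists>N\<in>sets borel. emeasure lborel N = 0 \<and> (\<forall>A\<in>bounded_borel. \<mu> A = \<mu> (A \<inter> N)))"

definition lebesgue_decomposition ::
    "'n::finite cmeas \<Rightarrow> 'n cmeas \<Rightarrow> 'n cmeas \<Rightarrow> 'n cmeas \<Rightarrow> bool" where
  "lebesgue_decomposition \<mu> p a s \<longleftrightarrow> p \<in> radon \<and> a \<in> radon \<and> s \<in> radon \<and>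
     pure_point p \<and> abs_continuous a \<and> sing_continuous s \<and> \<mu> = (\<lambda>A. p A + a A + s A)"

definition pp_part :: "'n::finite cmeas \<Rightarrow> 'n cmeas" where
  "pp_part \<mu> = (THE p. \<exists>a s. lebesgue_decomposition \<mu> p a s)"

definition ac_part :: "'n::finite cmeas \<Rightarrow> 'n cmeas" where
  "ac_part \<mu> = (THE a. \<exists>p s. lebesgue_decomposition \<mu> p a s)"

definition sc_part :: "'n::finite cmeas \<Rightarrow> 'n cmeas" where
  "sc_part \<mu> = (THE s. \<exists>p a. lebesgue_decomposition \<mu> p a s)"

definition DTBM :: "'n::finite distr set" where
  "DTBM = {\<omega> \<in> tempered. \<exists>\<mu>\<in>translation_bounded. distr_fourier \<omega> = distr_of_cmeas \<mu>}"

text \<open>The Fourier--Stieltjes algebra \<open>B\<close>.\<close>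

definition fourier_stieltjes :: "'n::finite cfun set" where
  "fourier_stieltjes =
     {\<lambda>x. cmeas_integral \<rho> (\<lambda>y. exp (- 2 * complex_of_real pi * \<i> * complex_of_real (x \<bullet> y))) | \<rho>. \<rho> \<in> finite_radon}"


section \<open>Almost periodicity\<close>

definition Cu :: "((real ^ 'n::finite) \<Rightarrow>\<^sub>C complex) set" where
  "Cu = {f. uniformly_continuous_on UNIV (apply_bcontfun f)}"

definition translate :: "real ^ 'n::finite \<Rightarrow> ((real ^ 'n) \<Rightarrow>\<^sub>C complex) \<Rightarrow> ((real ^ 'n) \<Rightarrow>\<^sub>C complex)" where
  "translate t f = Bcontfun (\<lambda>x. apply_bcontfun f (x - t))"

definition cscale :: "complex \<Rightarrow> ((real ^ 'n::finite) \<Rightarrow>\<^sub>C complex) \<Rightarrow> ((real ^ 'n) \<Rightarrow>\<^sub>C complex)" where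
  "cscale c f = Bcontfun (\<lambda>x. c * apply_bcontfun f x)"

lemma apply_translate [simp]: "apply_bcontfun (translate t f) x = apply_bcontfun f (x - t)"
proof -
  have "continuous_on UNIV (\<lambda>x. apply_bcontfun f (x - t))"
    by (rule continuous_on_compose2[OF continuous_on_apply_bcontfun[of UNIV f]])
       (auto intro: continuous_on_diff continuous_on_id continuous_on_const)
  moreover have "bounded (range (\<lambda>x. apply_bcontfun f (x - t)))"
    by (rule bounded_subset[OF bounded_apply_bcontfun[of f]]) auto
  ultimately show ?thesis
    by (simp add: translate_def bcontfun_def Bcontfun_inverse)
qed

lemma apply_cscale [simp]: "apply_bcontfun (cscale c f) x = c * apply_bcontfun f x"
proof -
  have "continuous_on UNIV (\<lambda>x. c * apply_bcontfun f x)"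
    by (rule continuous_on_mult_left[OF continuous_on_apply_bcontfun])
  moreover obtain K where "\<And>x. cmod (apply_bcontfun f x) \<le> K"
    using bounded_apply_bcontfun[of f] by (auto simp: bounded_iff)
  then have "bounded (range (\<lambda>x. c * apply_bcontfun f x))"
    by (intro boundedI[of _ "cmod c * K"]) (auto simp: norm_mult intro!: mult_left_mono)
  ultimately show ?thesis
    by (simp add: cscale_def bcontfun_def Bcontfun_inverse)
qed

definition Cu_dual :: "(((real ^ 'n::finite) \<Rightarrow>\<^sub>C complex) \<Rightarrow> complex) set" where
  "Cu_dual = {\<phi>.
     (\<forall>f\<in>Cu. \<forall>g\<in>Cu. \<phi> (f + g) = \<phi> f + \<phi> g) \<and>
     (\<forall>c. \<forall>f\<in>Cu. \<phi> (cscale c f) = c * \<phi> f) \<and>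
     (\<exists>K. \<forall>f\<in>Cu. cmod (\<phi> f) \<le> K * norm f)}"

definition Cu_weak_topology :: "((real ^ 'n::finite) \<Rightarrow>\<^sub>C complex) topology" where
  "Cu_weak_topology = topology_generated_by
     {{f \<in> Cu. \<phi> f \<in> U} | \<phi> U. \<phi> \<in> Cu_dual \<and> open U}"

definition relatively_compact_in :: "'a topology \<Rightarrow> 'a set \<Rightarrow> bool" where
  "relatively_compact_in X A \<longleftrightarrow> compactin X (X closure_of A)"

definition SAP_fun :: "'n::finite cfun set" where
  "SAP_fun = {apply_bcontfun f | f. f \<in> Cu \<and>
     relatively_compact_in (top_of_set Cu) (range (\<lambda>t. translate t f))}"

definition WAP_fun :: "'n::finite cfun set" where
  "WAP_fun = {apply_bcontfun f | f. f \<in> Cu \<and>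
     relatively_compact_in Cu_weak_topology (range (\<lambda>t. translate t f))}"

definition has_mean :: "(real ^ 'n::finite \<Rightarrow> real) \<Rightarrow> real \<Rightarrow> bool" where
  "has_mean f m \<longleftrightarrow> uniform_limit UNIV
     (\<lambda>n s. (LINT x:cbox (s - vec (real n)) (s + vec (real n))|lborel. f x) / (2 * real n) ^ CARD('n))
     (\<lambda>s. m) sequentially"

definition WAP0_fun :: "'n::finite cfun set" where
  "WAP0_fun = {f \<in> WAP_fun. has_mean (\<lambda>x. cmod (f x)) 0}"

definition SAP :: "'n::finite distr set" where
  "SAP = {\<omega> \<in> tempered. \<forall>f\<in>schwartz. distr_conv f \<omega> \<in> SAP_fun}"

definition WAP :: "'n::finite distr set" where
  "WAP = {\<omega> \<in> tempered. \<forall>f\<in>schwartz. distr_conv f \<omega> \<in> WAP_fun}"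

definition WAP0 :: "'n::finite distr set" where
  "WAP0 = {\<omega> \<in> tempered. \<forall>f\<in>schwartz. distr_conv f \<omega> \<in> WAP0_fun}"


section \<open>The two decompositions\<close>

text \<open>Here \<open>\<mu>\<close> stands for the Fourier transform of \<open>\<omega>\<close> as a translation bounded measure, so
  that its three parts can be formed.\<close>

definition spectral_decomposition ::
    "'n::finite distr \<Rightarrow> 'n cmeas \<Rightarrow> 'n distr \<Rightarrow> 'n distr \<Rightarrow> 'n distr \<Rightarrow> bool" where
  "spectral_decomposition \<omega> \<mu> \<omega>s \<omega>0a \<omega>0s \<longleftrightarrow>
     \<omega>s \<in> DTBM \<and> \<omega>0a \<in> DTBM \<and> \<omega>0s \<in> DTBM \<and>
     \<omega> = (\<lambda>f. \<omega>s f + \<omega>0a f + \<omega>0s f) \<and>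
     distr_fourier \<omega>s = distr_of_cmeas (pp_part \<mu>) \<and>
     distr_fourier \<omega>0a = distr_of_cmeas (ac_part \<mu>) \<and>
     distr_fourier \<omega>0s = distr_of_cmeas (sc_part \<mu>)"

definition eberlein_decomposition :: "'n::finite distr \<Rightarrow> 'n distr \<Rightarrow> 'n distr \<Rightarrow> bool" where
  "eberlein_decomposition \<omega> \<omega>s \<omega>0 \<longleftrightarrow>
     \<omega>s \<in> SAP \<and> \<omega>0 \<in> WAP0 \<and> \<omega> = (\<lambda>f. \<omega>s f + \<omega>0 f)"

end

theory Submission
  imports Defs "HOL-Probability.Probability"
begin

text \<open>
  The Fourier transform of \<open>\<omega>\<close> is a translation bounded measure, and the theorem says that the three
  parts of this measure can be transformed back one by one. This is possible because every
  translation bounded measure has the form \<open>u m\<close> with a bounded function \<open>u\<close> and a positive translation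
  bounded measure \<open>m\<close> (\<open>translation_bounded_obtain_density\<close>). The pure point, absolutely continuous and
  singular continuous part arise by restricting \<open>u\<close> to the atoms of \<open>m\<close>, to the complement of the
  atoms and a maximal Lebesgue null set \<open>N\<close>, and to the remainder of \<open>N\<close>
  (\<open>lebesgue_decomposition_restrict\<close>); a Lebesgue decomposition is unique
  (\<open>lebesgue_decomposition_unique\<close>). So any statement about \<open>u m\<close> for arbitrary bounded \<open>u\<close> holds for the
  three parts as well.

  The function \<open>weight x\<close>, the product of \<open>1 / (1 + (x $ i)\<^sup>2)\<close> over all coordinates, is integrable with
  respect to \<open>m\<close> (\<open>nn_integral_weight\<close>), and Schwartz functions are bounded by multiples of it. Hence
  \<open>inv_distr f = \<integral> inv_fourier f * u \<partial>m\<close> defines a tempered distribution. Fourier inversion on the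
  Schwartz space (\<open>inv_fourier_fourier\<close>) shows that its Fourier transform is \<open>u m\<close> and that no other
  tempered distribution has this transform (\<open>distr_fourier_inject\<close>), which gives existence and
  uniqueness of \<open>\<omega>s\<close>, \<open>\<omega>0a\<close>, \<open>\<omega>0s\<close>.

  On the Fourier side, \<open>Psi\<close> is multiplication by \<open>(-1) ^ d * Psi_symbol\<close> with
  \<open>Psi_symbol k = 1 + (\<Sum>i. (2 * pi * k $ i) ^ (2 * d))\<close>, whose inverse is at most \<open>2 ^ d * weight\<close>. Therefore
  \<open>q = (-1) ^ d * u / Psi_symbol\<close> is integrable with respect to \<open>m\<close>, the transform \<open>h\<close> of the finite
  measure \<open>q m\<close> belongs to \<open>fourier_stieltjes\<close>, and applying \<open>Psi\<close> to the measure with density \<open>h\<close>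
  gives back \<open>inv_distr\<close> (\<open>Psi_representation\<close>).

  For the Eberlein decomposition, the convolution of \<open>inv_distr\<close> with a Schwartz function is
  \<open>x \<mapsto> \<integral> ee (k \<bullet> x) * v k \<partial>M\<close> with a finite measure \<open>M\<close> and a bounded \<open>v\<close>
  (\<open>distr_conv_inv_distr_weighted\<close>). Three facts on such functions suffice.
  \<^item> They are weakly almost periodic (\<open>Fourier_Stieltjes_WAP\<close>): their translates are images of
    functionals, bounded in mean square, that lie in a fixed ball. The ball is
    weak-* compact by Tychonoff's theorem, and the map from functionals to transforms is continuous
    into the weak topology, because a bounded functional of the transform is nearly the evaluation at
    a fixed function (\<open>Cu_dual_transform_approx\<close>). This rests on an approximate form of the Riesz
    representation theorem in a pre-Hilbert space (\<open>riesz_approx\<close>).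
  \<^item> If \<open>v\<close> vanishes off a countable set they are Bohr almost periodic (\<open>pure_point_SAP\<close>), being uniform
    limits of trigonometric polynomials.
  \<^item> If \<open>M\<close> has no atoms they have absolute mean zero by Wiener's lemma: the mean square over large
    cubes is bounded by double integrals that tend to the mass of the diagonal under the product of
    \<open>M\<close> with itself
    (\<open>integral_square_cube_le\<close>, \<open>double_cube_bound_tendsto\<close>, \<open>no_atoms_has_mean_0\<close>).

  The first fact applies to \<open>\<omega>\<close>, the second to \<open>\<omega>s\<close>, and the first and third to \<open>\<omega>0a + \<omega>0s\<close>. Finally
  the Eberlein decomposition is unique, because a function that is both Bohr almost periodic and of
  absolute mean zero vanishes: it returns close to any of its values in a relatively dense way
  (\<open>almost_periodic_mean_zero\<close>, \<open>eberlein_decomposition_unique\<close>).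
\<close>

section \<open>Products of functions of one coordinate, and an integrable weight\<close>

lemma Basis_real_vec: "(Basis :: (real^'n::finite) set) = range (\<lambda>i. axis i 1)"
  by (auto simp: Basis_vec_def)

text \<open>Lebesgue measure is a product over the set \<open>Basis\<close>; reindexing by \<open>axis\<close> turns it into a
  product over the coordinates. The two uses are the integrability of \<open>weight\<close> and the
  factorisation of Gaussian and cube integrals.\<close>
lemma lborel_prod_coordinates:
  fixes f :: "'n::finite \<Rightarrow> real \<Rightarrow> 'b::{real_normed_field,banach,second_countable_topology}"
  assumes f: "\<And>i. integrable lborel (f i)"
  shows integrable_lborel_prod: "integrable lborel (\<lambda>x::real^'n. \<Prod>i\<in>UNIV. f i (x $ i))"
    and integral_lborel_prod: "(LINT x|lborel. (\<Prod>i\<in>UNIV. f i ((x::real^'n) $ i))) = (\<Prod>i\<in>UNIV. LINT t|lborel. f i t)"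
proof -
  let ?B = "Basis :: (real^'n) set"
  interpret product_sigma_finite "\<lambda>_::real^'n. lborel :: real measure"
    by standard
  have inj: "inj (\<lambda>i::'n. axis i (1::real))"
    by (auto simp: inj_on_def axis_eq_axis)
  define g where "g b = f (axis_index b)" for b :: "real^'n"
  have ax: "axis_index (axis i (1::real) :: real^'n) = i" for i :: 'n
    using axis_index_axis by blast
  have prod_B: "(\<Prod>b\<in>?B. h b) = (\<Prod>i\<in>UNIV. h (axis i 1))" for h :: "real^'n \<Rightarrow> 'b"
    unfolding Basis_real_vec by (subst prod.reindex[OF inj]) simp
  have comp: "(\<Sum>b\<in>?B. x b *\<^sub>R b) $ i = x (axis i 1)" for x :: "real^'n \<Rightarrow> real" and i
    unfolding Basis_real_vec by (subst sum.reindex[OF inj]) (simp add: axis_def if_distrib cong: if_cong)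
  have gi: "integrable lborel (g b)" for b by (simp add: g_def f)
  have [measurable]: "f i \<in> borel_measurable borel" for i using f[of i] by (auto dest: borel_measurable_integrable)
  have meas: "(\<lambda>x::real^'n. \<Prod>i\<in>UNIV. f i (x $ i)) \<in> borel_measurable borel"
    by measurable
  have eq: "(\<Prod>i\<in>UNIV. f i ((\<Sum>b\<in>?B. x b *\<^sub>R b) $ i)) = (\<Prod>b\<in>?B. g b (x b))" for x
    by (simp only: comp prod_B g_def ax)
  have I: "integrable (\<Pi>\<^sub>M b\<in>?B. lborel) (\<lambda>x. \<Prod>b\<in>?B. g b (x b))"
    by (rule product_integrable_prod) (auto intro: gi)
  show "integrable lborel (\<lambda>x::real^'n. \<Prod>i\<in>UNIV. f i (x $ i))"
    by (subst lborel_eq, subst integrable_distr_eq) (simp_all only: eq I meas, measurable)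
  have "(LINT x|lborel. (\<Prod>i\<in>UNIV. f i ((x::real^'n) $ i))) = (LINT x|(\<Pi>\<^sub>M b\<in>?B. lborel). (\<Prod>b\<in>?B. g b (x b)))"
    by (subst lborel_eq, subst integral_distr) (simp_all only: eq meas, measurable)
  also have "\<dots> = (\<Prod>b\<in>?B. LINT t|lborel. g b t)"
    by (rule product_integral_prod) (auto intro: gi)
  also have "\<dots> = (\<Prod>i\<in>UNIV. LINT t|lborel. f i t)"
    by (simp only: prod_B g_def ax)
  finally show "(LINT x|lborel. (\<Prod>i\<in>UNIV. f i ((x::real^'n) $ i))) = (\<Prod>i\<in>UNIV. LINT t|lborel. f i t)" .
qed

text \<open>One function serves as the measure of decay throughout. Its product form makes its integral
  factor, changes it by a bounded factor only under shifts by vectors of a cube, and lets it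
  be compared with both powers of the norm and \<open>Psi_symbol\<close>.\<close>
definition weight :: "real^'n::finite \<Rightarrow> real" where
  "weight x = (\<Prod>i\<in>UNIV. inverse (1 + (x $ i)\<^sup>2))"

lemma weight_pos: "0 < weight x"
  unfolding weight_def by (intro prod_pos) (auto intro: add_pos_nonneg)

lemma weight_le_1: "weight x \<le> 1"
  unfolding weight_def by (intro prod_le_1) (auto simp: inverse_le_1_iff intro: add_nonneg_nonneg)

lemma continuous_weight: "continuous_on UNIV weight"
  unfolding weight_def[abs_def]
  by (intro continuous_intros ballI) (metis add_pos_nonneg less_irrefl zero_le_power2 zero_less_one)

lemma measurable_weight [measurable]: "weight \<in> borel_measurable borel"
  by (rule borel_measurable_continuous_onI[OF continuous_weight])

lemma integrable_weight: "integrable lborel (weight :: real^'n::finite \<Rightarrow> real)"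
  unfolding weight_def[abs_def]
  using integrable_inverse_1_plus_square
  by (intro integrable_lborel_prod) (simp add: set_integrable_def)

text \<open>The weight is nearly constant on unit cubes, so its value can be replaced by its average over a
  cube, and an integral of \<open>weight\<close> against a measure by an integral against Lebesgue measure.\<close>
lemma weight_shift:
  fixes x z :: "real^'n::finite"
  assumes "\<And>i. \<bar>z $ i\<bar> \<le> 1"
  shows "weight x \<le> 3 ^ CARD('n) * weight (x + z)"
proof -
  have aux: "a \<le> 1 \<Longrightarrow> s \<le> 2 * b + 2 * a \<Longrightarrow> 0 \<le> b \<Longrightarrow> 1 + s \<le> 3 * 1 + 3 * b" for a b s :: real
    by simp
  have "weight x \<le> (\<Prod>i\<in>UNIV. 3 * inverse (1 + ((x + z) $ i)\<^sup>2))"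
    unfolding weight_def
  proof (intro prod_mono conjI)
    fix i
    have "(z $ i)\<^sup>2 \<le> 1" using assms[of i] by (simp add: abs_square_le_1)
    moreover have "(x $ i + z $ i)\<^sup>2 \<le> 2 * (x $ i)\<^sup>2 + 2 * (z $ i)\<^sup>2"
      using zero_le_power2[of "x $ i - z $ i"] by (simp add: power2_eq_square algebra_simps)
    ultimately have "1 + ((x + z) $ i)\<^sup>2 \<le> 3 * (1 + (x $ i)\<^sup>2)"

      using zero_le_power2[of "x $ i"] unfolding vector_add_component distrib_left by (intro aux)
    moreover have "0 < 1 + ((x + z) $ i)\<^sup>2" "0 < 1 + (x $ i)\<^sup>2" by (auto intro: add_pos_nonneg)
    ultimately show "inverse (1 + (x $ i)\<^sup>2) \<le> 3 * inverse (1 + ((x + z) $ i)\<^sup>2)"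
      by (simp add: field_simps)
  qed (auto intro: add_nonneg_nonneg)
  also have "\<dots> = 3 ^ CARD('n) * weight (x + z)"
    by (simp add: weight_def prod.distrib)
  finally show ?thesis .
qed

lemma one_plus_power_le:
  fixes a :: real assumes "0 \<le> a" shows "(1 + a) ^ d \<le> 2 ^ d * (1 + a ^ d)"
proof (cases "a \<le> 1")
  case True
  have "(1 + a) ^ d \<le> 2 ^ d" using True assms by (intro power_mono) auto
  moreover have "0 \<le> (2::real) ^ d * a ^ d" using assms by simp
  ultimately show ?thesis by (simp add: distrib_left)
next
  case False
  have "(1 + a) ^ d \<le> (2 * a) ^ d" using False by (intro power_mono) auto
  also have "\<dots> \<le> 2 ^ d * (1 + a ^ d)" by (simp add: power_mult_distrib)
  finally show ?thesis .
qed

lemma inverse_weight: "inverse (weight x) = (\<Prod>i\<in>UNIV. 1 + (x $ i)\<^sup>2)"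
  unfolding weight_def by (subst prod_inversef[symmetric]) (simp add: o_def)

text \<open>The Schwartz seminorms only involve powers of the norm; through this bound two of them control
  a Schwartz function by \<open>weight\<close>.\<close>
lemma inverse_weight_le_norm:
  fixes x :: "real^'n::finite"
  shows "inverse (weight x) \<le> 2 ^ CARD('n) * (1 + norm x ^ (2 * CARD('n)))"
proof -
  have "inverse (weight x) \<le> (\<Prod>i\<in>(UNIV::'n set). 1 + (norm x)\<^sup>2)"
    unfolding inverse_weight
  proof (intro prod_mono conjI)
    fix i
    have "\<bar>x $ i\<bar>\<^sup>2 \<le> (norm x)\<^sup>2" by (intro power_mono component_le_norm_cart) simp
    then show "1 + (x $ i)\<^sup>2 \<le> 1 + (norm x)\<^sup>2" by simp
  qed (auto intro: add_nonneg_nonneg)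
  also have "\<dots> \<le> 2 ^ CARD('n) * (1 + ((norm x)\<^sup>2) ^ CARD('n))"
    by (simp only: prod_constant) (rule one_plus_power_le, simp)
  finally show ?thesis by (simp add: power_mult)
qed

text \<open>Up to the factor \<open>(-1) ^ d\<close>, where \<open>d\<close> is the dimension, the polynomial by which the operator
  \<open>Psi\<close> multiplies Fourier transforms: \<open>2 * d\<close> derivatives along a coordinate contribute
  \<open>(2 * pi * \<i> * k $ i) ^ (2 * d) = (-1) ^ d * (2 * pi * k $ i) ^ (2 * d)\<close>, so that the constant
  term \<open>(-1) ^ d\<close> of \<open>Psi\<close> has the same sign and the symbol stays away from \<open>0\<close>.\<close>
definition Psi_symbol :: "real^'n::finite \<Rightarrow> real" where
  "Psi_symbol k = 1 + (\<Sum>i\<in>UNIV. (2 * pi * k $ i) ^ (2 * CARD('n)))"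

lemma Psi_symbol_ge_1: "1 \<le> Psi_symbol k"
  unfolding Psi_symbol_def by (simp add: sum_nonneg)

text \<open>The order \<open>2 * d\<close> of the operator enters here: with \<open>M\<close> the largest \<open>(k $ i)\<^sup>2\<close>, the product of
  the \<open>d\<close> factors \<open>1 + (k $ i)\<^sup>2\<close> is at most \<open>(1 + M) ^ d\<close>, and \<open>M ^ d\<close> is already dominated by one
  of the terms of the symbol.\<close>
lemma inverse_weight_le_Psi_symbol:
  fixes k :: "real^'n::finite"
  shows "inverse (weight k) \<le> 2 ^ CARD('n) * Psi_symbol k"
proof -
  define M where "M = Max (range (\<lambda>i. (k $ i)\<^sup>2))"
  have Mi: "(k $ i)\<^sup>2 \<le> M" for i unfolding M_def by (intro Max_ge) auto
  have "M \<in> range (\<lambda>i. (k $ i)\<^sup>2)" unfolding M_def by (intro Max_in) auto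
  then obtain j where j: "M = (k $ j)\<^sup>2" by auto
  have "inverse (weight k) \<le> (\<Prod>i\<in>(UNIV::'n set). 1 + M)"
    unfolding inverse_weight using Mi by (intro prod_mono) (auto intro: add_nonneg_nonneg)
  also have "\<dots> \<le> 2 ^ CARD('n) * (1 + M ^ CARD('n))"
    using j by (simp only: prod_constant) (rule one_plus_power_le, simp)
  also have "M ^ CARD('n) \<le> (\<Sum>i\<in>UNIV. (2 * pi * k $ i) ^ (2 * CARD('n)))"
  proof -
    have "M ^ CARD('n) = (1 * \<bar>k $ j\<bar>) ^ (2 * CARD('n))" using j by (simp add: power_mult)
    also have "\<dots> \<le> (2 * pi * \<bar>k $ j\<bar>) ^ (2 * CARD('n))"
      using pi_gt3 by (intro power_mono mult_right_mono) auto
    also have "\<dots> = (2 * pi * k $ j) ^ (2 * CARD('n))" by (simp add: power_mult power_mult_distrib)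
    also have "\<dots> \<le> (\<Sum>i\<in>UNIV. (2 * pi * k $ i) ^ (2 * CARD('n)))"
      by (intro member_le_sum) auto
    finally show ?thesis .
  qed
  finally show ?thesis by (simp add: Psi_symbol_def)
qed

section \<open>Schwartz functions\<close>

lemma pderivative_eq:
  assumes "(g has_derivative g') (at x)"
  shows "pderivative i g x = g' (axis i 1)"
proof -
  have "((\<lambda>t. x + t *\<^sub>R axis i 1) has_derivative (\<lambda>t. t *\<^sub>R axis i 1)) (at (0::real))"
    by (auto intro!: derivative_eq_intros)
  moreover have "(g has_derivative g') (at (x + 0 *\<^sub>R axis i 1))" using assms by simp
  ultimately have "((\<lambda>t. g (x + t *\<^sub>R axis i 1)) has_derivative (\<lambda>t. g' (t *\<^sub>R axis i 1))) (at 0)"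
    by (rule has_derivative_compose)
  moreover have "g' (t *\<^sub>R axis i 1) = t *\<^sub>R g' (axis i 1)" for t
    using has_derivative_bounded_linear[OF assms] by (simp add: linear_scale bounded_linear.linear)
  ultimately have "((\<lambda>t. g (x + t *\<^sub>R axis i 1)) has_vector_derivative g' (axis i 1)) (at 0)"
    by (simp add: has_vector_derivative_def)
  then show ?thesis by (simp add: pderivative_def vector_derivative_at)
qed

lemma has_derivative_pderivative:
  fixes g :: "real^'n::finite \<Rightarrow> complex"
  assumes "g differentiable at x"
  shows "(g has_derivative (\<lambda>h. \<Sum>i\<in>UNIV. h $ i *\<^sub>R pderivative i g x)) (at x)"
proof -
  obtain g' where g': "(g has_derivative g') (at x)" using assms by (auto simp: differentiable_def)
  then have lin: "linear g'" by (simp add: bounded_linear.linear has_derivative_bounded_linear)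
  have "g' h = (\<Sum>i\<in>UNIV. h $ i *\<^sub>R pderivative i g x)" for h
  proof -
    have "g' h = g' (\<Sum>i\<in>UNIV. h $ i *\<^sub>R axis i 1)"
      using basis_expansion[of h] by (simp add: scalar_mult_eq_scaleR)
    also have "\<dots> = (\<Sum>i\<in>UNIV. h $ i *\<^sub>R g' (axis i 1))"
      using lin by (simp add: linear_sum linear_scale)
    finally show ?thesis using pderivative_eq[OF g'] by simp
  qed
  then show ?thesis using g' by (metis (no_types, lifting) ext)
qed

lemma pderivatives_simps [simp]:
  "pderivatives [] f = f" "pderivatives (i # js) f = pderivative i (pderivatives js f)"
  "pderivatives (js @ [i]) f = pderivatives js (pderivative i f)"
  by (simp_all add: pderivatives_def)

text \<open>Membership in \<open>schwartz\<close> is a condition on all iterated derivatives. It follows from a condition on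
  first derivatives only, once a class of differentiable and rapidly decaying functions is
  known that is stable under each \<open>pderivative i\<close>. Closure properties of the Schwartz space are
  proved in this way by choosing the class, without formulas for higher derivatives.\<close>
lemma schwartz_coinduct:
  assumes "P f" "\<And>g x. P g \<Longrightarrow> g differentiable at x"
    "\<And>g k. P g \<Longrightarrow> \<exists>C. \<forall>x. norm x ^ k * cmod (g x) \<le> C"
    "\<And>g i. P g \<Longrightarrow> P (pderivative i g)"
  shows "f \<in> schwartz"
proof -
  have "P (pderivatives js f)" for js
    by (induction js) (auto intro: assms)
  then show ?thesis
    using assms(2,3) by (fastforce simp: schwartz_def bounded_iff)
qed

lemma schwartz_differentiable: "f \<in> schwartz \<Longrightarrow> f differentiable at x"
  unfolding schwartz_def by (metis (mono_tags, lifting) mem_Collect_eq pderivatives_simps(1))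

lemma schwartz_has_derivative:
  "f \<in> schwartz \<Longrightarrow> (f has_derivative (\<lambda>h. \<Sum>i\<in>UNIV. h $ i *\<^sub>R pderivative i f x)) (at x)"
  by (rule has_derivative_pderivative[OF schwartz_differentiable])

lemma schwartz_decay: "f \<in> schwartz \<Longrightarrow> \<exists>C. \<forall>x. norm x ^ k * cmod (f x) \<le> C"
proof -
  assume "f \<in> schwartz"
  then have "bounded (range (\<lambda>x. norm x ^ k * cmod (pderivatives [] f x)))"
    unfolding schwartz_def by blast
  then show ?thesis by (auto simp: bounded_iff)
qed

lemma schwartz_pderivative: "f \<in> schwartz \<Longrightarrow> pderivative i f \<in> schwartz"
  unfolding schwartz_def by (auto simp flip: pderivatives_simps(3))

lemma schwartz_pderivatives: "f \<in> schwartz \<Longrightarrow> pderivatives js f \<in> schwartz"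
  by (induction js) (auto intro: schwartz_pderivative)

lemma continuous_schwartz: "f \<in> schwartz \<Longrightarrow> continuous_on UNIV f"
  by (simp add: continuous_at_imp_continuous_on differentiable_imp_continuous_within schwartz_differentiable)

lemma measurable_schwartz [measurable_dest]: "f \<in> schwartz \<Longrightarrow> f \<in> borel_measurable borel"
  by (rule borel_measurable_continuous_onI[OF continuous_schwartz])

lemma pderivative_add:
  "f \<in> schwartz \<Longrightarrow> g \<in> schwartz \<Longrightarrow> pderivative i (\<lambda>x. f x + g x) = (\<lambda>x. pderivative i f x + pderivative i g x)"
  by (rule ext, rule trans[OF pderivative_eq[OF has_derivative_add[OF schwartz_has_derivative schwartz_has_derivative]]])
    (auto simp: axis_def if_distrib[of "\<lambda>x. x *\<^sub>R _"] cong: if_cong)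

lemma pderivative_cmult:
  assumes "f \<in> schwartz"
  shows "pderivative i (\<lambda>x. c * f x) = (\<lambda>x. c * pderivative i f x)"
proof
  fix x
  have "((\<lambda>x. c * f x) has_derivative (\<lambda>h. c * (\<Sum>i\<in>UNIV. h $ i *\<^sub>R pderivative i f x))) (at x)"
    by (intro has_derivative_mult_right schwartz_has_derivative assms)
  from pderivative_eq[OF this, of i] show "pderivative i (\<lambda>x. c * f x) x = c * pderivative i f x"
    by (simp add: axis_def if_distrib[of "\<lambda>x. x *\<^sub>R _"] cong: if_cong)
qed

lemma sum_axis_scaleR [simp]: "(\<Sum>j\<in>UNIV. (axis i (1::real)) $ j *\<^sub>R (v j :: 'b::real_vector)) = v (i::'n::finite)"
  by (simp add: axis_def if_distrib[of "\<lambda>x. x *\<^sub>R _"] cong: if_cong)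

lemma schwartz_add:
  assumes "f \<in> schwartz" "g \<in> schwartz" shows "(\<lambda>x. f x + g x) \<in> schwartz"
proof -
  define P where "P h \<longleftrightarrow> (\<exists>a\<in>schwartz. \<exists>b\<in>schwartz. h = (\<lambda>x. a x + b x))" for h :: "'a cfun"
  have "P (\<lambda>x. f x + g x)" using assms by (auto simp: P_def)
  then show ?thesis
  proof (rule schwartz_coinduct[where P=P])
    fix h x assume "P h" then show "h differentiable at x" unfolding P_def
      by (elim bexE) (simp, intro differentiable_add schwartz_differentiable; assumption)
  next
    fix h and k :: nat assume "P h"
    then obtain a b where ab: "a \<in> schwartz" "b \<in> schwartz" "h = (\<lambda>x. a x + b x)" by (auto simp: P_def)
    obtain A B where A: "\<And>x. norm x ^ k * cmod (a x) \<le> A" and B: "\<And>x. norm x ^ k * cmod (b x) \<le> B"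
      using schwartz_decay[OF ab(1)] schwartz_decay[OF ab(2)] by meson
    have "norm x ^ k * cmod (h x) \<le> A + B" for x
    proof -
      have "norm x ^ k * cmod (h x) \<le> norm x ^ k * (cmod (a x) + cmod (b x))"
        unfolding ab by (intro mult_left_mono norm_triangle_ineq) auto
      then show ?thesis using A[of x] B[of x] by (simp add: distrib_left)
    qed
    then show "\<exists>C. \<forall>x. norm x ^ k * cmod (h x) \<le> C" by blast
  next
    fix h i assume "P h" then show "P (pderivative i h)"
      by (auto simp: P_def pderivative_add intro!: bexI schwartz_pderivative)
  qed
qed

lemma schwartz_cmult:
  assumes "f \<in> schwartz" shows "(\<lambda>x. c * f x) \<in> schwartz"
proof -
  define P where "P h \<longleftrightarrow> (\<exists>a\<in>schwartz. h = (\<lambda>x. c * a x))" for h :: "'a cfun"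
  have "P (\<lambda>x. c * f x)" using assms by (auto simp: P_def)
  then show ?thesis
  proof (rule schwartz_coinduct[where P=P])
    fix h x assume "P h" then show "h differentiable at x"
      by (auto simp: P_def intro!: differentiable_mult[OF differentiable_const schwartz_differentiable])
  next
    fix h and k :: nat assume "P h"
    then obtain a where a: "a \<in> schwartz" "h = (\<lambda>x. c * a x)" by (auto simp: P_def)
    obtain A where A: "\<And>x. norm x ^ k * cmod (a x) \<le> A"
      using schwartz_decay[OF a(1)] by meson
    have "norm x ^ k * cmod (h x) \<le> cmod c * A" for x
      using mult_left_mono[OF A[of x], of "cmod c"] by (simp add: a norm_mult mult_ac)
    then show "\<exists>C. \<forall>x. norm x ^ k * cmod (h x) \<le> C" by blast
  next
    fix h i assume "P h" then show "P (pderivative i h)"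
      by (auto simp: P_def pderivative_cmult intro!: bexI schwartz_pderivative)
  qed
qed

lemma pderivative_times_coordinate:
  assumes "a \<in> schwartz"
  shows "pderivative i (\<lambda>x. of_real (x $ j) * a x) = (\<lambda>x. of_real (x $ j) * pderivative i a x + (if i = j then 1 else 0) * a x)"
    and "(\<lambda>x. of_real (x $ j) * a x) differentiable at x"
proof -
  have D: "((\<lambda>x. of_real (x $ j) * a x) has_derivative (\<lambda>h. of_real (x $ j) * (\<Sum>i\<in>UNIV. h $ i *\<^sub>R pderivative i a x) + of_real (h $ j) * a x)) (at x)" for x
    by (rule has_derivative_mult)
      (auto intro!: schwartz_has_derivative assms bounded_linear.has_derivative[OF bounded_linear_of_real bounded_linear_imp_has_derivative[OF bounded_linear_vec_nth]])
  show "(\<lambda>x. of_real (x $ j) * a x) differentiable at x" using D by (auto simp: differentiable_def)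
  show "pderivative i (\<lambda>x. of_real (x $ j) * a x) = (\<lambda>x. of_real (x $ j) * pderivative i a x + (if i = j then 1 else 0) * a x)"
    by (rule ext, rule trans[OF pderivative_eq[OF D]]) (auto simp: axis_def[of i 1] if_distrib[of "\<lambda>x. x *\<^sub>R _"] cong: if_cong)
qed

text \<open>By the product rule the functions \<open>x $ j * a x\<close> alone are not stable under differentiation; the
  functions \<open>x $ j * a x + b x\<close> are.\<close>
lemma schwartz_times_coordinate:
  assumes "f \<in> schwartz" shows "(\<lambda>x. of_real (x $ j) * f x) \<in> schwartz"
proof -
  define P where "P h \<longleftrightarrow> (\<exists>a\<in>schwartz. \<exists>b\<in>schwartz. h = (\<lambda>x. of_real (x $ j) * a x + b x))" for h :: "'a cfun"
  have z: "(\<lambda>x::real^'a. 0) \<in> schwartz" using schwartz_cmult[OF assms, of 0] unfolding mult_zero_left .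
  have "P (\<lambda>x. of_real (x $ j) * f x)" unfolding P_def
    by (rule bexI[OF _ assms], rule bexI[OF _ z]) simp
  then show ?thesis
  proof (rule schwartz_coinduct[where P=P])
    fix h x assume "P h" then show "h differentiable at x"unfolding P_def
      by (elim bexE) (simp, intro differentiable_add schwartz_differentiable pderivative_times_coordinate; assumption)
  next
    fix h and k :: nat assume "P h"
    then obtain a b where ab: "a \<in> schwartz" "b \<in> schwartz" "h = (\<lambda>x. of_real (x $ j) * a x + b x)" by (auto simp: P_def)
    obtain A B where A: "\<And>x. norm x ^ Suc k * cmod (a x) \<le> A" and B: "\<And>x. norm x ^ k * cmod (b x) \<le> B"
      using schwartz_decay[OF ab(1)] schwartz_decay[OF ab(2)] by meson
    have "norm x ^ k * cmod (h x) \<le> A + B" for x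
    proof -
      have "cmod (h x) \<le> \<bar>x $ j\<bar> * cmod (a x) + cmod (b x)"
        unfolding ab by (rule order_trans[OF norm_triangle_ineq]) (simp add: norm_mult)
      also have "\<dots> \<le> norm x * cmod (a x) + cmod (b x)"
        by (intro add_right_mono mult_right_mono component_le_norm_cart) auto
      finally have "norm x ^ k * cmod (h x) \<le> norm x ^ k * (norm x * cmod (a x) + cmod (b x))"
        by (intro mult_left_mono) auto
      then show ?thesis using A[of x] B[of x] by (simp add: distrib_left mult_ac)
    qed
    then show "\<exists>C. \<forall>x. norm x ^ k * cmod (h x) \<le> C" by blast
  next
    fix h i assume "P h"
    then obtain a b where ab: "a \<in> schwartz" "b \<in> schwartz" "h = (\<lambda>x. of_real (x $ j) * a x + b x)" by (auto simp: P_def)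
    have D: "(h has_derivative (\<lambda>v. (\<Sum>i\<in>UNIV. v $ i *\<^sub>R pderivative i (\<lambda>x. of_real (x $ j) * a x) x) + (\<Sum>i\<in>UNIV. v $ i *\<^sub>R pderivative i b x))) (at x)" for x
      unfolding ab(3) by (intro has_derivative_add has_derivative_pderivative pderivative_times_coordinate schwartz_differentiable ab)
    have "pderivative i h = (\<lambda>x. of_real (x $ j) * pderivative i a x + ((if i = j then 1 else 0) * a x + pderivative i b x))"
      by (rule ext, rule trans[OF pderivative_eq[OF D]]) (simp add: pderivative_times_coordinate ab)
    then show "P (pderivative i h)" unfolding P_def
      by (intro bexI[of _ "pderivative i a"] bexI[of _ "\<lambda>x. (if i = j then 1 else 0) * a x + pderivative i b x"])
        (auto intro!: schwartz_add schwartz_cmult schwartz_pderivative ab)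
  qed
qed

lemma pderivative_reflect:
  assumes "a \<in> schwartz"
  shows "pderivative i (\<lambda>y. a (x - y)) = (\<lambda>y. - pderivative i a (x - y))"
    and "(\<lambda>y. a (x - y)) differentiable at y"
proof -
  have D: "((\<lambda>y. a (x - y)) has_derivative (\<lambda>h. \<Sum>i\<in>UNIV. (-h) $ i *\<^sub>R pderivative i a (x - y))) (at y)" for y
    by (rule has_derivative_compose[where f="\<lambda>y. x - y" and g=a])
      (auto intro!: derivative_eq_intros schwartz_has_derivative assms)
  show "(\<lambda>y. a (x - y)) differentiable at y" using D by (auto simp: differentiable_def)
  show "pderivative i (\<lambda>y. a (x - y)) = (\<lambda>y. - pderivative i a (x - y))"
    by (rule ext, rule trans[OF pderivative_eq[OF D]]) (simp add: sum_negf)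
qed

lemma schwartz_reflect:
  assumes "f \<in> schwartz" shows "(\<lambda>y. f (x - y)) \<in> schwartz"
proof -
  define P where "P h \<longleftrightarrow> (\<exists>a\<in>schwartz. h = (\<lambda>y. a (x - y)))" for h :: "'a cfun"
  have "P (\<lambda>y. f (x - y))" using assms by (auto simp: P_def)
  then show ?thesis
  proof (rule schwartz_coinduct[where P=P])
    fix h x assume "P h" then show "h differentiable at x" by (auto simp: P_def intro!: pderivative_reflect)
  next
    fix h and k :: nat assume "P h"
    then obtain a where a: "a \<in> schwartz" "h = (\<lambda>y. a (x - y))" by (auto simp: P_def)
    obtain A A0 where A: "\<And>x. norm x ^ k * cmod (a x) \<le> A" and A0: "\<And>x. norm x ^ 0 * cmod (a x) \<le> A0"
      using schwartz_decay[OF a(1)] by meson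
    have "norm y ^ k * cmod (h y) \<le> 2 ^ k * (norm x ^ k * A0 + A)" for y
    proof -
      have "norm y \<le> norm x + norm (x - y)" using norm_triangle_ineq4[of x "x - y"] by simp
      then have "norm y ^ k \<le> (2 * max (norm x) (norm (x - y))) ^ k" by (intro power_mono) auto
      also have "\<dots> \<le> 2 ^ k * (norm x ^ k + norm (x - y) ^ k)"
        by (auto simp: power_mult_distrib max_def)
      finally have "norm y ^ k * cmod (a (x - y)) \<le> 2 ^ k * (norm x ^ k + norm (x - y) ^ k) * cmod (a (x - y))"
        by (rule mult_right_mono) simp
      also have "\<dots> = 2 ^ k * (norm x ^ k * cmod (a (x - y)) + norm (x - y) ^ k * cmod (a (x - y)))"
        by (simp add: algebra_simps)
      also have "\<dots> \<le> 2 ^ k * (norm x ^ k * A0 + A)"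
        using A[of "x - y"] A0[of "x - y"] by (intro mult_left_mono add_mono) auto
      finally show ?thesis by (simp add: a)
    qed
    then show "\<exists>C. \<forall>x. norm x ^ k * cmod (h x) \<le> C" by blast
  next
    fix h i assume "P h"
    then obtain a where a: "a \<in> schwartz" "h = (\<lambda>y. a (x - y))" by (auto simp: P_def)
    have "(\<lambda>z. - pderivative i a z) \<in> schwartz"
      using schwartz_cmult[OF schwartz_pderivative[OF a(1)], of "-1"] by simp
    then show "P (pderivative i h)" unfolding P_def by (rule bexI[rotated]) (simp add: a pderivative_reflect)
  qed
qed

section \<open>Integrals of Schwartz functions\<close>

lemma schwartz_seminorm_upper:
  assumes "f \<in> schwartz"
  shows "norm x ^ k * cmod (pderivatives js f x) \<le> schwartz_seminorm k js f"
  unfolding schwartz_seminorm_def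
proof (rule cSUP_upper)
  show "bdd_above (range (\<lambda>x. norm x ^ k * cmod (pderivatives js f x)))"
    using assms unfolding schwartz_def by (intro bounded_imp_bdd_above) blast
qed simp

lemma schwartz_seminorm_nonneg:
  assumes "f \<in> schwartz" shows "0 \<le> schwartz_seminorm k js f"
  by (rule order_trans[OF _ schwartz_seminorm_upper[OF assms, of 0]]) simp

definition weight_norm :: "'n::finite cfun \<Rightarrow> real" where
  "weight_norm f = 2 ^ CARD('n) * (schwartz_seminorm 0 [] f + schwartz_seminorm (2 * CARD('n)) [] f)"

lemma weight_norm_nonneg: "f \<in> schwartz \<Longrightarrow> 0 \<le> weight_norm f"
  by (simp add: weight_norm_def schwartz_seminorm_nonneg)

lemma schwartz_le_weight:
  fixes f :: "'n::finite cfun"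
  assumes "f \<in> schwartz" shows "cmod (f x) \<le> weight_norm f * weight x"
proof -
  have "cmod (f x) * inverse (weight x) \<le> cmod (f x) * (2 ^ CARD('n) * (1 + norm x ^ (2 * CARD('n))))"
    by (intro mult_left_mono inverse_weight_le_norm) simp
  also have "\<dots> = 2 ^ CARD('n) * (norm x ^ 0 * cmod (pderivatives [] f x) + norm x ^ (2 * CARD('n)) * cmod (pderivatives [] f x))"
    by (simp add: algebra_simps)
  also have "\<dots> \<le> weight_norm f" unfolding weight_norm_def
    by (intro mult_left_mono add_mono schwartz_seminorm_upper assms) simp
  finally show ?thesis using weight_pos[of x] by (simp add: field_simps)
qed

lemma integrable_schwartz:
  assumes "f \<in> schwartz" shows "integrable lborel f"
proof (rule Bochner_Integration.integrable_bound)
  show "integrable lborel (\<lambda>x::real^'a. weight_norm f * weight x)" by (simp add: integrable_weight)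
  show "f \<in> borel_measurable lborel" using measurable_schwartz[OF assms] by simp
  show "AE x in lborel. norm (f x) \<le> norm (weight_norm f * weight x)"
    using schwartz_le_weight[OF assms] by (auto intro!: AE_I2 intro: order_trans abs_ge_self)
qed

lemma integral_schwartz_le:
  fixes f :: "'n::finite cfun"
  assumes "f \<in> schwartz"
  shows "(LINT x|lborel. cmod (f x)) \<le> (LINT x|lborel. weight (x::real^'n)) * weight_norm f"
proof -
  have "(LINT x|lborel. cmod (f x)) \<le> (LINT x|lborel. weight_norm f * weight (x::real^'n))"
    by (intro Bochner_Integration.integral_mono integrable_norm integrable_schwartz assms schwartz_le_weight) (simp add: integrable_weight)
  then show ?thesis by (simp add: mult.commute)
qed

lemma lborel_affine_integral:
  fixes f :: "'a::euclidean_space \<Rightarrow> 'b::{banach, second_countable_topology}"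
  assumes [measurable]: "f \<in> borel_measurable borel" and c: "c \<noteq> 0"
  shows integrable_lborel_affine: "integrable lborel (\<lambda>x. f (t + c *\<^sub>R x)) \<longleftrightarrow> integrable lborel f"
    and integral_lborel_affine: "(LINT x|lborel. f x) = \<bar>c\<bar> ^ DIM('a) *\<^sub>R (LINT x|lborel. f (t + c *\<^sub>R x))"
proof -
  have "integrable lborel f \<longleftrightarrow> integrable (density (distr lborel borel (\<lambda>x. t + c *\<^sub>R x)) (\<lambda>_. \<bar>c\<bar> ^ DIM('a))) f"
    using lborel_affine[OF c, of t] by simp
  also have "\<dots> \<longleftrightarrow> integrable lborel (\<lambda>x. f (t + c *\<^sub>R x))"
  proof -
    have "integrable lborel (\<lambda>x. f (t + c *\<^sub>R x))" if "integrable lborel (\<lambda>x. \<bar>c\<bar> ^ DIM('a) *\<^sub>R f (t + c *\<^sub>R x))"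
      using integrable_scaleR_right[of "inverse (\<bar>c\<bar> ^ DIM('a))", OF that] c by simp
    then show ?thesis
      by (subst integrable_density) (auto simp: integrable_distr_eq)
  qed
  finally show "integrable lborel (\<lambda>x. f (t + c *\<^sub>R x)) \<longleftrightarrow> integrable lborel f" ..
  have "(LINT x|lborel. f x) = (LINT x|density (distr lborel borel (\<lambda>x. t + c *\<^sub>R x)) (\<lambda>_. \<bar>c\<bar> ^ DIM('a)). f x)"
    using lborel_affine[OF c, of t] by simp
  also have "\<dots> = \<bar>c\<bar> ^ DIM('a) *\<^sub>R (LINT x|lborel. f (t + c *\<^sub>R x))"
    by (subst integral_density) (auto simp: integral_distr)
  finally show "(LINT x|lborel. f x) = \<bar>c\<bar> ^ DIM('a) *\<^sub>R (LINT x|lborel. f (t + c *\<^sub>R x))" .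
qed

text \<open>All exchanges of Bochner integrals below have a dominating function that is a product of two integrable
  functions of one variable each, which makes joint integrability immediate.\<close>
lemma dominated_by_product:
  fixes F :: "'a \<Rightarrow> 'b \<Rightarrow> 'c::{banach, second_countable_topology}" and a b :: "_ \<Rightarrow> real"
  assumes "sigma_finite_measure M" "sigma_finite_measure N"
    and F: "case_prod F \<in> borel_measurable (M \<Otimes>\<^sub>M N)" and a: "integrable M a" and b: "integrable N b"
    and bound: "\<And>x y. x \<in> space M \<Longrightarrow> y \<in> space N \<Longrightarrow> norm (F x y) \<le> a x * b y"
  shows integrable_pair_dominated: "integrable (M \<Otimes>\<^sub>M N) (case_prod F)"
    and Fubini_dominated: "(LINT x|M. LINT y|N. F x y) = (LINT y|N. LINT x|M. F x y)"
proof -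
  interpret M: sigma_finite_measure M by fact
  interpret N: sigma_finite_measure N by fact
  interpret pair_sigma_finite M N ..
  have [measurable]: "a \<in> borel_measurable M" "b \<in> borel_measurable N" using a b by auto
  have "integrable (M \<Otimes>\<^sub>M N) (\<lambda>(x, y). a x * b y)"
  proof (rule Fubini_integrable)
    show "integrable M (\<lambda>x. LINT y|N. norm (case (x, y) of (x, y) \<Rightarrow> a x * b y))"
      using a by (simp add: abs_mult integrable_abs)
    show "AE x in M. integrable N (\<lambda>y. case (x, y) of (x, y) \<Rightarrow> a x * b y)"
      using b by simp
  qed measurable
  then show I: "integrable (M \<Otimes>\<^sub>M N) (case_prod F)"
    by (rule Bochner_Integration.integrable_bound[OF _ F])
      (auto intro!: AE_I2 order_trans[OF bound] simp: space_pair_measure)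
  show "(LINT x|M. LINT y|N. F x y) = (LINT y|N. LINT x|M. F x y)"
    by (rule Fubini_integral[OF I, symmetric])
qed

text \<open>The difference quotients of \<open>g\<close> have integral \<open>0\<close> by translation invariance. They converge to
  the derivative, and the mean value theorem together with the near constancy of \<open>weight\<close> on unit
  cubes dominates them by a multiple of \<open>weight\<close>.\<close>
lemma integral_pderivative_schwartz:
  assumes g: "g \<in> schwartz"
  shows "(LINT x|lborel. pderivative i g x) = 0"
proof (rule LIMSEQ_unique)
  let ?e = "axis i (1::real)" and ?h = "pderivative i g"
  define q where "q n y = (g (y + inverse (real (Suc n)) *\<^sub>R ?e) - g y) /\<^sub>R inverse (real (Suc n))" for n y
  note [measurable] = measurable_schwartz[OF g] measurable_schwartz[OF schwartz_pderivative[OF g]]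
  have D: "((\<lambda>t. g (y + t *\<^sub>R ?e)) has_derivative (\<lambda>s. s *\<^sub>R ?h (y + t *\<^sub>R ?e))) (at t)" for y t
    by (rule has_derivative_compose[where f="\<lambda>t. y + t *\<^sub>R ?e" and g=g, THEN has_derivative_eq_rhs])
      (auto intro!: derivative_eq_intros schwartz_has_derivative g
        simp: vector_scaleR_component scaleR_scaleR[symmetric] scaleR_sum_right[symmetric] simp del: scaleR_scaleR)
  have shift: "(LINT y|lborel. g (y + z)) = (LINT y|lborel. g y)" "integrable lborel (\<lambda>y. g (y + z))" for z
    using integral_lborel_affine[of g 1 z] integrable_lborel_affine[of g 1 z] integrable_schwartz[OF g]
    by (simp_all add: add.commute)
  show "(\<lambda>n. LINT y|lborel. q n y) \<longlonglongrightarrow> (LINT x|lborel. ?h x)"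
  proof (rule integral_dominated_convergence)
    \<comment> \<open>The factor \<open>3 ^ d\<close> pays for moving the intermediate point back to \<open>y\<close>.\<close>
    let ?C = "weight_norm ?h * 3 ^ CARD('a)"
    show "integrable lborel (\<lambda>y::real^'a. ?C * weight y)" by (simp add: integrable_weight)
    show "AE y in lborel. (\<lambda>n. q n y) \<longlonglongrightarrow> ?h y"
    proof (rule AE_I2)
      fix y
      have "((\<lambda>t. norm (g (y + t *\<^sub>R ?e) - g y - t *\<^sub>R ?h y) / norm t) \<longlongrightarrow> 0) (at 0)"
        using D[of y 0] by (simp add: has_derivative_iff_norm)
      moreover have "eventually (\<lambda>t. norm (g (y + t *\<^sub>R ?e) - g y - t *\<^sub>R ?h y) / norm t = norm ((g (y + t *\<^sub>R ?e) - g y) /\<^sub>R t - ?h y)) (at 0)"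
      proof (rule eventually_at_filter[THEN iffD2], intro always_eventually allI impI)
        fix t :: real assume "t \<noteq> 0"
        then have "(g (y + t *\<^sub>R ?e) - g y) /\<^sub>R t - ?h y = (g (y + t *\<^sub>R ?e) - g y - t *\<^sub>R ?h y) /\<^sub>R t"
          by (simp add: scaleR_diff_right)
        then show "norm (g (y + t *\<^sub>R ?e) - g y - t *\<^sub>R ?h y) / norm t = norm ((g (y + t *\<^sub>R ?e) - g y) /\<^sub>R t - ?h y)"
          by (simp add: divide_inverse mult.commute)
      qed
      ultimately have "((\<lambda>t. norm ((g (y + t *\<^sub>R ?e) - g y) /\<^sub>R t - ?h y)) \<longlongrightarrow> 0) (at 0)"
        by (rule Lim_transform_eventually)
      then have "((\<lambda>t. (g (y + t *\<^sub>R ?e) - g y) /\<^sub>R t) \<longlongrightarrow> ?h y) (at 0)"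
        by (simp only: tendsto_norm_zero_iff LIM_zero_iff)
      moreover have "filterlim (\<lambda>n. inverse (real (Suc n))) (at 0) sequentially"
        unfolding filterlim_at by (intro conjI LIMSEQ_inverse_real_of_nat) auto
      ultimately show "(\<lambda>n. q n y) \<longlonglongrightarrow> ?h y"
        unfolding q_def by (rule filterlim_compose)
    qed
    show "AE y in lborel. norm (q n y) \<le> ?C * weight y" for n
    proof (rule AE_I2)
      fix y
      let ?t = "inverse (real (Suc n))"
      have t: "0 < ?t" "?t \<le> 1" by (auto simp: inverse_le_1_iff)
      have "\<exists>s\<in>{0<..<?t}. norm (g (y + ?t *\<^sub>R ?e) - g (y + 0 *\<^sub>R ?e)) \<le> norm ((?t - 0) *\<^sub>R ?h (y + s *\<^sub>R ?e))"
      proof (rule mvt_general[OF t(1)])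
        show "continuous_on {0..?t} (\<lambda>t. g (y + t *\<^sub>R ?e))"
          using D by (meson continuous_at_imp_continuous_on has_derivative_continuous)
      qed (rule D)
      then obtain s where s: "0 < s" "s < ?t"
        and le: "norm (g (y + ?t *\<^sub>R ?e) - g y) \<le> ?t * norm (?h (y + s *\<^sub>R ?e))" using t by auto
      have "norm (q n y) = norm (g (y + ?t *\<^sub>R ?e) - g y) / ?t"
        using t by (simp add: q_def divide_inverse mult.commute)
      also have "\<dots> \<le> norm (?h (y + s *\<^sub>R ?e))" using le t(1) by (simp add: pos_divide_le_eq mult.commute)
      also have "\<dots> \<le> weight_norm ?h * weight (y + s *\<^sub>R ?e)"
        by (rule schwartz_le_weight[OF schwartz_pderivative[OF g]])
      also have "\<dots> \<le> weight_norm ?h * (3 ^ CARD('a) * weight (y + s *\<^sub>R ?e + (- s) *\<^sub>R ?e))"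
        using s t by (intro mult_left_mono weight_shift weight_norm_nonneg schwartz_pderivative g) (auto simp: axis_def)
      finally show "norm (q n y) \<le> ?C * weight y" by simp
    qed
  qed (simp_all add: q_def)
  have "(LINT y|lborel. q n y) = 0" for n
    unfolding q_def using shift integrable_schwartz[OF g] by simp
  then show "(\<lambda>n. LINT y|lborel. q n y) \<longlonglongrightarrow> 0" by simp
qed

section \<open>The Fourier transform on the Schwartz space\<close>

definition ee :: "real \<Rightarrow> complex" where "ee t = cis (2 * pi * t)"

lemma ee_0 [simp]: "ee 0 = 1" and norm_ee [simp]: "cmod (ee t) = 1"
  and ee_add: "ee (s + t) = ee s * ee t" and cnj_ee: "cnj (ee t) = ee (- t)"
  by (simp_all add: ee_def cis_mult distrib_left cis_cnj)

lemma ee_diff: "ee (s - t) = ee s * ee (- t)"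
  using ee_add[of s "- t"] by simp

lemma exp_eq_ee: "exp (- 2 * complex_of_real pi * \<i> * complex_of_real t) = ee (- t)"
  by (simp add: ee_def cis_conv_exp mult_ac)

lemma continuous_ee: "continuous_on A ee"
  unfolding ee_def[abs_def] cis_conv_exp by (intro continuous_intros)

lemma measurable_ee [measurable]: "ee \<in> borel_measurable borel"
  by (rule borel_measurable_continuous_onI[OF continuous_ee])

lemma ee_approx: "cmod (ee t - 1 - 2 * pi * \<i> * t) \<le> (2 * pi * t)\<^sup>2 / 2"
  using iexp_approx1[of "2 * pi * t" 1]
  by (simp add: ee_def cis_conv_exp algebra_simps numeral_2_eq_2)

lemma ee_has_derivative:
  "((\<lambda>y. ee (- (x \<bullet> y))) has_derivative (\<lambda>h. - 2 * pi * \<i> * (x \<bullet> h) * ee (- (x \<bullet> y)))) (at y)"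
proof -
  have "((\<lambda>y. \<i> * of_real (2 * pi * (- (x \<bullet> y)))) has_derivative (\<lambda>h. \<i> * of_real (2 * pi * (- (x \<bullet> h))))) (at y)"
    by (intro has_derivative_mult_right bounded_linear.has_derivative[OF bounded_linear_of_real])
      (auto intro!: derivative_eq_intros)
  from has_derivative_compose[OF this DERIV_exp[unfolded has_field_derivative_def]]
  show ?thesis unfolding ee_def cis_conv_exp by (simp add: mult_ac)
qed

lemma fourier_eq: "fourier f x = (LINT y|lborel. ee (- (x \<bullet> y)) * f y)"
  unfolding fourier_def exp_eq_ee ..

lemma integrable_ee_mult:
  assumes [measurable]: "f \<in> borel_measurable borel" "g \<in> borel_measurable borel"
    and "integrable lborel (f :: real^'n::finite \<Rightarrow> complex)"
  shows "integrable lborel (\<lambda>y. ee (g y) * f y)"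
  by (intro Bochner_Integration.integrable_bound[OF assms(3)]) (auto simp: norm_mult)

lemma integrable_ee_schwartz:
  assumes "f \<in> schwartz" "g \<in> borel_measurable borel"
  shows "integrable lborel (\<lambda>y. ee (g y) * f y)"
  using assms by (intro integrable_ee_mult measurable_schwartz integrable_schwartz)

lemma cmod_fourier_le: "f \<in> schwartz \<Longrightarrow> cmod (fourier f x) \<le> (LINT y|lborel. cmod (f y))"
  unfolding fourier_eq by (rule order_trans[OF integral_norm_bound]) (simp add: norm_mult)

lemma fourier_cmult: "fourier (\<lambda>y. c * f y) x = c * fourier f x"
proof -
  have "fourier (\<lambda>y. c * f y) x = (LINT y|lborel. c * (ee (- (x \<bullet> y)) * f y))"
    unfolding fourier_eq by (intro arg_cong[where f="integral\<^sup>L lborel"]) (auto simp: mult_ac)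
  then show ?thesis by (simp add: fourier_eq)
qed

lemma fourier_add:
  "f \<in> schwartz \<Longrightarrow> g \<in> schwartz \<Longrightarrow> fourier (\<lambda>y. f y + g y) x = fourier f x + fourier g x"
  unfolding fourier_eq by (simp add: distrib_left integrable_ee_schwartz)

text \<open>The derivative of a modulated Schwartz function, together with the vanishing of its integral,
  yields the action of the Fourier transform on derivatives.\<close>
lemma ee_mult_schwartz:
  assumes "f \<in> schwartz" shows "(\<lambda>y. ee (- (x \<bullet> y)) * f y) \<in> schwartz"
    and "pderivative i (\<lambda>y. ee (- (x \<bullet> y)) * f y) = (\<lambda>y. ee (- (x \<bullet> y)) * (pderivative i f y - 2 * pi * \<i> * x $ i * f y))"
proof -
  have D: "((\<lambda>y. ee (- (x \<bullet> y)) * a y) has_derivative (\<lambda>h. ee (- (x \<bullet> y)) * (\<Sum>i\<in>UNIV. h $ i *\<^sub>R pderivative i a y) + (- 2 * pi * \<i> * (x \<bullet> h) * ee (- (x \<bullet> y))) * a y)) (at y)"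
    if "a \<in> schwartz" for a y
    by (rule has_derivative_mult[OF ee_has_derivative schwartz_has_derivative[OF that]])
  have E: "pderivative i (\<lambda>y. ee (- (x \<bullet> y)) * a y) = (\<lambda>y. ee (- (x \<bullet> y)) * (pderivative i a y - 2 * pi * \<i> * x $ i * a y))"
    if "a \<in> schwartz" for a i
    by (rule ext, rule trans[OF pderivative_eq[OF D[OF that]]]) (simp add: inner_axis algebra_simps)
  show "pderivative i (\<lambda>y. ee (- (x \<bullet> y)) * f y) = (\<lambda>y. ee (- (x \<bullet> y)) * (pderivative i f y - 2 * pi * \<i> * x $ i * f y))"
    by (rule E[OF assms])
  define P where "P h \<longleftrightarrow> (\<exists>a\<in>schwartz. h = (\<lambda>y. ee (- (x \<bullet> y)) * a y))" for h :: "'a cfun"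
  have "P (\<lambda>y. ee (- (x \<bullet> y)) * f y)" using assms by (auto simp: P_def)
  then show "(\<lambda>y. ee (- (x \<bullet> y)) * f y) \<in> schwartz"
  proof (rule schwartz_coinduct[where P=P])
    fix h y assume "P h" then show "h differentiable at y"
      unfolding P_def differentiable_def using D by blast
  next
    fix h and k :: nat assume "P h"
    then obtain a where "a \<in> schwartz" "h = (\<lambda>y. ee (- (x \<bullet> y)) * a y)" by (auto simp: P_def)
    then show "\<exists>C. \<forall>x. norm x ^ k * cmod (h x) \<le> C"
      using schwartz_decay[of a k] by (simp add: norm_mult)
  next
    fix h i assume "P h"
    then obtain a where a: "a \<in> schwartz" "h = (\<lambda>y. ee (- (x \<bullet> y)) * a y)" by (auto simp: P_def)
    show "P (pderivative i h)"
      unfolding P_def a(2) E[OF a(1)]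
      using schwartz_add[OF schwartz_pderivative[OF a(1), of i] schwartz_cmult[OF a(1), of "- (2 * pi * \<i> * x $ i)"]]
      by (intro bexI[of _ "\<lambda>y. pderivative i a y - 2 * pi * \<i> * x $ i * a y"]) (simp_all)
  qed
qed

lemma fourier_pderivative:
  assumes f: "f \<in> schwartz"
  shows "fourier (pderivative i f) x = 2 * pi * \<i> * x $ i * fourier f x"
proof -
  have "0 = (LINT y|lborel. ee (- (x \<bullet> y)) * (pderivative i f y - 2 * pi * \<i> * x $ i * f y))"
    using integral_pderivative_schwartz[OF ee_mult_schwartz(1)[OF f, of x], of i]
    unfolding ee_mult_schwartz(2)[OF f] by simp
  also have "\<dots> = (LINT y|lborel. ee (- (x \<bullet> y)) * pderivative i f y - (2 * pi * \<i> * x $ i) * (ee (- (x \<bullet> y)) * f y))"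
    by (simp add: algebra_simps)
  also have "\<dots> = fourier (pderivative i f) x - (2 * pi * \<i> * x $ i) * fourier f x"
    unfolding fourier_eq
    by (subst Bochner_Integration.integral_diff) (auto intro!: integrable_ee_schwartz integrable_mult_right f schwartz_pderivative)
  finally show ?thesis by simp
qed

text \<open>Differentiation under the integral sign: \<open>ee_approx\<close> bounds the remainder of first order of the
  character by a multiple of \<open>(norm (z - x))\<^sup>2 * (norm y)\<^sup>2\<close>, and \<open>(norm y)\<^sup>2 * f y\<close> is integrable.\<close>
lemma pderivative_fourier:
  fixes f :: "'n::finite cfun"
  assumes f: "f \<in> schwartz"
  shows "fourier f differentiable at x"
    and "pderivative i (fourier f) = fourier (\<lambda>y. - 2 * pi * \<i> * (y $ i * f y))"
proof -
  define g where "g i y = - 2 * pi * \<i> * (y $ i * f y)" for i y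
  have g: "g i \<in> schwartz" for i
    unfolding g_def by (intro schwartz_cmult schwartz_times_coordinate f)
  have D: "(fourier f has_derivative (\<lambda>h. \<Sum>i\<in>UNIV. h $ i *\<^sub>R fourier (g i) x)) (at x)" for x
  proof (rule has_derivativeI_sandwich[of 1])
    define I where "I = (LINT y|lborel. (norm y)\<^sup>2 * cmod (f y))"
    have intI: "integrable lborel (\<lambda>y. (norm y)\<^sup>2 * cmod (f y))"
    proof -
      have "(norm y)\<^sup>2 * cmod (f y) = (\<Sum>i\<in>UNIV. cmod (y $ i * (y $ i * f y)))" for y
        unfolding power2_norm_eq_inner inner_vec_def
        by (simp add: sum_distrib_right norm_mult mult.assoc[symmetric] abs_mult_self_eq)
      then show ?thesis
        by (auto intro!: Bochner_Integration.integrable_sum integrable_norm integrable_schwartz schwartz_times_coordinate f)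
    qed
    show "bounded_linear (\<lambda>h. \<Sum>i\<in>UNIV. h $ i *\<^sub>R fourier (g i) x)"
      by (intro bounded_linear_sum bounded_linear_scaleR_const[OF bounded_linear_vec_nth])
    show "((\<lambda>z. 2 * pi\<^sup>2 * I * norm (z - x)) \<longlongrightarrow> 0) (at x)"
      by (auto intro!: tendsto_eq_intros)
    fix z assume "z \<noteq> x"
    have eq: "fourier f z - fourier f x - (\<Sum>i\<in>UNIV. (z - x) $ i *\<^sub>R fourier (g i) x)
       = (LINT y|lborel. ee (- (x \<bullet> y)) * f y * (ee (- ((z - x) \<bullet> y)) - 1 - 2 * pi * \<i> * (- ((z - x) \<bullet> y))))"
    proof -
      have s: "(\<Sum>i\<in>UNIV. (z - x) $ i *\<^sub>R fourier (g i) x) = (LINT y|lborel. (\<Sum>i\<in>UNIV. (z - x) $ i *\<^sub>R (ee (- (x \<bullet> y)) * g i y)))"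
        unfolding fourier_eq
        by (subst Bochner_Integration.integral_sum) (auto intro!: integrable_ee_schwartz integrable_scaleR_right g)
      have I1: "integrable lborel (\<lambda>y. ee (- (w \<bullet> y)) * f y)" for w
        by (intro integrable_ee_schwartz f) measurable
      have I2: "integrable lborel (\<lambda>y. \<Sum>i\<in>UNIV. (z - x) $ i *\<^sub>R (ee (- (x \<bullet> y)) * g i y))"
        by (intro Bochner_Integration.integrable_sum integrable_scaleR_right integrable_ee_schwartz g) measurable
      have "fourier f z - fourier f x - (\<Sum>i\<in>UNIV. (z - x) $ i *\<^sub>R fourier (g i) x)
         = (LINT y|lborel. ee (- (z \<bullet> y)) * f y - ee (- (x \<bullet> y)) * f y - (\<Sum>i\<in>UNIV. (z - x) $ i *\<^sub>R (ee (- (x \<bullet> y)) * g i y)))"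
        unfolding s fourier_eq
        by (simp only: Bochner_Integration.integral_diff Bochner_Integration.integrable_diff I1 I2 s[unfolded fourier_eq])
      also have "\<dots> = (LINT y|lborel. ee (- (x \<bullet> y)) * f y * (ee (- ((z - x) \<bullet> y)) - 1 - 2 * pi * \<i> * (- ((z - x) \<bullet> y))))"
      proof (rule Bochner_Integration.integral_cong[OF refl])
        fix y
        have "(\<Sum>i\<in>UNIV. (z - x) $ i *\<^sub>R (ee (- (x \<bullet> y)) * g i y)) = ee (- (x \<bullet> y)) * f y * (2 * pi * \<i> * (- ((z - x) \<bullet> y)))"
          unfolding g_def inner_vec_def
          by (simp add: sum_distrib_left sum_negf scaleR_conv_of_real)
            (auto intro!: sum.cong simp: algebra_simps)
        moreover have "ee (- (z \<bullet> y)) = ee (- (x \<bullet> y)) * ee (- ((z - x) \<bullet> y))"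
          unfolding ee_add[symmetric] by (simp add: inner_diff_left)
        ultimately show "ee (- (z \<bullet> y)) * f y - ee (- (x \<bullet> y)) * f y - (\<Sum>i\<in>UNIV. (z - x) $ i *\<^sub>R (ee (- (x \<bullet> y)) * g i y))
          = ee (- (x \<bullet> y)) * f y * (ee (- ((z - x) \<bullet> y)) - 1 - 2 * pi * \<i> * (- ((z - x) \<bullet> y)))"
          by (simp only: right_diff_distrib mult_ac mult_1_right mult_1_left)
      qed
      finally show ?thesis .
    qed
    have "norm (fourier f z - fourier f x - (\<Sum>i\<in>UNIV. (z - x) $ i *\<^sub>R fourier (g i) x))
      \<le> (LINT y|lborel. 2 * pi\<^sup>2 * (norm (z - x))\<^sup>2 * ((norm y)\<^sup>2 * cmod (f y)))"
      unfolding eq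
    proof (rule Bochner_Integration.integral_norm_bound_integral)
      show "integrable lborel (\<lambda>y. 2 * pi\<^sup>2 * (norm (z - x))\<^sup>2 * ((norm y)\<^sup>2 * cmod (f y)))" using intI by simp
      show bd: "norm (ee (- (x \<bullet> y)) * f y * (ee (- ((z - x) \<bullet> y)) - 1 - 2 * pi * \<i> * (- ((z - x) \<bullet> y)))) \<le> 2 * pi\<^sup>2 * (norm (z - x))\<^sup>2 * ((norm y)\<^sup>2 * cmod (f y))" for y
      proof -
        have "\<bar>(z - x) \<bullet> y\<bar>\<^sup>2 \<le> (norm (z - x) * norm y)\<^sup>2"
          by (intro power_mono Cauchy_Schwarz_ineq2) simp
        then have "(2 * pi * (- ((z - x) \<bullet> y)))\<^sup>2 / 2 \<le> 2 * pi\<^sup>2 * (norm (z - x))\<^sup>2 * (norm y)\<^sup>2"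
          by (simp add: power_mult_distrib)
        from mult_left_mono[OF order_trans[OF ee_approx this], of "cmod (f y)"]
        show ?thesis by (simp add: norm_mult mult_ac)
      qed
      show "integrable lborel (\<lambda>y. ee (- (x \<bullet> y)) * f y * (ee (- ((z - x) \<bullet> y)) - 1 - 2 * pi * \<i> * (- ((z - x) \<bullet> y))))"
        by (rule Bochner_Integration.integrable_bound[OF \<open>integrable lborel (\<lambda>y. 2 * pi\<^sup>2 * (norm (z - x))\<^sup>2 * ((norm y)\<^sup>2 * cmod (f y)))\<close>])
         (use measurable_schwartz[OF f] bd in \<open>auto intro!: AE_I2 intro: order_trans abs_ge_self\<close>)
    qed
    also have "\<dots> = 2 * pi\<^sup>2 * I * norm (z - x) * norm (z - x)" by (simp add: I_def power2_eq_square)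
    finally show "norm (fourier f z - fourier f x - (\<Sum>i\<in>UNIV. (z - x) $ i *\<^sub>R fourier (g i) x)) / norm (z - x) \<le> 2 * pi\<^sup>2 * I * norm (z - x)"
      using \<open>z \<noteq> x\<close> by (simp add: pos_divide_le_eq)
  qed simp
  show "fourier f differentiable at x" using D by (auto simp: differentiable_def)
  show "pderivative i (fourier f) = fourier (\<lambda>y. - 2 * pi * \<i> * (y $ i * f y))"
    by (rule ext, rule trans[OF pderivative_eq[OF D]]) (simp add: g_def[abs_def])
qed

text \<open>Each factor \<open>x $ i\<close> is traded for a derivative of \<open>f\<close>, whose Fourier transform is bounded.\<close>
lemma fourier_decay:
  "f \<in> schwartz \<Longrightarrow> \<exists>C. \<forall>x. norm x ^ k * cmod (fourier f x) \<le> C"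
proof (induction k arbitrary: f)
  case 0 then show ?case using cmod_fourier_le by auto
next
  case (Suc k)
  have "\<forall>i. \<exists>C. \<forall>x. norm x ^ k * cmod (fourier (pderivative i f) x) \<le> C"
    using Suc.IH Suc.prems schwartz_pderivative by blast
  then obtain C where C: "\<And>i x. norm x ^ k * cmod (fourier (pderivative i f) x) \<le> C i" by metis
  have "norm x ^ Suc k * cmod (fourier f x) \<le> (\<Sum>i\<in>UNIV. C i)" for x
  proof -
    have "norm x ^ Suc k * cmod (fourier f x) \<le> (\<Sum>i\<in>UNIV. \<bar>x $ i\<bar>) * (norm x ^ k * cmod (fourier f x))"
      using mult_right_mono[OF norm_le_l1_cart[of x], of "norm x ^ k * cmod (fourier f x)"] by (simp add: mult_ac)
    also have "\<dots> = (\<Sum>i\<in>UNIV. \<bar>x $ i\<bar> * (norm x ^ k * cmod (fourier f x)))" by (simp add: sum_distrib_right)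
    also have "\<dots> \<le> (\<Sum>i\<in>UNIV. C i)"
    proof (rule sum_mono)
      fix i
      have "\<bar>x $ i\<bar> * cmod (fourier f x) \<le> 2 * pi * \<bar>x $ i\<bar> * cmod (fourier f x)"
        using pi_gt3 by (intro mult_right_mono) (auto simp: mult_left_le_one_le intro!: mult_right_mono[of 1 _ "\<bar>x $ i\<bar>", simplified])
      also have "\<dots> = cmod (fourier (pderivative i f) x)"
        unfolding fourier_pderivative[OF Suc.prems] by (simp add: norm_mult)
      finally have "norm x ^ k * (\<bar>x $ i\<bar> * cmod (fourier f x)) \<le> norm x ^ k * cmod (fourier (pderivative i f) x)"
        by (intro mult_left_mono) auto
      with C[of x i] show "\<bar>x $ i\<bar> * (norm x ^ k * cmod (fourier f x)) \<le> C i" by (simp add: mult_ac)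
    qed
    finally show ?thesis .
  qed
  then show ?case by blast
qed

text \<open>The class of all Fourier transforms of Schwartz functions is stable under derivatives, since a
  derivative of \<open>fourier a\<close> is the transform of a coordinate multiple of \<open>a\<close>.\<close>
lemma fourier_schwartz:
  assumes "f \<in> schwartz" shows "fourier f \<in> schwartz"
proof -
  define P where "P h \<longleftrightarrow> (\<exists>a\<in>schwartz. h = fourier a)" for h :: "'a cfun"
  have "P (fourier f)" using assms by (auto simp: P_def)
  then show ?thesis
  proof (rule schwartz_coinduct[where P=P])
    fix h x assume "P h" then show "h differentiable at x" by (auto simp: P_def pderivative_fourier)
  next
    fix h and k :: nat assume "P h" then show "\<exists>C. \<forall>x. norm x ^ k * cmod (h x) \<le> C"
      by (auto simp: P_def fourier_decay)
  next
    fix h i assume "P h"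
    then obtain a where a: "a \<in> schwartz" "h = fourier a" by (auto simp: P_def)
    then show "P (pderivative i h)" unfolding P_def a(2) pderivative_fourier(2)[OF a(1)]
      by - (rule bexI, rule refl, intro schwartz_cmult schwartz_times_coordinate)
  qed
qed

section \<open>Fourier inversion\<close>

definition inv_fourier :: "'n::finite cfun \<Rightarrow> 'n cfun" where
  "inv_fourier f = (\<lambda>x. fourier f (- x))"

lemma inv_fourier_eq: "inv_fourier f x = (LINT y|lborel. ee (x \<bullet> y) * f y)"
  by (simp add: inv_fourier_def fourier_eq)

lemma inv_fourier_schwartz: "f \<in> schwartz \<Longrightarrow> inv_fourier f \<in> schwartz"
  using schwartz_reflect[OF fourier_schwartz, of f 0] by (simp add: inv_fourier_def)

definition gauss :: "real^'n::finite \<Rightarrow> real" where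
  "gauss z = exp (- (norm z)\<^sup>2 / 2)"

lemma gauss_prod: "gauss z = (\<Prod>i\<in>UNIV. exp (- (z $ i)\<^sup>2 / 2))"
  unfolding gauss_def power2_norm_eq_inner inner_vec_def
  by (simp add: exp_sum[symmetric] power2_eq_square sum_negf sum_divide_distrib)

lemma measurable_gauss [measurable]: "gauss \<in> borel_measurable borel"
  unfolding gauss_def by measurable

lemma gauss_le_1: "gauss z \<le> 1" and gauss_pos: "0 < gauss z"
  by (simp_all add: gauss_def)

text \<open>The Gaussian factors over the coordinates, and in one coordinate its transform is the
  characteristic function of the standard normal distribution.\<close>
lemma gauss_fourier:
  fixes t :: "real^'n::finite"
  shows integrable_gauss: "integrable lborel (gauss :: real^'n \<Rightarrow> real)"
    and integral_cis_gauss: "(LINT z|lborel. cis (t \<bullet> z) * gauss z) = sqrt (2 * pi) ^ CARD('n) * gauss t"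
proof -
  have den: "std_normal_density x = exp (- x\<^sup>2 / 2) / sqrt (2 * pi)" for x
    by (simp add: std_normal_density_def)
  have I: "integrable lborel (\<lambda>x::real. exp (- x\<^sup>2 / 2))"
    using integrable_mult_left[of "sqrt (2 * pi)", OF integrable_normal_moment[of 1 0 0]]
    by (simp add: den)
  show "integrable lborel (gauss :: real^'n \<Rightarrow> real)"
    unfolding gauss_prod[abs_def] by (rule integrable_lborel_prod) (rule I)
  have I': "integrable lborel (\<lambda>x::real. cis (s * x) * exp (- x\<^sup>2 / 2))" for s
    by (rule Bochner_Integration.integrable_bound[OF I]) (auto simp: norm_mult cis_conv_exp)
  have one: "(LINT x|lborel. cis (s * x) * exp (- x\<^sup>2 / 2)) = sqrt (2 * pi) * exp (- s\<^sup>2 / 2)" for s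
  proof -
    have "complex_of_real (exp (- s\<^sup>2 / 2)) = (LINT x|lborel. std_normal_density x *\<^sub>R iexp (s * x))"
      using fun_cong[OF char_std_normal_distribution, of s] unfolding char_def
      by (subst (asm) integral_density) (auto intro: normal_density_nonneg)
    also have "\<dots> = (LINT x|lborel. (cis (s * x) * exp (- x\<^sup>2 / 2)) / sqrt (2 * pi))"
      unfolding den by (intro Bochner_Integration.integral_cong) (auto simp: cis_conv_exp scaleR_conv_of_real field_simps)
    also have "\<dots> = (LINT x|lborel. cis (s * x) * exp (- x\<^sup>2 / 2)) / sqrt (2 * pi)"
      by simp
    finally show ?thesis by (simp add: field_simps)
  qed
  have "cis (t \<bullet> z) * gauss z = (\<Prod>i\<in>UNIV. cis (t $ i * z $ i) * exp (- (z $ i)\<^sup>2 / 2))" for z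
  proof -
    have "cis (t \<bullet> z) = (\<Prod>i\<in>UNIV. cis (t $ i * z $ i))"
      unfolding cis_conv_exp inner_vec_def by (simp add: exp_sum[symmetric] sum_distrib_left)
    then show ?thesis unfolding gauss_prod by (simp add: prod.distrib)
  qed
  then have "(LINT z|lborel. cis (t \<bullet> z) * gauss z) = (\<Prod>i\<in>UNIV. LINT x|lborel. cis (t $ i * x) * exp (- x\<^sup>2 / 2))"
    using integral_lborel_prod[of "\<lambda>i x. cis (t $ i * x) * exp (- x\<^sup>2 / 2)", OF I'] by simp
  also have "\<dots> = sqrt (2 * pi) ^ CARD('n) * gauss t"
    unfolding one gauss_prod by (simp add: prod.distrib)
  finally show "(LINT z|lborel. cis (t \<bullet> z) * gauss z) = sqrt (2 * pi) ^ CARD('n) * gauss t" .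
qed

text \<open>In the inversion integral the two integrals cannot be exchanged, as \<open>ee (k \<bullet> x) * f y\<close> is not
  integrable in \<open>k\<close>. With a Gaussian factor they can, and the integral over \<open>k\<close> is again a
  Gaussian, of width proportional to \<open>\<epsilon>\<close> around \<open>x\<close>.\<close>
lemma fourier_gauss_regularised:
  fixes f :: "'n::finite cfun" and \<epsilon> :: real
  assumes f: "f \<in> schwartz" and e: "0 < \<epsilon>"
  shows "(LINT k|lborel. ee (k \<bullet> x) * fourier f k * gauss (\<epsilon> *\<^sub>R k))
     = inverse (sqrt (2 * pi)) ^ CARD('n) * (LINT z|lborel. f (x + (\<epsilon> / (2 * pi)) *\<^sub>R z) * gauss z)"
proof -
  let ?d = "CARD('n)" and ?s = "sqrt (2 * pi)" and ?c = "\<epsilon> / (2 * pi)"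
  note [measurable] = measurable_schwartz[OF f] measurable_schwartz[OF fourier_schwartz[OF f]]
  \<comment> \<open>The Gaussian in \<open>k\<close> of width \<open>1 / \<epsilon>\<close> has a transform of width \<open>\<epsilon> / (2 * pi)\<close>.\<close>
  have c: "?c > 0" using e by simp
  have g: "integrable lborel (\<lambda>k::real^'n. gauss (\<epsilon> *\<^sub>R k))"
    using integrable_lborel_affine[of "gauss :: real^'n \<Rightarrow> real" \<epsilon> 0] integrable_gauss e by simp
  have inner: "(LINT k|lborel. ee (k \<bullet> (x - y)) * f y * gauss (\<epsilon> *\<^sub>R k)) = f y * (inverse \<epsilon> ^ ?d * ?s ^ ?d * gauss ((y - x) /\<^sub>R ?c))" for y
  proof -
    have "(LINT k|lborel. ee (k \<bullet> (x - y)) * f y * gauss (\<epsilon> *\<^sub>R k))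
      = (LINT k|lborel. f y * (ee (k \<bullet> (x - y)) * gauss (\<epsilon> *\<^sub>R k)))"
      by (simp add: mult_ac)
    also have "\<dots> = f y * (LINT k|lborel. ee (k \<bullet> (x - y)) * gauss (\<epsilon> *\<^sub>R k))" by simp
    also have "(LINT k|lborel. ee (k \<bullet> (x - y)) * gauss (\<epsilon> *\<^sub>R k)) = inverse \<epsilon> ^ ?d *\<^sub>R (LINT k|lborel. ee ((0 + inverse \<epsilon> *\<^sub>R k) \<bullet> (x - y)) * gauss (\<epsilon> *\<^sub>R (0 + inverse \<epsilon> *\<^sub>R k)))"
      using integral_lborel_affine[of "\<lambda>k. ee (k \<bullet> (x - y)) * gauss (\<epsilon> *\<^sub>R k)" "inverse \<epsilon>" 0] e by simp
    also have "(LINT k|lborel. ee ((0 + inverse \<epsilon> *\<^sub>R k) \<bullet> (x - y)) * gauss (\<epsilon> *\<^sub>R (0 + inverse \<epsilon> *\<^sub>R k)))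
       = (LINT k|lborel. cis (((x - y) /\<^sub>R ?c) \<bullet> k) * gauss k)"
    proof (rule Bochner_Integration.integral_cong[OF refl])
      fix k :: "real^'n"
      have "2 * pi * ((0 + inverse \<epsilon> *\<^sub>R k) \<bullet> (x - y)) = ((x - y) /\<^sub>R ?c) \<bullet> k"
        unfolding add_0_left inner_scaleR_left inner_scaleR_right divide_inverse inverse_mult_distrib inverse_inverse_eq
        by (simp only: inner_commute mult_ac)
      moreover have arg: "\<epsilon> *\<^sub>R (0 + inverse \<epsilon> *\<^sub>R k) = k" using e by simp
      ultimately show "ee ((0 + inverse \<epsilon> *\<^sub>R k) \<bullet> (x - y)) * gauss (\<epsilon> *\<^sub>R (0 + inverse \<epsilon> *\<^sub>R k)) = cis (((x - y) /\<^sub>R ?c) \<bullet> k) * gauss k"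
        by (simp only: ee_def arg)
    qed
    also have "\<dots> = ?s ^ ?d * gauss ((x - y) /\<^sub>R ?c)" by (rule integral_cis_gauss)
    also have "gauss ((x - y) /\<^sub>R ?c) = gauss ((y - x) /\<^sub>R ?c)" by (simp add: gauss_def norm_minus_commute)
    finally show ?thesis by (simp add: scaleR_conv_of_real)
  qed
  have "(LINT k|lborel. ee (k \<bullet> x) * fourier f k * gauss (\<epsilon> *\<^sub>R k))
      = (LINT k|lborel. LINT y|lborel. ee (k \<bullet> (x - y)) * f y * gauss (\<epsilon> *\<^sub>R k))"
  proof (rule Bochner_Integration.integral_cong[OF refl])
    fix k
    have "ee (k \<bullet> x) * fourier f k * gauss (\<epsilon> *\<^sub>R k) = (ee (k \<bullet> x) * gauss (\<epsilon> *\<^sub>R k)) * (LINT y|lborel. ee (- (k \<bullet> y)) * f y)"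
      by (simp add: fourier_eq mult_ac)
    also have "\<dots> = (LINT y|lborel. (ee (k \<bullet> x) * gauss (\<epsilon> *\<^sub>R k)) * (ee (- (k \<bullet> y)) * f y))" by simp
    also have "\<dots> = (LINT y|lborel. ee (k \<bullet> (x - y)) * f y * gauss (\<epsilon> *\<^sub>R k))"
      by (intro Bochner_Integration.integral_cong) (auto simp: inner_diff_right ee_diff)
    finally show "ee (k \<bullet> x) * fourier f k * gauss (\<epsilon> *\<^sub>R k) = (LINT y|lborel. ee (k \<bullet> (x - y)) * f y * gauss (\<epsilon> *\<^sub>R k))" .
  qed
  also have "\<dots> = (LINT y|lborel. LINT k|lborel. ee (k \<bullet> (x - y)) * f y * gauss (\<epsilon> *\<^sub>R k))"
    by (rule Fubini_dominated[OF _ _ _ g integrable_norm[OF integrable_schwartz[OF f]]])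
      (auto simp: norm_mult gauss_pos less_imp_le intro!: sigma_finite_lborel)
  also have "\<dots> = (LINT y|lborel. (inverse \<epsilon> ^ ?d * ?s ^ ?d) * (f y * gauss ((y - x) /\<^sub>R ?c)))"
    unfolding inner by (simp add: mult_ac)
  also have "\<dots> = (inverse \<epsilon> ^ ?d * ?s ^ ?d) * (LINT y|lborel. f y * gauss ((y - x) /\<^sub>R ?c))" by simp
  also have "(LINT y|lborel. f y * gauss ((y - x) /\<^sub>R ?c)) = ?c ^ ?d *\<^sub>R (LINT z|lborel. f (x + ?c *\<^sub>R z) * gauss (((x + ?c *\<^sub>R z) - x) /\<^sub>R ?c))"
    using integral_lborel_affine[of "\<lambda>y. f y * gauss ((y - x) /\<^sub>R ?c)" ?c x] c e by simp
  also have "\<dots> = ?c ^ ?d *\<^sub>R (LINT z|lborel. f (x + ?c *\<^sub>R z) * gauss z)"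
    using c e by simp
  also have "(inverse \<epsilon> ^ ?d * ?s ^ ?d) * (?c ^ ?d *\<^sub>R (LINT z|lborel. f (x + ?c *\<^sub>R z) * gauss z))
    = ((inverse \<epsilon> * ?s * ?c) ^ ?d) * (LINT z|lborel. f (x + ?c *\<^sub>R z) * gauss z)"
    by (simp only: scaleR_conv_of_real power_mult_distrib of_real_mult of_real_power of_real_inverse of_real_divide mult.assoc)
  also have "inverse \<epsilon> * ?s * ?c = inverse ?s"
    using e by (simp add: field_simps real_sqrt_mult_self)
  finally show ?thesis by simp
qed

text \<open>Both sides of \<open>fourier_gauss_regularised\<close> converge as \<open>\<epsilon>\<close> tends to \<open>0\<close>, the left one to the
  inversion integral and the right one to \<open>f x\<close>.\<close>
theorem inv_fourier_fourier:
  fixes f :: "'n::finite cfun"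
  assumes f: "f \<in> schwartz"
  shows "inv_fourier (fourier f) = f"
proof
  fix x
  let ?d = "CARD('n)" and ?s = "sqrt (2 * pi)"
  note F = fourier_schwartz[OF f]
  note [measurable] = measurable_schwartz[OF f] measurable_schwartz[OF F]
  define e where "e n = inverse (real (Suc n))" for n
  have e0: "e \<longlonglongrightarrow> 0" unfolding e_def by (rule LIMSEQ_inverse_real_of_nat)
  have epos: "0 < e n" for n by (simp add: e_def)
  let ?L = "\<lambda>n. LINT k|lborel. ee (k \<bullet> x) * fourier f k * gauss (e n *\<^sub>R k)"
  have "?L \<longlonglongrightarrow> (LINT k|lborel. ee (k \<bullet> x) * fourier f k * 1)"
  proof (rule integral_dominated_convergence[where w="\<lambda>k. cmod (fourier f k)"])
    show "integrable lborel (\<lambda>k. cmod (fourier f k))" by (intro integrable_norm integrable_schwartz F)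
    show "AE k in lborel. (\<lambda>n. ee (k \<bullet> x) * fourier f k * gauss (e n *\<^sub>R k)) \<longlonglongrightarrow> ee (k \<bullet> x) * fourier f k * 1"
      unfolding gauss_def by (rule AE_I2) (rule tendsto_eq_intros e0 refl | simp)+
    show "AE k in lborel. norm (ee (k \<bullet> x) * fourier f k * gauss (e n *\<^sub>R k)) \<le> cmod (fourier f k)" for n
      by (auto simp: norm_mult abs_of_pos gauss_pos intro!: mult_left_le gauss_le_1)
  qed measurable
  moreover have "?L \<longlonglongrightarrow> inverse ?s ^ ?d * (LINT z|lborel. f x * gauss (z :: real^'n))"
  proof -
    have "(\<lambda>n. LINT z|lborel. f (x + (e n / (2 * pi)) *\<^sub>R z) * gauss z) \<longlonglongrightarrow> (LINT z|lborel. f x * gauss (z :: real^'n))"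
    proof (rule integral_dominated_convergence[where w="\<lambda>z::real^'n. weight_norm f * gauss z"])
      show "integrable lborel (\<lambda>z::real^'n. weight_norm f * gauss z)" by (simp add: integrable_gauss)
      show "AE z in lborel. (\<lambda>n. f (x + (e n / (2 * pi)) *\<^sub>R z) * gauss z) \<longlonglongrightarrow> f x * gauss z"
      proof (rule AE_I2, rule tendsto_mult_right)
        fix z :: "real^'n"
        have "isCont f x" using continuous_schwartz[OF f] by (simp add: continuous_on_eq_continuous_at)
        moreover have "(\<lambda>n. x + (e n / (2 * pi)) *\<^sub>R z) \<longlonglongrightarrow> x" by (rule tendsto_eq_intros e0 refl | simp)+
        ultimately show "(\<lambda>n. f (x + (e n / (2 * pi)) *\<^sub>R z)) \<longlonglongrightarrow> f x" by (rule isCont_tendsto_compose)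
      qed
      show "AE z in lborel. norm (f (x + (e n / (2 * pi)) *\<^sub>R z) * gauss z) \<le> weight_norm f * gauss z" for n
      proof (rule AE_I2)
        fix z :: "real^'n"
        let ?y = "x + (e n / (2 * pi)) *\<^sub>R z"
        have "cmod (f ?y) \<le> weight_norm f * 1"
          using schwartz_le_weight[OF f, of ?y] mult_left_mono[OF weight_le_1 weight_norm_nonneg[OF f], of ?y] by (rule order_trans)
        then show "norm (f ?y * gauss z) \<le> weight_norm f * gauss z"
          by (simp add: norm_mult gauss_pos abs_of_pos)
      qed
    qed measurable
    then have "(\<lambda>n. inverse ?s ^ ?d * (LINT z|lborel. f (x + (e n / (2 * pi)) *\<^sub>R z) * gauss z)) \<longlonglongrightarrow> inverse ?s ^ ?d * (LINT z|lborel. f x * gauss (z :: real^'n))"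
      by (intro tendsto_mult_left)
    then show ?thesis unfolding fourier_gauss_regularised[OF f epos] .
  qed
  ultimately have L: "(LINT k|lborel. ee (k \<bullet> x) * fourier f k * 1) = inverse ?s ^ ?d * (LINT z|lborel. f x * gauss (z :: real^'n))"
    by (rule LIMSEQ_unique)
  have G: "(LINT z|lborel. complex_of_real (gauss (z :: real^'n))) = ?s ^ ?d"
    using integral_cis_gauss[of "0 :: real^'n"] by (simp add: gauss_def)
  have "inv_fourier (fourier f) x = (LINT k|lborel. ee (k \<bullet> x) * fourier f k * 1)"
    unfolding inv_fourier_eq by (simp only: inner_commute mult_1_right)
  also have "\<dots> = complex_of_real (inverse ?s ^ ?d) * (f x * complex_of_real (?s ^ ?d))"
    unfolding L G[symmetric] by (simp only: integral_mult_right_zero)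
  also have "\<dots> = f x * complex_of_real (inverse ?s ^ ?d * ?s ^ ?d)" by (simp only: of_real_mult mult_ac)
  also have "inverse ?s ^ ?d * ?s ^ ?d = 1"
    unfolding power_mult_distrib[symmetric] by simp
  finally show "inv_fourier (fourier f) x = f x" by (simp only: of_real_1 mult_1_right)
qed

lemma fourier_inv_fourier:
  assumes f: "f \<in> schwartz"
  shows "fourier (inv_fourier f) = f"
proof -
  have "fourier (inv_fourier f) x = inv_fourier (fourier f) x" for x
  proof -
    have "fourier (inv_fourier f) x = (LINT y|lborel. ee (- (x \<bullet> y)) * fourier f (- y))"
      unfolding fourier_eq[of "inv_fourier f"] unfolding inv_fourier_def ..
    also have "\<dots> = (LINT y|lborel. ee (- (x \<bullet> (0 + (-1) *\<^sub>R y))) * fourier f (- (0 + (-1) *\<^sub>R y)))"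
      using integral_lborel_affine[of "\<lambda>y. ee (- (x \<bullet> y)) * fourier f (- y)" "-1" 0]
        measurable_schwartz[OF inv_fourier_schwartz[OF f]] unfolding inv_fourier_def by simp
    finally show ?thesis by (simp add: inv_fourier_eq)
  qed
  then show ?thesis using inv_fourier_fourier[OF f] by auto
qed

section \<open>Radon measures\<close>

text \<open>The real and the imaginary part of a complex Radon measure, and their negatives, are real set
  functions that are countably additive as long as the union stays bounded.\<close>
locale bounded_charge =
  fixes r :: "(real^'n::finite) set \<Rightarrow> real"
  assumes sums: "range A \<subseteq> sets borel \<Longrightarrow> disjoint_family A \<Longrightarrow> bounded (\<Union>n. A n) \<Longrightarrow>
    (\<lambda>n. r (A n)) sums r (\<Union>n. A (n::nat))"
begin

lemma empty: "r {} = 0"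
proof -
  have "(\<lambda>n::nat. r {}) sums r (\<Union>n::nat. {})" by (rule sums) (auto simp: disjoint_family_on_def)
  then have "summable (\<lambda>n::nat. r {})" by (rule sums_summable)
  then show ?thesis by (simp add: summable_const_iff)
qed

lemma union:
  assumes "A \<in> bounded_borel" "B \<in> bounded_borel" "A \<inter> B = {}"
  shows "r (A \<union> B) = r A + r B"
proof -
  have "(\<lambda>n. r (binaryset A B n)) sums r (\<Union>n. binaryset A B n)"
    using assms by (intro sums) (auto simp: bounded_borel_def UN_binaryset_eq disjoint_family_on_def binaryset_def)
  moreover have "(\<lambda>n. r (binaryset A B n)) sums (r A + r B)"
    by (rule binaryset_sums) (rule empty)
  ultimately show ?thesis by (simp add: sums_unique2 UN_binaryset_eq)
qed

lemma diff:
  assumes "A \<in> bounded_borel" "B \<in> bounded_borel" "B \<subseteq> A"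
  shows "r (A - B) = r A - r B"
proof -
  have "A - B \<in> bounded_borel" using assms by (auto simp: bounded_borel_def intro: bounded_subset)
  from union[OF this assms(2)] have "r ((A - B) \<union> B) = r (A - B) + r B" by blast
  moreover have "(A - B) \<union> B = A" using assms(3) by blast
  ultimately show ?thesis by simp
qed

lemma uminus: "bounded_charge (\<lambda>A. - r A)"
  by standard (intro sums_minus sums)

lemma sets_pos_variation [simp]: "sets (pos_variation r) = sets borel"
  and space_pos_variation [simp]: "space (pos_variation r) = UNIV"
  unfolding pos_variation_def using sets.sigma_sets_eq[of "borel :: (real^'n) measure"]
  by (simp_all add: sets_measure_of space_measure_of)

text \<open>A value of \<open>measure_of\<close> is known only after the set function is shown to be countably additive. One
  inequality glues nearly optimal pieces of the sets \<open>A n\<close>; the other cuts a bounded set in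
  the union along the \<open>A n\<close>.\<close>
lemma emeasure_pos_variation:
  assumes "A \<in> sets borel"
  shows "emeasure (pos_variation r) A = (SUP B\<in>{B \<in> bounded_borel. B \<subseteq> A}. ennreal (r B))" (is "_ = ?m A")
  unfolding pos_variation_def
proof (rule emeasure_measure_of_sigma)
  show "sigma_algebra UNIV (sets (borel :: (real^'n) measure))"
    using sets.sigma_algebra_axioms[of "borel :: (real^'n) measure"] by simp
  have "{B \<in> bounded_borel. B \<subseteq> {}} = {{} :: (real^'n) set}" by (auto simp: bounded_borel_def)
  then show "positive (sets borel) ?m" by (simp add: positive_def empty)
  show "countably_additive (sets borel) ?m"
  proof (rule countably_additiveI)
    fix A :: "nat \<Rightarrow> (real^'n) set"
    assume A: "range A \<subseteq> sets borel" and disj: "disjoint_family A" and U: "\<Union> (range A) \<in> sets borel"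
    show "(\<Sum>n. ?m (A n)) = ?m (\<Union> (range A))"
    proof (rule antisym)
      show "(\<Sum>n. ?m (A n)) \<le> ?m (\<Union> (range A))"
      proof (rule suminf_le_const[OF summableI])
        fix N :: nat
        \<comment> \<open>Near-optimal pieces of finitely many \<open>A n\<close> are put together.\<close>
        have "(\<Sum>n<N. ?m (A n)) \<le> (SUP B\<in>{B \<in> bounded_borel. B \<subseteq> (\<Union>n<N. A n)}. ennreal (r B))"
        proof (induction N)
          case (Suc N)
          let ?P = "{B \<in> bounded_borel. B \<subseteq> (\<Union>n<N. A n)}" and ?Q = "{B \<in> bounded_borel. B \<subseteq> A N}"
          have ne: "{} \<in> ?P" "{} \<in> ?Q" by (auto simp: bounded_borel_def)
          have "(\<Sum>n<Suc N. ?m (A n)) \<le> (SUP B\<in>?P. ennreal (r B)) + ?m (A N)"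
            using Suc.IH by (simp add: add_right_mono)
          also have "\<dots> = (SUP B\<in>?P. ennreal (r B) + ?m (A N))"
            using ne by (subst ennreal_SUP_add_left) auto
          also have "\<dots> = (SUP B\<in>?P. SUP B'\<in>?Q. ennreal (r B) + ennreal (r B'))"
            using ne by (subst ennreal_SUP_add_right) auto
          also have "\<dots> \<le> (SUP B\<in>{B \<in> bounded_borel. B \<subseteq> (\<Union>n<Suc N. A n)}. ennreal (r B))"
          proof (intro SUP_least)
            fix B B' assume B: "B \<in> ?P" and B': "B' \<in> ?Q"
            \<comment> \<open>\<open>ennreal\<close> sends negative reals to \<open>0\<close>, so a piece of negative charge is replaced by \<open>{}\<close>.\<close>
            let ?B = "if 0 \<le> r B then B else {}" and ?B' = "if 0 \<le> r B' then B' else {}"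
            have disjBB: "B \<inter> B' = {}"
            proof -
              have "A n \<inter> A N = {}" if "n < N" for n
                using disj that by (intro disjoint_family_onD) auto
              then show ?thesis using B B' by blast
            qed
            have pos: "0 \<le> r ?B" "0 \<le> r ?B'" and pos_eq: "ennreal (r B) = ennreal (r ?B)" "ennreal (r B') = ennreal (r ?B')"
              by (simp_all add: empty ennreal_neg)
            have "ennreal (r B) + ennreal (r B') = ennreal (r ?B + r ?B')"
              unfolding pos_eq by (rule ennreal_plus[symmetric]) (rule pos)+
            also have "r ?B + r ?B' = r (?B \<union> ?B')"
              using B B' disjBB ne by (intro union[symmetric]) (auto simp: bounded_borel_def)
            also have "ennreal (r (?B \<union> ?B')) \<le> (SUP B\<in>{B \<in> bounded_borel. B \<subseteq> (\<Union>n<Suc N. A n)}. ennreal (r B))"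
              using B B' by (intro SUP_upper) (auto simp: bounded_borel_def lessThan_Suc)
            finally show "ennreal (r B) + ennreal (r B') \<le> (SUP B\<in>{B \<in> bounded_borel. B \<subseteq> (\<Union>n<Suc N. A n)}. ennreal (r B))" .
          qed
          finally show ?case .
        qed simp
        also have "\<dots> \<le> ?m (\<Union> (range A))"
          by (rule SUP_subset_mono) auto
        finally show "(\<Sum>n<N. ?m (A n)) \<le> ?m (\<Union> (range A))" .
      qed
      show "?m (\<Union> (range A)) \<le> (\<Sum>n. ?m (A n))"
      proof (rule SUP_least)
        fix B assume "B \<in> {B \<in> bounded_borel. B \<subseteq> \<Union> (range A)}"
        then have B: "B \<in> sets borel" "bounded B" "B \<subseteq> \<Union> (range A)" by (auto simp: bounded_borel_def)
        have BA: "A n \<inter> B \<in> bounded_borel" for n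
          using B A by (auto simp: bounded_borel_def intro: bounded_subset)
        \<comment> \<open>The union of the pieces \<open>A n \<inter> B\<close> is bounded, which is what countable additivity of \<open>r\<close> asks for.\<close>
        have eq: "(\<Union>n. A n \<inter> B) = B" using B(3) by auto
        have s: "(\<lambda>n. r (A n \<inter> B)) sums r B"
        proof -
          have "(\<lambda>n. r (A n \<inter> B)) sums r (\<Union>n. A n \<inter> B)"
          proof (rule sums)
            show "bounded (\<Union>n. A n \<inter> B)" using B(2) eq by simp
            show "disjoint_family (\<lambda>n. A n \<inter> B)" using disj by (auto simp: disjoint_family_on_def)
          qed (use A B in auto)
          then show ?thesis using eq by simp
        qed
        have le: "ennreal (r (A n \<inter> B)) \<le> ?m (A n)" for n
          using BA by (intro SUP_upper) auto
        show "ennreal (r B) \<le> (\<Sum>n. ?m (A n))"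
        proof (rule LIMSEQ_le_const2[OF tendsto_ennrealI[OF s[unfolded sums_def]]], intro exI allI impI)
          fix N
          have "ennreal (\<Sum>n<N. r (A n \<inter> B)) \<le> (\<Sum>n<N. ennreal (r (A n \<inter> B)))"
          proof (induction N)
            case (Suc N)
            have "ennreal ((\<Sum>n<N. r (A n \<inter> B)) + r (A N \<inter> B)) \<le> ennreal (\<Sum>n<N. r (A n \<inter> B)) + ennreal (r (A N \<inter> B))"
            proof (cases "0 \<le> (\<Sum>n<N. r (A n \<inter> B)) \<and> 0 \<le> r (A N \<inter> B)")
              case True then show ?thesis by (simp add: ennreal_plus)
            next
              case False
              then consider "(\<Sum>n<N. r (A n \<inter> B)) < 0" | "r (A N \<inter> B) < 0" by linarith
              then show ?thesis
              proof cases
                case 1 then have "ennreal ((\<Sum>n<N. r (A n \<inter> B)) + r (A N \<inter> B)) \<le> ennreal (r (A N \<inter> B))"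
                  by (intro ennreal_leI) simp
                then show ?thesis by (rule order_trans) simp
              next
                case 2 then have "ennreal ((\<Sum>n<N. r (A n \<inter> B)) + r (A N \<inter> B)) \<le> ennreal (\<Sum>n<N. r (A n \<inter> B))"
                  by (intro ennreal_leI) simp
                then show ?thesis by (rule order_trans) simp
              qed
            qed
            also have "\<dots> \<le> (\<Sum>n<N. ennreal (r (A n \<inter> B))) + ennreal (r (A N \<inter> B))"
              by (intro add_right_mono Suc.IH)
            finally show ?case by simp
          qed simp
          also have "\<dots> \<le> (\<Sum>n<N. ?m (A n))" by (intro sum_mono le)
          also have "\<dots> \<le> (\<Sum>n. ?m (A n))" by (rule sum_le_suminf) auto
          finally show "ennreal (\<Sum>n<N. r (A n \<inter> B)) \<le> (\<Sum>n. ?m (A n))" .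
        qed
      qed
    qed
  qed
qed (use assms in auto)

text \<open>For \<open>B \<subseteq> A\<close> one has \<open>r B = r A - r (A - B)\<close>, and \<open>- r (A - B)\<close> is at most the positive variation
  of \<open>- r\<close> on \<open>A\<close>.\<close>
lemma measure_pos_variation_le:
  assumes A: "A \<in> bounded_borel"
    and fin: "emeasure (pos_variation r) A < \<infinity>" "emeasure (pos_variation (\<lambda>A. - r A)) A < \<infinity>"
  shows "measure (pos_variation r) A \<le> measure (pos_variation (\<lambda>A. - r A)) A + r A"
proof -
  interpret neg: bounded_charge "\<lambda>A. - r A" by (rule uminus)
  have A': "A \<in> sets borel" using A by (simp add: bounded_borel_def)
  let ?m = "measure (pos_variation r) A" and ?n = "measure (pos_variation (\<lambda>A. - r A)) A"
  have m: "emeasure (pos_variation r) A = ennreal ?m" and n: "emeasure (pos_variation (\<lambda>A. - r A)) A = ennreal ?n"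
    using fin by (simp_all add: emeasure_eq_ennreal_measure)
  have le: "- r B \<le> ?n" if "B \<in> bounded_borel" "B \<subseteq> A" for B
  proof -
    have "ennreal (- r B) \<le> ennreal ?n"
      unfolding n[symmetric] neg.emeasure_pos_variation[OF A'] using that by (intro SUP_upper) auto
    then show ?thesis by (simp add: ennreal_le_iff)
  qed
  have "ennreal ?m \<le> ennreal (?n + r A)"
    unfolding m[symmetric] emeasure_pos_variation[OF A']
  proof (intro SUP_least ennreal_leI)
    fix B assume B: "B \<in> {B \<in> bounded_borel. B \<subseteq> A}"
    then have "A - B \<in> bounded_borel" using A by (auto simp: bounded_borel_def intro: bounded_subset)
    then show "r B \<le> ?n + r A" using le[of "A - B"] diff[of A B] A B by auto
  qed
  moreover have "0 \<le> ?n + r A" using le[OF A] by simp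
  ultimately show ?thesis by (simp add: ennreal_le_iff)
qed

lemma jordan:
  assumes A: "A \<in> bounded_borel"
    and fin: "emeasure (pos_variation r) A < \<infinity>" "emeasure (pos_variation (\<lambda>A. - r A)) A < \<infinity>"
  shows "r A = measure (pos_variation r) A - measure (pos_variation (\<lambda>A. - r A)) A"
proof -
  have "emeasure (pos_variation (\<lambda>A. - (- r A))) A < \<infinity>" using fin(1) by simp
  from bounded_charge.measure_pos_variation_le[OF uminus A fin(2) this] measure_pos_variation_le[OF assms]
  show ?thesis by (simp only: minus_minus)
qed

end

lemma radon_bounded_charge:
  assumes "\<mu> \<in> radon"
  shows "bounded_charge (\<lambda>A. Re (\<mu> A))" "bounded_charge (\<lambda>A. Im (\<mu> A))"
    "bounded_charge (\<lambda>A. - Re (\<mu> A))" "bounded_charge (\<lambda>A. - Im (\<mu> A))"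
proof -
  show "bounded_charge (\<lambda>A. Re (\<mu> A))" by standard (intro sums_Re, use assms in \<open>auto simp: radon_def\<close>)
  then show "bounded_charge (\<lambda>A. - Re (\<mu> A))" by (rule bounded_charge.uminus)
  show "bounded_charge (\<lambda>A. Im (\<mu> A))" by standard (intro sums_Im, use assms in \<open>auto simp: radon_def\<close>)
  then show "bounded_charge (\<lambda>A. - Im (\<mu> A))" by (rule bounded_charge.uminus)
qed

lemma bounded_borel_Int [intro]: "A \<in> bounded_borel \<Longrightarrow> B \<in> sets borel \<Longrightarrow> A \<inter> B \<in> bounded_borel"
  by (auto simp: bounded_borel_def intro: bounded_subset)

lemma bounded_borelD: "A \<in> bounded_borel \<Longrightarrow> A \<in> sets borel"
  by (simp add: bounded_borel_def)

text \<open>The complex Radon measure with density \<open>u\<close> with respect to a positive measure \<open>m\<close>.\<close>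
definition density_charge :: "(real^'n::finite) measure \<Rightarrow> 'n cfun \<Rightarrow> 'n cmeas" where
  "density_charge m u = (\<lambda>A. if A \<in> bounded_borel then (LINT x:A|m. u x) else 0)"

lemma density_cmeas_eq: "density_cmeas h = density_charge lborel h"
  by (simp add: density_cmeas_def density_charge_def)

locale radon_measure =
  fixes m :: "(real^'n::finite) measure"
  assumes sets_m [measurable_cong, simp]: "sets m = sets borel"
    and finite_bounded: "A \<in> bounded_borel \<Longrightarrow> emeasure m A < \<infinity>"
begin

lemma space_m [simp]: "space m = UNIV"
  using sets_eq_imp_space_eq[OF sets_m] by simp

lemma cball_in: "cball 0 r \<in> bounded_borel" by (simp add: bounded_borel_def)

lemma sigma_finite: "sigma_finite_measure m"
proof
  have "(\<Union>n::nat. cball (0::real^'n) (real n)) = UNIV"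
    by (auto simp: real_arch_simple)
  then show "\<exists>A. countable A \<and> A \<subseteq> sets m \<and> \<Union>A = space m \<and> (\<forall>a\<in>A. emeasure m a \<noteq> \<infinity>)"
    using finite_bounded[OF cball_in]
    by (intro exI[of _ "range (\<lambda>n::nat. cball 0 (real n))"]) (auto simp: less_top)
qed

end

locale radon_density = radon_measure m for m :: "(real^'n::finite) measure" +
  fixes u :: "real^'n \<Rightarrow> complex"
  assumes u_measurable [measurable]: "u \<in> borel_measurable borel"
    and locally_integrable: "A \<in> bounded_borel \<Longrightarrow> set_integrable m A u"
begin

lemma density_charge_sums:
  assumes A: "range A \<subseteq> sets borel" "disjoint_family A" "bounded (\<Union>n::nat. A n)"
  shows "(\<lambda>n. density_charge m u (A n)) sums density_charge m u (\<Union>n. A n)"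
proof -
  let ?U = "\<Union>n. A n"
  have U: "?U \<in> bounded_borel" using A by (auto simp: bounded_borel_def)
  have An: "A n \<in> bounded_borel" for n
    using A by (auto simp: bounded_borel_def intro: bounded_subset[of ?U])
  have fin: "(LINT x:(\<Union>i<N. A i)|m. u x) = (\<Sum>i<N. LINT x:A i|m. u x)" for N
    using A An by (intro set_integral_finite_Union)
      (auto simp: disjoint_family_on_def intro!: locally_integrable)
  have "(\<lambda>N. LINT x:(\<Union>i<N. A i)|m. u x) \<longlonglongrightarrow> (LINT x:(\<Union>N. \<Union>i<N. A i)|m. u x)"
  proof (rule set_integral_cont_up)
    have "(\<Union>N. \<Union>i<N. A i) = ?U" by auto
    then show "set_integrable m (\<Union>N. \<Union>i<N. A i) u" using locally_integrable[OF U] by simp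
    show "incseq (\<lambda>N. \<Union>i<N. A i)" by (force simp: incseq_def)
  qed (use A in auto)
  moreover have "(\<Union>N. \<Union>i<N. A i) = ?U" by auto
  ultimately have "(\<lambda>N. \<Sum>i<N. LINT x:A i|m. u x) \<longlonglongrightarrow> (LINT x:?U|m. u x)" by (simp add: fin)
  then show ?thesis by (simp add: density_charge_def U An sums_def)
qed

lemma density_charge_radon: "density_charge m u \<in> radon"
  using density_charge_sums by (auto simp: radon_def density_charge_def[of m u])

lemma total_variation_density_charge:
  assumes [measurable]: "A \<in> sets borel"
  shows "total_variation (density_charge m u) A \<le> (\<integral>\<^sup>+x\<in>A. cmod (u x) \<partial>m)"
  unfolding total_variation_def
proof (rule SUP_least)
  fix P assume "P \<in> {P. finite P \<and> disjoint P \<and> P \<subseteq> bounded_borel \<and> \<Union>P \<subseteq> A}"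
  then have P: "finite P" "disjoint P" "P \<subseteq> bounded_borel" "\<Union>P \<subseteq> A" by auto
  have "(\<Sum>B\<in>P. ennreal (cmod (density_charge m u B))) \<le> (\<Sum>B\<in>P. emeasure (density m (\<lambda>x. cmod (u x))) B)"
  proof (rule sum_mono)
    fix B assume "B \<in> P"
    then have B: "B \<in> bounded_borel" using P by auto
    then have [measurable]: "B \<in> sets borel" by (rule bounded_borelD)
    have "ennreal (cmod (LINT x:B|m. u x)) \<le> (\<integral>\<^sup>+x. norm (indicator B x *\<^sub>R u x) \<partial>m)"
      unfolding set_lebesgue_integral_def
      using locally_integrable[OF B] by (intro integral_norm_bound_ennreal) (simp add: set_integrable_def)
    also have "\<dots> = emeasure (density m (\<lambda>x. cmod (u x))) B"
      by (subst emeasure_density) (auto intro!: nn_integral_cong split: split_indicator)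
    finally show "ennreal (cmod (density_charge m u B)) \<le> emeasure (density m (\<lambda>x. cmod (u x))) B"
      by (simp add: density_charge_def B)
  qed
  also have "\<dots> = emeasure (density m (\<lambda>x. cmod (u x))) (\<Union>P)"
    using P by (subst sum_emeasure[where F="\<lambda>B. B"])
      (auto simp: disjoint_family_on_def disjoint_def bounded_borel_def)
  also have "\<dots> \<le> emeasure (density m (\<lambda>x. cmod (u x))) A"
    using P by (intro emeasure_mono) auto
  also have "\<dots> = (\<integral>\<^sup>+x\<in>A. cmod (u x) \<partial>m)" by (subst emeasure_density) auto
  finally show "(\<Sum>B\<in>P. ennreal (cmod (density_charge m u B))) \<le> (\<integral>\<^sup>+x\<in>A. cmod (u x) \<partial>m)" .
qed

end

text \<open>On a bounded set the supremum is attained on the part where \<open>v\<close> is nonnegative; arbitrary sets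
  are exhausted by bounded ones.\<close>
lemma (in radon_measure) pos_variation_density:
  fixes v :: "real^'n::finite \<Rightarrow> real"
  assumes v [measurable]: "v \<in> borel_measurable borel" and int: "\<And>A. A \<in> bounded_borel \<Longrightarrow> set_integrable m A v"
    and r: "\<And>A. A \<in> bounded_borel \<Longrightarrow> r A = (LINT x:A|m. v x)"
    and charge: "bounded_charge r"
  shows "pos_variation r = density m (\<lambda>x. ennreal (v x))"
proof (rule measure_eqI)
  interpret bounded_charge r by fact
  fix A assume "A \<in> sets (pos_variation r)"
  then have A [measurable]: "A \<in> sets borel" by simp
  let ?d = "density m (\<lambda>x. ennreal (v x))"
  have part: "emeasure ?d B = ennreal (r (B \<inter> {x. 0 \<le> v x}))" if B: "B \<in> bounded_borel" for B
  proof -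
    have [measurable]: "B \<in> sets borel" using B by (rule bounded_borelD)
    have B': "B \<inter> {x. 0 \<le> v x} \<in> bounded_borel" using B by (rule bounded_borel_Int) measurable
    have "emeasure ?d B = (\<integral>\<^sup>+x. ennreal (indicator (B \<inter> {x. 0 \<le> v x}) x *\<^sub>R v x) \<partial>m)"
      by (subst emeasure_density) (auto intro!: nn_integral_cong split: split_indicator simp: ennreal_neg)
    also have "\<dots> = ennreal (LINT x:B \<inter> {x. 0 \<le> v x}|m. v x)"
      unfolding set_lebesgue_integral_def
      using int[OF B'] by (intro nn_integral_eq_integral) (auto simp: set_integrable_def split: split_indicator)
    finally show ?thesis using r[OF B'] by simp
  qed
  show "emeasure (pos_variation r) A = emeasure ?d A"
    unfolding emeasure_pos_variation[OF A]
  proof (rule antisym)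
    show "(SUP B\<in>{B \<in> bounded_borel. B \<subseteq> A}. ennreal (r B)) \<le> emeasure ?d A"
    proof (rule SUP_least)
      fix B assume "B \<in> {B \<in> bounded_borel. B \<subseteq> A}"
      then have B: "B \<in> bounded_borel" "B \<subseteq> A" and [measurable]: "B \<in> sets borel" by (auto intro: bounded_borelD)
      have "r B \<le> r (B \<inter> {x. 0 \<le> v x})"
      proof -
        have B': "B \<inter> {x. 0 \<le> v x} \<in> bounded_borel" using B(1) by (rule bounded_borel_Int) measurable
        show ?thesis unfolding r[OF B(1)] r[OF B'] set_lebesgue_integral_def
          using int[OF B(1)] int[OF B'] unfolding set_integrable_def
          by (intro Bochner_Integration.integral_mono) (auto split: split_indicator)
      qed
      then have "ennreal (r B) \<le> emeasure ?d B" unfolding part[OF B(1)] by (rule ennreal_leI)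
      also have "\<dots> \<le> emeasure ?d A" using B by (intro emeasure_mono) auto
      finally show "ennreal (r B) \<le> emeasure ?d A" .
    qed
    have "emeasure ?d A = emeasure ?d (\<Union>n::nat. A \<inter> cball 0 (real n))"
      by (intro arg_cong[where f="emeasure ?d"]) (auto simp: real_arch_simple)
    also have "\<dots> = (SUP n::nat. emeasure ?d (A \<inter> cball 0 (real n)))"
      by (rule SUP_emeasure_incseq[symmetric]) (auto simp: incseq_def)
    also have "\<dots> \<le> (SUP B\<in>{B \<in> bounded_borel. B \<subseteq> A}. ennreal (r B))"
    proof (rule SUP_least)
      fix n :: nat
      have B: "A \<inter> cball 0 (real n) \<in> bounded_borel" using bounded_borel_Int[OF cball_in A] by (simp add: Int_commute)
      have "(A \<inter> cball 0 (real n)) \<inter> {x. 0 \<le> v x} \<in> bounded_borel" using B by (rule bounded_borel_Int) measurable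
      then show "emeasure ?d (A \<inter> cball 0 (real n)) \<le> (SUP B\<in>{B \<in> bounded_borel. B \<subseteq> A}. ennreal (r B))"
        unfolding part[OF B] by (intro SUP_upper) auto
    qed
    finally show "emeasure ?d A \<le> (SUP B\<in>{B \<in> bounded_borel. B \<subseteq> A}. ennreal (r B))" .
  qed
qed (simp add: bounded_charge.sets_pos_variation[OF charge])

context radon_density begin

lemma pos_variation_density_charge:
  shows "pos_variation (\<lambda>A. Re (density_charge m u A)) = density m (\<lambda>x. ennreal (Re (u x)))"
    "pos_variation (\<lambda>A. - Re (density_charge m u A)) = density m (\<lambda>x. ennreal (- Re (u x)))"
    "pos_variation (\<lambda>A. Im (density_charge m u A)) = density m (\<lambda>x. ennreal (Im (u x)))"
    "pos_variation (\<lambda>A. - Im (density_charge m u A)) = density m (\<lambda>x. ennreal (- Im (u x)))"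
proof -
  note ch = radon_bounded_charge[OF density_charge_radon]
  have I: "set_integrable m A (\<lambda>x. Re (u x))" "set_integrable m A (\<lambda>x. Im (u x))" if "A \<in> bounded_borel" for A
    using locally_integrable[OF that] unfolding set_integrable_def
    by (auto dest: integrable_Re integrable_Im)
  have E: "Re (density_charge m u A) = (LINT x:A|m. Re (u x))" "Im (density_charge m u A) = (LINT x:A|m. Im (u x))" if "A \<in> bounded_borel" for A
    using locally_integrable[OF that] that unfolding set_integrable_def set_lebesgue_integral_def density_charge_def
    by (auto simp flip: integral_Re integral_Im)
  have J: "set_integrable m A (\<lambda>x. - Re (u x))" "set_integrable m A (\<lambda>x. - Im (u x))" if "A \<in> bounded_borel" for A
    using I[OF that] unfolding set_integrable_def by auto
  have F: "(LINT x:A|m. - Re (u x)) = - (LINT x:A|m. Re (u x))" "(LINT x:A|m. - Im (u x)) = - (LINT x:A|m. Im (u x))" for A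
    by (simp_all add: set_lebesgue_integral_def)
  show "pos_variation (\<lambda>A. Re (density_charge m u A)) = density m (\<lambda>x. ennreal (Re (u x)))"
    by (rule pos_variation_density) (use ch E I in auto)
  show "pos_variation (\<lambda>A. - Re (density_charge m u A)) = density m (\<lambda>x. ennreal (- Re (u x)))"
    by (rule pos_variation_density) (use ch E J F in auto)
  show "pos_variation (\<lambda>A. Im (density_charge m u A)) = density m (\<lambda>x. ennreal (Im (u x)))"
    by (rule pos_variation_density) (use ch E I in auto)
  show "pos_variation (\<lambda>A. - Im (density_charge m u A)) = density m (\<lambda>x. ennreal (- Im (u x)))"
    by (rule pos_variation_density) (use ch E J F in auto)
qed

text \<open>The four Jordan parts have the densities \<open>max 0 (\<plusminus> Re u)\<close> and \<open>max 0 (\<plusminus> Im u)\<close>, which recombine to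
  \<open>u\<close>. From here on, integrals against complex Radon measures are Bochner integrals
  against a positive measure.\<close>
lemma cmeas_integral_density_charge:
  assumes [measurable]: "f \<in> borel_measurable borel" and fu: "integrable m (\<lambda>x. f x * u x)"
  shows "cmeas_integral (density_charge m u) f = (LINT x|m. f x * u x)"
proof -
  have D: "(LINT x|density m (\<lambda>x. ennreal (v x)). f x) = (LINT x|m. max 0 (v x) *\<^sub>R f x)"
    if [measurable]: "v \<in> borel_measurable borel" for v
  proof -
    have "density m (\<lambda>x. ennreal (v x)) = density m (\<lambda>x. ennreal (max 0 (v x)))"
      by (intro density_cong) (auto simp: max_def ennreal_neg)
    then show ?thesis by (rule ssubst[where P="\<lambda>M. (LINT x|M. f x) = _"]) (rule integral_density, auto)
  qed
  have I: "integrable m (\<lambda>x. max 0 (v x) *\<^sub>R f x)" if [measurable]: "v \<in> borel_measurable borel" and "\<And>x. \<bar>v x\<bar> \<le> cmod (u x)" for v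
  proof (rule Bochner_Integration.integrable_bound[OF fu])
    show "AE x in m. norm (max 0 (v x) *\<^sub>R f x) \<le> norm (f x * u x)"
    proof (rule AE_I2)
      fix x
      have "\<bar>max 0 (v x)\<bar> * cmod (f x) \<le> cmod (u x) * cmod (f x)" using that(2)[of x] by (intro mult_right_mono) auto
      then show "norm (max 0 (v x) *\<^sub>R f x) \<le> norm (f x * u x)" by (simp add: norm_mult mult.commute)
    qed
  qed measurable
  have i: "integrable m (\<lambda>x. max 0 (Re (u x)) *\<^sub>R f x)" "integrable m (\<lambda>x. max 0 (- Re (u x)) *\<^sub>R f x)"
    "integrable m (\<lambda>x. max 0 (Im (u x)) *\<^sub>R f x)" "integrable m (\<lambda>x. max 0 (- Im (u x)) *\<^sub>R f x)"
    by (intro I; simp add: abs_Re_le_cmod abs_Im_le_cmod)+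
  have "cmeas_integral (density_charge m u) f = (LINT x|m. (max 0 (Re (u x)) *\<^sub>R f x - max 0 (- Re (u x)) *\<^sub>R f x)
      + \<i> * (max 0 (Im (u x)) *\<^sub>R f x - max 0 (- Im (u x)) *\<^sub>R f x))"
    unfolding cmeas_integral_def pos_variation_density_charge by (simp add: D i)
  also have "\<dots> = (LINT x|m. f x * u x)"
  proof (rule Bochner_Integration.integral_cong[OF refl])
    fix x
    have m: "max 0 a - max 0 (- a) = a" for a :: real by (simp add: max_def)
    have "(max 0 (Re (u x)) *\<^sub>R f x - max 0 (- Re (u x)) *\<^sub>R f x) + \<i> * (max 0 (Im (u x)) *\<^sub>R f x - max 0 (- Im (u x)) *\<^sub>R f x)
       = Re (u x) *\<^sub>R f x + \<i> * (Im (u x) *\<^sub>R f x)"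
      unfolding scaleR_diff_left[symmetric] m ..
    also have "\<dots> = f x * u x"
      by (subst (3) complex_eq[of "u x"]) (simp add: scaleR_conv_of_real algebra_simps)
    finally show "(max 0 (Re (u x)) *\<^sub>R f x - max 0 (- Re (u x)) *\<^sub>R f x) + \<i> * (max 0 (Im (u x)) *\<^sub>R f x - max 0 (- Im (u x)) *\<^sub>R f x) = f x * u x" .
  qed
  finally show ?thesis .
qed

end

section \<open>A translation bounded measure as a bounded density\<close>

lemma exists_sum_measure:
  assumes M: "sets M = sets borel" and N: "sets N = sets borel"
  obtains K where "sets K = sets borel" "\<And>A. A \<in> sets borel \<Longrightarrow> emeasure K A = emeasure M A + emeasure N A"
proof
  have [simp]: "space M = UNIV" "space N = UNIV"
    using sets_eq_imp_space_eq[OF M] sets_eq_imp_space_eq[OF N] by simp_all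
  let ?K = "measure_of (UNIV :: 'a set) (sets borel) (\<lambda>A. emeasure M A + emeasure N A)"
  show "sets ?K = sets borel"
    using sets.sigma_sets_eq[of "borel :: 'a measure"] by (simp add: sets_measure_of)
  show "emeasure ?K A = emeasure M A + emeasure N A" if "A \<in> sets borel" for A
  proof (rule emeasure_measure_of_sigma)
    show "sigma_algebra UNIV (sets (borel :: 'a measure))"
      using sets.sigma_algebra_axioms[of "borel :: 'a measure"] by simp
    show "positive (sets borel) (\<lambda>A. emeasure M A + emeasure N A)" by (simp add: positive_def)
    show "countably_additive (sets borel) (\<lambda>A. emeasure M A + emeasure N A)"
    proof (rule countably_additiveI)
      fix F :: "nat \<Rightarrow> 'a set" assume "range F \<subseteq> sets borel" "disjoint_family F"
      then show "(\<Sum>i. emeasure M (F i) + emeasure N (F i)) = emeasure M (\<Union> (range F)) + emeasure N (\<Union> (range F))"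
        by (simp add: suminf_add[symmetric] suminf_emeasure M N)
    qed
  qed fact
qed

locale translation_bounded_measure = radon_measure m for m :: "(real^'n::finite) measure" +
  assumes translation_bdd: "compact K \<Longrightarrow> (SUP t. emeasure m ((+) t ` K)) < \<infinity>"
begin

text \<open>The mass that \<open>m\<close> has at \<open>y\<close> is spread over the unit cube around \<open>y\<close>, where \<open>weight\<close> is nearly
  constant. After exchanging the integrals, \<open>weight x\<close> is integrated against Lebesgue measure, with
  the mass of the unit cube around \<open>x\<close> as a factor, and this mass is bounded uniformly in \<open>x\<close>.\<close>
lemma nn_integral_weight: "(\<integral>\<^sup>+y. ennreal (weight y) \<partial>m) < \<infinity>"
proof -
  \<comment> \<open>Half the side of the unit cube, which is thus centred at the origin.\<close>
  let ?h = "vec (1/2) :: real^'n" and ?d = "CARD('n)"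
  interpret sigma_finite_measure m by (rule sigma_finite)
  interpret pair_sigma_finite "lborel :: (real^'n) measure" m ..
  define C where "C = (SUP t. emeasure m ((+) t ` cbox (- ?h) ?h))"
  have C: "C < \<infinity>" unfolding C_def by (rule translation_bdd) simp
  define D where "D = {p :: (real^'n) \<times> (real^'n). \<forall>i. \<bar>snd p $ i - fst p $ i\<bar> \<le> 1 / 2}"
  let ?F = "\<lambda>(x, y). ennreal (weight y) * indicator D (x, y) :: ennreal"
  have "closed D" unfolding D_def
    by (intro closed_Collect_all closed_Collect_le continuous_intros)
  moreover have "sets (lborel \<Otimes>\<^sub>M m) = sets (borel :: ((real^'n) \<times> (real^'n)) measure)"
    unfolding borel_prod[symmetric] by (intro sets_pair_measure_cong) simp_all
  ultimately have [measurable]: "D \<in> sets (lborel \<Otimes>\<^sub>M m)" by (simp add: borel_closed)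
  have meas: "?F \<in> borel_measurable (lborel \<Otimes>\<^sub>M m)"
    by measurable
  have box: "{x. \<forall>i. \<bar>y $ i - x $ i\<bar> \<le> 1 / 2} = cbox (y - ?h) (y + ?h)" for y :: "real^'n"
    unfolding mem_box_cart set_eq_iff by (auto simp: abs_le_iff) (smt (verit) field_sum_of_halves)+
  have box': "{y. \<forall>i. \<bar>y $ i - x $ i\<bar> \<le> 1 / 2} = (+) x ` cbox (- ?h) ?h" for x :: "real^'n"
  proof -
    have "(+) x ` cbox (- ?h) ?h = cbox (x - ?h) (x + ?h)"
      using cbox_translation[of x "- ?h" ?h] by simp
    then show ?thesis unfolding box[symmetric] by (simp add: abs_minus_commute)
  qed
  have "(\<integral>\<^sup>+y. ennreal (weight y) \<partial>m) = (\<integral>\<^sup>+y. \<integral>\<^sup>+x. ?F (x, y) \<partial>lborel \<partial>m)"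
  proof (rule nn_integral_cong)
    fix y :: "real^'n"
    have "(\<integral>\<^sup>+x. ?F (x, y) \<partial>lborel) = (\<integral>\<^sup>+x. ennreal (weight y) * indicator (cbox (y - ?h) (y + ?h)) x \<partial>lborel)"
      unfolding box[symmetric] by (intro nn_integral_cong) (auto simp: D_def split: split_indicator)
    also have "\<dots> = ennreal (weight y) * emeasure lborel (cbox (y - ?h) (y + ?h))"
      by (subst nn_integral_cmult_indicator) auto
    also have "emeasure lborel (cbox (y - ?h) (y + ?h)) = 1"
    proof -
      have "(y + ?h - (y - ?h)) \<bullet> b = 1" if "b \<in> Basis" for b
        using that unfolding Basis_real_vec by (auto simp: inner_axis)
      then show ?thesis by (subst emeasure_lborel_cbox) (auto simp: Basis_real_vec inner_axis)
    qed
    finally show "ennreal (weight y) = (\<integral>\<^sup>+x. ?F (x, y) \<partial>lborel)" by simp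
  qed
  also have "\<dots> = (\<integral>\<^sup>+x. \<integral>\<^sup>+y. ?F (x, y) \<partial>m \<partial>lborel)"
    by (rule Fubini[OF meas])
  also have "\<dots> \<le> (\<integral>\<^sup>+x. (3 ^ ?d * C) * ennreal (weight x) \<partial>(lborel :: (real^'n) measure))"
  proof (rule nn_integral_mono)
    fix x :: "real^'n"
    have "(\<integral>\<^sup>+y. ?F (x, y) \<partial>m) \<le> (\<integral>\<^sup>+y. ennreal (3 ^ ?d * weight x) * indicator ((+) x ` cbox (- ?h) ?h) y \<partial>m)"
    proof (rule nn_integral_mono)
      fix y :: "real^'n"
      show "?F (x, y) \<le> ennreal (3 ^ ?d * weight x) * indicator ((+) x ` cbox (- ?h) ?h) y"
      proof (cases "\<forall>i. \<bar>y $ i - x $ i\<bar> \<le> 1 / 2")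
        case True
        have "\<bar>(x - y) $ i\<bar> \<le> 1" for i using spec[OF True, of i] unfolding vector_minus_component by linarith
        then have "weight y \<le> 3 ^ ?d * weight (y + (x - y))" by (rule weight_shift)
        then show ?thesis unfolding box'[symmetric] using True by (auto simp: D_def intro: ennreal_leI)
      qed (auto simp: D_def)
    qed
    also have "\<dots> = ennreal (3 ^ ?d * weight x) * emeasure m ((+) x ` cbox (- ?h) ?h)"
      by (subst nn_integral_cmult_indicator) (auto simp: box'[symmetric])
    also have "\<dots> \<le> ennreal (3 ^ ?d * weight x) * C"
      unfolding C_def by (intro mult_left_mono SUP_upper) auto
    also have "\<dots> = (3 ^ ?d * C) * ennreal (weight x)"
      by (simp add: ennreal_mult less_imp_le[OF weight_pos] mult_ac ennreal_power[symmetric])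
    finally show "(\<integral>\<^sup>+y. ?F (x, y) \<partial>m) \<le> (3 ^ ?d * C) * ennreal (weight x)" .
  qed
  also have "\<dots> = (3 ^ ?d * C) * (\<integral>\<^sup>+x. ennreal (weight x) \<partial>(lborel :: (real^'n) measure))"
    by (rule nn_integral_cmult) measurable
  also have "\<dots> < \<infinity>"
    using C integrable_weight[where 'n='n, unfolded integrable_iff_bounded]
    by (auto simp: ennreal_mult_less_top less_imp_le[OF weight_pos] power_less_top_ennreal)
  finally show ?thesis .
qed

lemma integrable_weight_m: "integrable m weight"
  using nn_integral_weight by (simp add: integrable_iff_bounded less_imp_le[OF weight_pos])

end

text \<open>Every translation bounded complex measure will be written with a bounded density \<open>u\<close> over a positive
  translation bounded measure \<open>m\<close>. The parts of the complex measure are obtained by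
  changing \<open>u\<close> alone, keeping both \<open>m\<close> and the bound \<open>U\<close>.\<close>
locale bounded_density = translation_bounded_measure m for m :: "(real^'n::finite) measure" +
  fixes u :: "real^'n \<Rightarrow> complex" and U :: real
  assumes u_measurable' [measurable]: "u \<in> borel_measurable borel" and u_bound: "cmod (u x) \<le> U"
begin

lemma U_nonneg: "0 \<le> U" using order_trans[OF norm_ge_zero u_bound] .

sublocale radon_density m u
proof
  show "u \<in> borel_measurable borel" by (rule u_measurable')
  fix A :: "(real^'n) set" assume A: "A \<in> bounded_borel"
  then have [measurable]: "A \<in> sets borel" by (rule bounded_borelD)
  show "set_integrable m A u" unfolding set_integrable_def
  proof (rule Bochner_Integration.integrable_bound)
    show "integrable m (\<lambda>x. indicator A x * U)"
      using finite_bounded[OF A] by (intro integrable_mult_left integrable_real_indicator) auto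
    show "AE x in m. norm (indicator A x *\<^sub>R u x) \<le> norm (indicat_real A x * U)"
      using u_bound U_nonneg by (auto split: split_indicator)
  qed measurable
qed

lemma density_charge_translation_bounded: "density_charge m u \<in> translation_bounded"
  unfolding translation_bounded_def
proof (intro CollectI conjI allI impI density_charge_radon)
  fix K :: "(real^'n) set" assume K: "compact K"
  have "(SUP t. total_variation (density_charge m u) ((+) t ` K)) \<le> ennreal U * (SUP t. emeasure m ((+) t ` K))"
  proof (rule SUP_least)
    fix t
    have [measurable]: "(+) t ` K \<in> sets borel" using K by (simp add: compact_translation borel_compact)
    have "total_variation (density_charge m u) ((+) t ` K) \<le> (\<integral>\<^sup>+x\<in>(+) t ` K. cmod (u x) \<partial>m)"
      by (rule total_variation_density_charge) measurable
    also have "\<dots> \<le> (\<integral>\<^sup>+x. ennreal U * indicator ((+) t ` K) x \<partial>m)"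
      using u_bound by (intro nn_integral_mono) (auto split: split_indicator intro: ennreal_leI)
    also have "\<dots> = ennreal U * emeasure m ((+) t ` K)"
      by (subst nn_integral_cmult_indicator) auto
    also have "\<dots> \<le> ennreal U * (SUP t. emeasure m ((+) t ` K))"
      by (intro mult_left_mono SUP_upper) auto
    finally show "total_variation (density_charge m u) ((+) t ` K) \<le> ennreal U * (SUP t. emeasure m ((+) t ` K))" .
  qed
  also have "\<dots> < \<infinity>" using translation_bdd[OF K] by (simp add: ennreal_mult_less_top)
  finally show "(SUP t. total_variation (density_charge m u) ((+) t ` K)) < \<infinity>" .
qed

lemma restrict:
  assumes [measurable]: "E \<in> sets borel"
  shows "bounded_density m (\<lambda>x. indicator E x * u x) U"
    and "A \<in> bounded_borel \<Longrightarrow> density_charge m (\<lambda>x. indicator E x * u x) A = density_charge m u (A \<inter> E)"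
proof -
  show "bounded_density m (\<lambda>x. indicator E x * u x) U"
    using u_bound U_nonneg by unfold_locales (auto split: split_indicator)
  assume A: "A \<in> bounded_borel"
  then have "A \<inter> E \<in> bounded_borel" by (rule bounded_borel_Int) measurable
  then show "density_charge m (\<lambda>x. indicator E x * u x) A = density_charge m u (A \<inter> E)"
    using A unfolding density_charge_def set_lebesgue_integral_def
    by (auto intro!: Bochner_Integration.integral_cong split: split_indicator)
qed

end

text \<open>The Radon--Nikodym density is at most \<open>1\<close> almost everywhere, since otherwise the part of some ball
  where it exceeds \<open>1\<close> would have more mass under \<open>M\<close> than under \<open>m\<close>; balls have finite mass, so the two
  integrals may be subtracted. Truncation then gives the bound everywhere.\<close>
lemma (in radon_measure) dominated_measure_density:
  assumes M [measurable_cong]: "sets M = sets borel"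
    and le: "\<And>A. A \<in> sets borel \<Longrightarrow> emeasure M A \<le> emeasure m A"
  obtains e where "e \<in> borel_measurable borel" "\<And>x. 0 \<le> e x" "\<And>x. e x \<le> 1"
    "\<And>A. A \<in> bounded_borel \<Longrightarrow> set_integrable m A e"
    "\<And>A. A \<in> bounded_borel \<Longrightarrow> measure M A = (LINT x:A|m. e x)"
proof -
  interpret sigma_finite_measure m by (rule sigma_finite)
  have "absolutely_continuous m M"
    unfolding absolutely_continuous_def null_sets_def using le by (auto simp: M) (metis le_zero_eq)
  then obtain d where d: "d \<in> borel_measurable m" and dM: "density m d = M"
    using Radon_Nikodym[of M] M by auto
  then have [measurable]: "d \<in> borel_measurable borel" by (simp cong: measurable_cong_sets)
  have "AE x in m. \<forall>n::nat. \<not> (1 < d x \<and> x \<in> cball 0 (real n))"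
    unfolding AE_all_countable
  proof
    fix n :: nat
    let ?A = "{x. 1 < d x} \<inter> cball 0 (real n)"
    have A [measurable]: "?A \<in> sets borel" by measurable
    have "?A \<in> bounded_borel" using bounded_borel_Int[OF cball_in, of "{x. 1 < d x}" "real n"] by (simp add: Int_commute)
    then have fin: "emeasure m ?A \<noteq> \<infinity>" using finite_bounded by (simp add: less_top[symmetric])
    have "(\<integral>\<^sup>+x. d x * indicator ?A x - indicator ?A x \<partial>m) = (\<integral>\<^sup>+x. d x * indicator ?A x \<partial>m) - (\<integral>\<^sup>+x. indicator ?A x \<partial>m)"
      using fin by (intro nn_integral_diff) (auto split: split_indicator)
    also have "\<dots> = emeasure M ?A - emeasure m ?A"
      unfolding dM[symmetric] by (subst emeasure_density) (auto simp: d)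
    also have "\<dots> = 0"
      using le[OF A] fin unfolding diff_eq_0_iff_ennreal by (metis infinity_ennreal_def le_less_trans less_top)
    finally have "AE x in m. d x * indicator ?A x - indicator ?A x = 0"
      by (subst (asm) nn_integral_0_iff_AE) auto
    then show "AE x in m. \<not> (1 < d x \<and> x \<in> cball 0 (real n))"
    proof eventually_elim
      case (elim x)
      show ?case
      proof
        assume x: "1 < d x \<and> x \<in> cball 0 (real n)"
        then have "d x \<le> 1" using elim by (simp add: diff_eq_0_iff_ennreal)
        then show False using x by (simp add: leD)
      qed
    qed
  qed
  then have d1: "AE x in m. d x \<le> 1"
  proof eventually_elim
    case (elim x)
    obtain n :: nat where "norm x \<le> real n" using real_arch_simple by blast
    then show ?case using spec[OF elim, of n] by (simp add: not_less)
  qed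
  define e where "e x = enn2real (min (d x) 1)" for x
  have e01: "0 \<le> e x" "e x \<le> 1" for x
    unfolding e_def by (auto simp: enn2real_leI)
  have em [measurable]: "e \<in> borel_measurable borel" unfolding e_def[abs_def] by measurable
  show thesis
  proof (rule that[OF em e01])
    fix A :: "(real^'n) set" assume A: "A \<in> bounded_borel"
    note [measurable] = bounded_borelD[OF A]
    have Am: "A \<in> sets m" by simp
    show "set_integrable m A e" unfolding set_integrable_def
    proof (rule Bochner_Integration.integrable_bound)
      show "integrable m (indicat_real A)" using finite_bounded[OF A] by (intro integrable_real_indicator) auto
    qed (auto simp: e01 split: split_indicator)
    have "emeasure M A = (\<integral>\<^sup>+x. ennreal (indicator A x *\<^sub>R e x) \<partial>m)"
      unfolding dM[symmetric] emeasure_density[OF d Am]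
    proof (rule nn_integral_cong_AE, use d1 in eventually_elim)
      case (elim x)
      then have "ennreal (e x) = d x" unfolding e_def
        by (simp add: min_absorb1 order.strict_trans1[OF elim])
      then show ?case by (auto split: split_indicator)
    qed
    then show "measure M A = (LINT x:A|m. e x)"
      unfolding measure_def set_lebesgue_integral_def
      by (subst integral_eq_nn_integral) (auto simp: e01 intro!: AE_I2)
  qed
qed

lemma emeasure_pos_variation_le_total_variation:
  assumes "bounded_charge r" "\<And>B. r B \<le> cmod (\<mu> B)" "A \<in> sets borel"
  shows "emeasure (pos_variation r) A \<le> total_variation \<mu> A"
  unfolding bounded_charge.emeasure_pos_variation[OF assms(1,3)]
proof (rule SUP_least)
  fix B assume B: "B \<in> {B \<in> bounded_borel. B \<subseteq> A}"
  have "ennreal (r B) \<le> ennreal (cmod (\<mu> B))" by (rule ennreal_leI[OF assms(2)])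
  also have "\<dots> \<le> total_variation \<mu> A"
    unfolding total_variation_def by (rule SUP_upper2[of "{B}"]) (use B in auto)
  finally show "ennreal (r B) \<le> total_variation \<mu> A" .
qed

text \<open>Take for \<open>m\<close> the sum of the positive variations of \<open>Re \<mu>\<close>, \<open>- Re \<mu>\<close>, \<open>Im \<mu>\<close> and \<open>- Im \<mu>\<close>. Each is at most
  the total variation of \<open>\<mu>\<close>, so \<open>m\<close> is translation bounded, and each is dominated by \<open>m\<close>, so it
  has a density with values between \<open>0\<close> and \<open>1\<close>. By the Jordan decomposition the density of \<open>\<mu>\<close>
  combines these four.\<close>
theorem translation_bounded_obtain_density:
  fixes \<mu> :: "'n::finite cmeas"
  assumes \<mu>: "\<mu> \<in> translation_bounded"
  obtains m u where "bounded_density m u 4" "\<mu> = density_charge m u"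
proof -
  have rad: "\<mu> \<in> radon" using \<mu> by (simp add: translation_bounded_def)
  interpret c1: bounded_charge "\<lambda>A. Re (\<mu> A)" by (rule radon_bounded_charge[OF rad])
  interpret c2: bounded_charge "\<lambda>A. - Re (\<mu> A)" by (rule radon_bounded_charge[OF rad])
  interpret c3: bounded_charge "\<lambda>A. Im (\<mu> A)" by (rule radon_bounded_charge[OF rad])
  interpret c4: bounded_charge "\<lambda>A. - Im (\<mu> A)" by (rule radon_bounded_charge[OF rad])
  let ?M1 = "pos_variation (\<lambda>A. Re (\<mu> A))" and ?M2 = "pos_variation (\<lambda>A. - Re (\<mu> A))"
  and ?M3 = "pos_variation (\<lambda>A. Im (\<mu> A))" and ?M4 = "pos_variation (\<lambda>A. - Im (\<mu> A))"
  have R: "Re z \<le> cmod z" "- Re z \<le> cmod z" "Im z \<le> cmod z" "- Im z \<le> cmod z" for z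
    using abs_Re_le_cmod[of z] abs_Im_le_cmod[of z] by auto
  note le4 = emeasure_pos_variation_le_total_variation[OF c1.bounded_charge_axioms R(1)]
    emeasure_pos_variation_le_total_variation[OF c2.bounded_charge_axioms R(2)]
    emeasure_pos_variation_le_total_variation[OF c3.bounded_charge_axioms R(3)]
    emeasure_pos_variation_le_total_variation[OF c4.bounded_charge_axioms R(4)]
  obtain M12 where M12: "sets M12 = sets borel" "\<And>A. A \<in> sets borel \<Longrightarrow> emeasure M12 A = emeasure ?M1 A + emeasure ?M2 A"
    using exists_sum_measure[OF c1.sets_pos_variation c2.sets_pos_variation] by blast
  obtain M34 where M34: "sets M34 = sets borel" "\<And>A. A \<in> sets borel \<Longrightarrow> emeasure M34 A = emeasure ?M3 A + emeasure ?M4 A"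
    using exists_sum_measure[OF c3.sets_pos_variation c4.sets_pos_variation] by blast
  obtain m where m: "sets m = sets borel" "\<And>A. A \<in> sets borel \<Longrightarrow> emeasure m A = emeasure M12 A + emeasure M34 A"
    using exists_sum_measure[OF M12(1) M34(1)] by blast
  have m_eq: "emeasure m A = emeasure ?M1 A + emeasure ?M2 A + (emeasure ?M3 A + emeasure ?M4 A)" if "A \<in> sets borel" for A
    using that by (simp add: m M12 M34)
  have m_le: "emeasure m A \<le> 4 * total_variation \<mu> A" if A: "A \<in> sets borel" for A
  proof -
    let ?t = "total_variation \<mu> A"
    have "emeasure m A \<le> ?t + ?t + (?t + ?t)"
      unfolding m_eq[OF A] by (intro add_mono le4 A)
    also have "\<dots> = 4 * ?t" by (simp add: mult_2[symmetric] mult.assoc[symmetric])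
    finally show ?thesis .
  qed
  have tb: "(SUP t. emeasure m ((+) t ` K)) < \<infinity>" if K: "compact K" for K
  proof -
    have "(SUP t. emeasure m ((+) t ` K)) \<le> (SUP t. 4 * total_variation \<mu> ((+) t ` K))"
      using K by (intro SUP_mono') (auto intro!: m_le simp: compact_translation borel_compact)
    also have "\<dots> = 4 * (SUP t. total_variation \<mu> ((+) t ` K))" by (simp add: SUP_mult_left_ennreal)
    also have "\<dots> < \<infinity>" using \<mu> K by (simp add: translation_bounded_def ennreal_mult_less_top)
    finally show ?thesis .
  qed
  interpret m: translation_bounded_measure m
  proof
    show "sets m = sets borel" by fact
    show "emeasure m A < \<infinity>" if A: "A \<in> bounded_borel" for A
    proof -
      have "bounded A" using A by (simp add: bounded_borel_def)
      then obtain r where "A \<subseteq> ball 0 r" using bounded_subset_ballD by blast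
      then have "A \<subseteq> cball 0 r" using ball_subset_cball by (rule order_trans)
      then have "emeasure m A \<le> emeasure m ((+) 0 ` cball 0 r)"
        using A by (intro emeasure_mono) (auto simp: bounded_borel_def m)
      also have "\<dots> \<le> (SUP t. emeasure m ((+) t ` cball 0 r))" by (rule SUP_upper) simp
      also have "\<dots> < \<infinity>" by (rule tb) simp
      finally show ?thesis .
    qed
  qed (rule tb)
  have le_m: "emeasure ?M1 A \<le> emeasure m A" "emeasure ?M2 A \<le> emeasure m A"
    "emeasure ?M3 A \<le> emeasure m A" "emeasure ?M4 A \<le> emeasure m A" if "A \<in> sets borel" for A
    unfolding m_eq[OF that] by (simp_all add: add_increasing add_increasing2)
  obtain e1 where e1: "e1 \<in> borel_measurable borel" "\<And>x. 0 \<le> e1 x" "\<And>x. e1 x \<le> 1"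
    "\<And>A. A \<in> bounded_borel \<Longrightarrow> set_integrable m A e1" "\<And>A. A \<in> bounded_borel \<Longrightarrow> measure ?M1 A = (LINT x:A|m. e1 x)"
    using m.dominated_measure_density[OF c1.sets_pos_variation le_m(1)] by blast
  obtain e2 where e2: "e2 \<in> borel_measurable borel" "\<And>x. 0 \<le> e2 x" "\<And>x. e2 x \<le> 1"
    "\<And>A. A \<in> bounded_borel \<Longrightarrow> set_integrable m A e2" "\<And>A. A \<in> bounded_borel \<Longrightarrow> measure ?M2 A = (LINT x:A|m. e2 x)"
    using m.dominated_measure_density[OF c2.sets_pos_variation le_m(2)] by blast
  obtain e3 where e3: "e3 \<in> borel_measurable borel" "\<And>x. 0 \<le> e3 x" "\<And>x. e3 x \<le> 1"
    "\<And>A. A \<in> bounded_borel \<Longrightarrow> set_integrable m A e3" "\<And>A. A \<in> bounded_borel \<Longrightarrow> measure ?M3 A = (LINT x:A|m. e3 x)"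
    using m.dominated_measure_density[OF c3.sets_pos_variation le_m(3)] by blast
  obtain e4 where e4: "e4 \<in> borel_measurable borel" "\<And>x. 0 \<le> e4 x" "\<And>x. e4 x \<le> 1"
    "\<And>A. A \<in> bounded_borel \<Longrightarrow> set_integrable m A e4" "\<And>A. A \<in> bounded_borel \<Longrightarrow> measure ?M4 A = (LINT x:A|m. e4 x)"
    using m.dominated_measure_density[OF c4.sets_pos_variation le_m(4)] by blast
  \<comment> \<open>The bound \<open>4\<close> adds up the four densities.\<close>
  define u where "u x = complex_of_real (e1 x) - e2 x + \<i> * (e3 x - e4 x)" for x
  have u_meas: "u \<in> borel_measurable borel"
    using e1(1) e2(1) e3(1) e4(1) unfolding u_def[abs_def] by measurable
  have ub: "cmod (u x) \<le> 4" for x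
  proof -
    have "cmod (u x) \<le> cmod (of_real (e1 x - e2 x)) + cmod (\<i> * of_real (e3 x - e4 x))"
      unfolding u_def by (rule order_trans[OF _ norm_triangle_ineq]) simp
    also have "\<dots> = \<bar>e1 x - e2 x\<bar> + \<bar>e3 x - e4 x\<bar>" by (simp only: norm_mult norm_of_real) simp
    also have "\<dots> \<le> 4"
      using e1(2,3)[of x] e2(2,3)[of x] e3(2,3)[of x] e4(2,3)[of x] by linarith
    finally show ?thesis .
  qed
  have "\<mu> = density_charge m u"
  proof
    fix A show "\<mu> A = density_charge m u A"
    proof (cases "A \<in> bounded_borel")
      case True
      note fins = le_m[OF bounded_borelD[OF True], THEN le_less_trans, OF m.finite_bounded[OF True]]
      have I: "integrable m (\<lambda>x. complex_of_real (indicator A x * e x))" if "set_integrable m A e" for e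
        using that unfolding set_integrable_def by (intro integrable_of_real) simp
      have "density_charge m u A = (LINT x|m. complex_of_real (indicator A x * e1 x) - complex_of_real (indicator A x * e2 x)
          + \<i> * (complex_of_real (indicator A x * e3 x) - complex_of_real (indicator A x * e4 x)))"
        unfolding density_charge_def set_lebesgue_integral_def u_def using True
        by (auto intro!: Bochner_Integration.integral_cong split: split_indicator)
      also have "\<dots> = of_real (LINT x:A|m. e1 x) - of_real (LINT x:A|m. e2 x)
          + \<i> * (of_real (LINT x:A|m. e3 x) - of_real (LINT x:A|m. e4 x))"
        using I[OF e1(4)[OF True]] I[OF e2(4)[OF True]] I[OF e3(4)[OF True]] I[OF e4(4)[OF True]]
        by (simp add: set_lebesgue_integral_def del: of_real_mult flip: integral_of_real)
      also have "\<dots> = of_real (measure ?M1 A) - of_real (measure ?M2 A) + \<i> * (of_real (measure ?M3 A) - of_real (measure ?M4 A))"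
        unfolding e1(5)[OF True] e2(5)[OF True] e3(5)[OF True] e4(5)[OF True] ..
      also have "\<dots> = of_real (Re (\<mu> A)) + \<i> * of_real (Im (\<mu> A))"
        using c1.jordan[OF True fins(1,2)] c3.jordan[OF True fins(3,4)] by simp
      also have "\<dots> = \<mu> A" by (simp add: complex_eq[symmetric])
      finally show ?thesis by simp
    next
      case False
      then show ?thesis using rad by (simp add: density_charge_def radon_def)
    qed
  qed
  moreover have "bounded_density m u 4" by unfold_locales (use u_meas ub in auto)
  ultimately show thesis using that by blast
qed

section \<open>The Lebesgue decomposition\<close>

context translation_bounded_measure begin

definition atoms :: "(real^'n) set" where "atoms = {x. emeasure m {x} \<noteq> 0}"

text \<open>A finite measure with the same null sets as \<open>m\<close>.\<close>
definition weighted :: "(real^'n) measure" where "weighted = density m (\<lambda>x. ennreal (weight x))"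

lemma sets_weighted [measurable_cong, simp]: "sets weighted = sets borel"
  and space_weighted [simp]: "space weighted = UNIV"
  by (simp_all add: weighted_def)

lemma finite_weighted: "finite_measure weighted"
proof
  have "emeasure weighted UNIV = (\<integral>\<^sup>+x. ennreal (weight x) \<partial>m)"
    unfolding weighted_def by (subst emeasure_density) auto
  then show "emeasure weighted (space weighted) \<noteq> \<infinity>" using nn_integral_weight by simp
qed

lemma emeasure_weighted_eq_0: "A \<in> sets borel \<Longrightarrow> emeasure weighted A = 0 \<longleftrightarrow> emeasure m A = 0"
proof -
  assume A [measurable]: "A \<in> sets borel"
  have "emeasure weighted A = 0 \<longleftrightarrow> (AE x in m. x \<in> A \<longrightarrow> ennreal (weight x) = 0)"
    unfolding weighted_def by (subst emeasure_density) (auto simp: nn_integral_0_iff_AE indicator_eq_0_iff)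
  also have "\<dots> \<longleftrightarrow> (AE x in m. x \<notin> A)"
  proof (intro AE_cong)
    fix x show "(x \<in> A \<longrightarrow> ennreal (weight x) = 0) \<longleftrightarrow> x \<notin> A"
      using weight_pos[of x] by (simp add: ennreal_eq_0_iff)
  qed
  also have "\<dots> \<longleftrightarrow> emeasure m A = 0"
    by (subst AE_iff_measurable[of A]) auto
  finally show ?thesis .
qed

lemma countable_atoms: "countable atoms"
proof -
  interpret finite_measure weighted by (rule finite_weighted)
  have "atoms = {x. measure weighted {x} \<noteq> 0}"
    unfolding atoms_def using emeasure_weighted_eq_0 by (auto simp: emeasure_eq_measure)
  then show ?thesis using countable_support by simp
qed

lemma borel_atoms [measurable]: "atoms \<in> sets borel"
  by (rule sets.countable[OF _ countable_atoms]) simp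

text \<open>Among the Lebesgue null sets choose a sequence whose \<open>weighted\<close> masses approach their supremum.
  The union of the sequence attains the supremum, so a null set disjoint from it can
  add no mass. Finiteness of \<open>weighted\<close> is what makes the masses comparable.\<close>
lemma exists_maximal_null_set:
  obtains N where "N \<in> sets borel" "emeasure lborel N = 0"
    "\<And>A. A \<in> sets borel \<Longrightarrow> emeasure lborel A = 0 \<Longrightarrow> A \<inter> N = {} \<Longrightarrow> emeasure m A = 0"
proof -
  interpret finite_measure weighted by (rule finite_weighted)
  define Z where "Z = {N :: (real^'n) set. N \<in> sets borel \<and> emeasure lborel N = 0}"
  have Z0: "{} \<in> Z" by (simp add: Z_def)
  define c where "c = (SUP N\<in>Z. emeasure weighted N)"
  obtain F :: "nat \<Rightarrow> (real^'n) set" where F: "\<And>n. F n \<in> Z" "(SUP n. emeasure weighted (F n)) = c"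
  proof -
    obtain g where g: "range g \<subseteq> (\<lambda>N. emeasure weighted N) ` Z" "c = (SUP n::nat. g n)"
      using ennreal_SUP_countable_SUP[of Z "emeasure weighted"] Z0 unfolding c_def by auto
    then have "\<forall>n. \<exists>N\<in>Z. g n = emeasure weighted N" by auto
    then obtain F where "\<And>n. F n \<in> Z" "\<And>n. g n = emeasure weighted (F n)" by metis
    then show ?thesis using that[of F] g by simp
  qed
  define N where "N = (\<Union>n. F n)"
  have NZ: "N \<in> Z"
  proof -
    have "(\<Union>n. F n) \<in> null_sets lborel"
      using F(1) by (intro null_sets_UN) (auto simp: Z_def null_sets_def)
    then show ?thesis by (auto simp: N_def Z_def null_sets_def)
  qed
  have cN: "c \<le> emeasure weighted N"
    unfolding F(2)[symmetric] N_def using F(1) by (intro SUP_least emeasure_mono) (auto simp: Z_def)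
  show thesis
  proof
    show "N \<in> sets borel" "emeasure lborel N = 0" using NZ by (auto simp: Z_def)
    fix A :: "(real^'n) set" assume A: "A \<in> sets borel" "emeasure lborel A = 0" "A \<inter> N = {}"
    have "A \<union> N \<in> null_sets lborel" using A NZ by (intro null_sets.Un) (auto simp: Z_def null_sets_def)
    then have "A \<union> N \<in> Z" by (auto simp: Z_def null_sets_def)
    then have "emeasure weighted (A \<union> N) \<le> emeasure weighted N" using cN unfolding c_def by (meson SUP_upper order_trans)
    moreover have "emeasure weighted (A \<union> N) = emeasure weighted A + emeasure weighted N"
      using A NZ by (intro plus_emeasure[symmetric]) (auto simp: Z_def)
    ultimately have "emeasure weighted A = 0"
      by (simp add: emeasure_eq_measure ennreal_plus[symmetric] measure_le_0_iff del: ennreal_plus)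
    then show "emeasure m A = 0" using emeasure_weighted_eq_0 A by simp
  qed
qed

end

lemma radon_countable_sums:
  "\<mu> \<in> radon \<Longrightarrow> range A \<subseteq> sets borel \<Longrightarrow> disjoint_family A \<Longrightarrow> bounded (\<Union>n::nat. A n) \<Longrightarrow> (\<lambda>n. \<mu> (A n)) sums \<mu> (\<Union>n. A n)"
  by (simp add: radon_def)

lemma radon_countable_null:
  assumes s: "s \<in> radon" and pt: "\<And>x. s {x} = 0" and D: "countable D" and A: "A \<in> bounded_borel"
  shows "s (A \<inter> D) = 0"
proof -
  have e: "s {} = 0"
    using radon_bounded_charge(1,2)[OF s, THEN bounded_charge.empty] by (simp add: complex_eq_iff)
  define B where "B n = {x \<in> A \<inter> D. to_nat_on D x = n}" for n
  have sub: "(\<exists>x. B n = {x}) \<or> B n = {}" for n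
  proof -
    have "x = y" if "x \<in> B n" "y \<in> B n" for x y
      using that inj_on_to_nat_on[OF D] by (auto simp: B_def inj_on_def)
    then show ?thesis by blast
  qed
  have B0: "s (B n) = 0" for n using sub[of n] pt e by auto
  have U: "(\<Union>n. B n) = A \<inter> D" by (auto simp: B_def)
  have "(\<lambda>n. s (B n)) sums s (\<Union>n. B n)"
  proof (rule radon_countable_sums[OF s])
    show "range B \<subseteq> sets borel" using sub by (metis (no_types, lifting) borel_singleton image_subsetI sets.empty_sets)
    show "disjoint_family B" by (auto simp: disjoint_family_on_def B_def)
    show "bounded (\<Union>n. B n)" unfolding U using A by (auto simp: bounded_borel_def intro: bounded_subset)
  qed
  then have "(\<lambda>n::nat. 0::complex) sums s (A \<inter> D)" by (simp add: B0 U)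
  then show ?thesis by (rule sums_unique2[OF _ sums_zero])
qed

lemma countable_lborel_null:
  fixes C :: "(real^'n::finite) set"
  assumes "countable C" shows "C \<in> sets borel" "emeasure lborel C = 0"
  using assms by (auto intro: sets.countable emeasure_lborel_countable)

text \<open>The pure point parts live on a countable set \<open>D\<close> and the singular continuous parts on a Lebesgue
  null set \<open>K\<close>. On subsets of \<open>D\<close> the other parts vanish, which identifies \<open>p\<close> and \<open>p'\<close>; on
  subsets of \<open>K\<close> the absolutely continuous parts vanish, which then identifies \<open>s\<close> and \<open>s'\<close>.\<close>
lemma lebesgue_decomposition_unique:
  fixes \<mu> :: "'n::finite cmeas"
  assumes 1: "lebesgue_decomposition \<mu> p a s" and 2: "lebesgue_decomposition \<mu> p' a' s'"
  shows "p' = p \<and> a' = a \<and> s' = s"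
proof -
  obtain C where C: "countable C" "\<And>A. A \<in> bounded_borel \<Longrightarrow> p A = p (A \<inter> C)"
    using 1 by (auto simp: lebesgue_decomposition_def pure_point_def)
  obtain C' where C': "countable C'" "\<And>A. A \<in> bounded_borel \<Longrightarrow> p' A = p' (A \<inter> C')"
    using 2 by (auto simp: lebesgue_decomposition_def pure_point_def)
  obtain N where N: "N \<in> sets borel" "emeasure lborel N = 0" "\<And>A. A \<in> bounded_borel \<Longrightarrow> s A = s (A \<inter> N)"
    using 1 by (auto simp: lebesgue_decomposition_def sing_continuous_def)
  obtain N' where N': "N' \<in> sets borel" "emeasure lborel N' = 0" "\<And>A. A \<in> bounded_borel \<Longrightarrow> s' A = s' (A \<inter> N')"
    using 2 by (auto simp: lebesgue_decomposition_def sing_continuous_def)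
  have rad: "p \<in> radon" "a \<in> radon" "s \<in> radon" "p' \<in> radon" "a' \<in> radon" "s' \<in> radon"
    using 1 2 by (auto simp: lebesgue_decomposition_def)
  have eq: "p A + a A + s A = p' A + a' A + s' A" for A
    using 1 2 unfolding lebesgue_decomposition_def by metis
  have ac: "a A = 0" "a' A = 0" if "A \<in> bounded_borel" "emeasure lborel A = 0" for A
    using 1 2 that by (auto simp: lebesgue_decomposition_def abs_continuous_def)
  have pt: "s {x} = 0" "s' {x} = 0" for x
    using 1 2 by (auto simp: lebesgue_decomposition_def sing_continuous_def)
  have null: "emeasure lborel (A \<inter> K) = 0" if "K \<in> sets borel" "emeasure lborel K = 0" "A \<in> sets borel" for A K :: "(real^'n) set"
    using that emeasure_mono[of "A \<inter> K" K lborel] by simp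
  let ?D = "C \<union> C'" and ?K = "N \<union> N'"
  have D: "countable ?D" using C C' by simp
  note Db = countable_lborel_null[OF D]
  have K: "?K \<in> sets borel" "emeasure lborel ?K = 0"
    using N N' null_sets.Un[of N lborel N'] by (auto simp: null_sets_def)
  have on: "p A = p' A \<and> s A = s' A" if A: "A \<in> bounded_borel" for A
  proof -
    have AD: "A \<inter> ?D \<in> bounded_borel" and AK: "A \<inter> ?K \<in> bounded_borel"
      using A Db(1) K(1) by blast+
    have "p A = p (A \<inter> ?D)" using C(2)[OF A] C(2)[OF AD] by (simp add: Int_assoc Int_absorb1)
    moreover have "p' A = p' (A \<inter> ?D)" using C'(2)[OF A] C'(2)[OF AD] by (simp add: Int_assoc Int_absorb1)
    moreover have "p (A \<inter> ?D) = p' (A \<inter> ?D)"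
      using eq[of "A \<inter> ?D"] ac[OF AD null[OF Db bounded_borelD[OF A]]]
        radon_countable_null[OF rad(3) pt(1) D A] radon_countable_null[OF rad(6) pt(2) D A] by simp
    ultimately have pp: "p A = p' A" by simp
    have "p (A \<inter> ?K) = p' (A \<inter> ?K)"
    proof -
      have AKD: "(A \<inter> ?K) \<inter> ?D \<in> bounded_borel" using AK Db(1) by blast
      have "p (A \<inter> ?K) = p ((A \<inter> ?K) \<inter> ?D)" using C(2)[OF AK] C(2)[OF AKD] by (simp add: Int_assoc Int_absorb1)
      moreover have "p' (A \<inter> ?K) = p' ((A \<inter> ?K) \<inter> ?D)" using C'(2)[OF AK] C'(2)[OF AKD] by (simp add: Int_assoc Int_absorb1)
      moreover have "p ((A \<inter> ?K) \<inter> ?D) = p' ((A \<inter> ?K) \<inter> ?D)"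
        using eq[of "(A \<inter> ?K) \<inter> ?D"] ac[OF AKD null[OF Db bounded_borelD[OF AK]]]
          radon_countable_null[OF rad(3) pt(1) D AK] radon_countable_null[OF rad(6) pt(2) D AK] by simp
      ultimately show ?thesis by simp
    qed
    then have "s (A \<inter> ?K) = s' (A \<inter> ?K)"
      using eq[of "A \<inter> ?K"] ac[OF AK null[OF K bounded_borelD[OF A]]] by simp
    moreover have "s A = s (A \<inter> ?K)" using N(3)[OF A] N(3)[OF AK] by (simp add: Int_assoc Int_absorb1)
    moreover have "s' A = s' (A \<inter> ?K)" using N'(3)[OF A] N'(3)[OF AK] by (simp add: Int_assoc Int_absorb1)
    ultimately show ?thesis using pp by simp
  qed
  have all: "p A = p' A \<and> s A = s' A" for A
    using on[of A] rad by (cases "A \<in> bounded_borel") (auto simp: radon_def)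
  moreover have "a A = a' A" for A using all[of A] eq[of A] by simp
  ultimately show ?thesis by auto
qed

lemma parts_eq:
  assumes "lebesgue_decomposition \<mu> p a s"
  shows "pp_part \<mu> = p" "ac_part \<mu> = a" "sc_part \<mu> = s"
  using assms lebesgue_decomposition_unique[OF assms] unfolding pp_part_def ac_part_def sc_part_def
  by (blast intro!: the_equality)+

text \<open>The space is cut into the atoms of \<open>m\<close>, the rest of a maximal Lebesgue null set \<open>N\<close>, and the
  complement of both, which by maximality contains no Lebesgue null set of positive mass.\<close>
lemma (in bounded_density) lebesgue_decomposition_restrict:
  obtains N where "N \<in> sets borel"
    "lebesgue_decomposition (density_charge m u) (density_charge m (\<lambda>x. indicator atoms x * u x))
      (density_charge m (\<lambda>x. indicator (- (N \<union> atoms)) x * u x)) (density_charge m (\<lambda>x. indicator (N - atoms) x * u x))"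
proof -
  obtain N where N [measurable]: "N \<in> sets borel" and N0: "emeasure lborel N = 0"
    and max: "\<And>A. A \<in> sets borel \<Longrightarrow> emeasure lborel A = 0 \<Longrightarrow> A \<inter> N = {} \<Longrightarrow> emeasure m A = 0"
    using exists_maximal_null_set by blast
  let ?\<mu> = "\<lambda>E. density_charge m (\<lambda>x. indicator E x * u x)"
  have Em [measurable]: "- (N \<union> atoms) \<in> sets borel" "N - atoms \<in> sets borel" by measurable
  have rad: "?\<mu> E \<in> radon" if "E \<in> sets borel" for E
  proof -
    interpret r: bounded_density m "\<lambda>x. indicator E x * u x" U by (rule restrict(1)[OF that])
    show ?thesis by (rule r.density_charge_radon)
  qed
  have null: "density_charge m v A = 0" if "A \<in> sets borel" "emeasure m A = 0" for v A
  proof (cases "A \<in> bounded_borel")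
    case True
    have "AE x in m. x \<notin> A" using that by (subst AE_iff_measurable[of A]) auto
    then have "(LINT x:A|m. v x) = 0"
      unfolding set_lebesgue_integral_def by (intro integral_eq_zero_AE) auto
    then show ?thesis by (simp add: density_charge_def)
  qed (simp add: density_charge_def)
  show thesis
  proof (rule that[OF N])
    show "lebesgue_decomposition (density_charge m u) (?\<mu> atoms) (?\<mu> (- (N \<union> atoms))) (?\<mu> (N - atoms))"
      unfolding lebesgue_decomposition_def
    proof (intro conjI rad borel_atoms Em)
      show "pure_point (?\<mu> atoms)"
        unfolding pure_point_def using countable_atoms
        by (intro exI[of _ atoms]) (auto simp: restrict(2) bounded_borel_Int Int_assoc)
      show "abs_continuous (?\<mu> (- (N \<union> atoms)))"
        unfolding abs_continuous_def
      proof (intro ballI impI)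
        fix A :: "(real^'n) set" assume A: "A \<in> bounded_borel" "emeasure lborel A = 0"
        note [measurable] = bounded_borelD[OF A(1)]
        have "emeasure m (A \<inter> (- (N \<union> atoms))) = 0"
        proof (rule max)
          show "emeasure lborel (A \<inter> (- (N \<union> atoms))) = 0"
            using emeasure_mono[of "A \<inter> (- (N \<union> atoms))" A lborel] A(2) by simp
        qed auto
        then show "?\<mu> (- (N \<union> atoms)) A = 0"
          unfolding restrict(2)[OF Em(1) A(1)] by (intro null) auto
      qed
      show "sing_continuous (?\<mu> (N - atoms))"
        unfolding sing_continuous_def
      proof (intro conjI allI)
        fix x :: "real^'n"
        have x: "{x} \<in> bounded_borel" by (simp add: bounded_borel_def)
        have "emeasure m ({x} \<inter> (N - atoms)) = 0"
        proof (cases "x \<in> atoms")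
          case False
          then have "emeasure m {x} = 0" by (simp add: atoms_def)
          then show ?thesis using emeasure_mono[of "{x} \<inter> (N - atoms)" "{x}" m] by simp
        qed auto
        then show "?\<mu> (N - atoms) {x} = 0"
          unfolding restrict(2)[OF Em(2) x] by (intro null) auto
        show "\<exists>K\<in>sets borel. emeasure lborel K = 0 \<and> (\<forall>A\<in>bounded_borel. ?\<mu> (N - atoms) A = ?\<mu> (N - atoms) (A \<inter> K))"
          using N0 N by (intro bexI[of _ N]) (auto simp: restrict(2) bounded_borel_Int Int_assoc Int_absorb1 intro!: arg_cong[where f="density_charge m u"])
      qed
      show "density_charge m u = (\<lambda>A. ?\<mu> atoms A + ?\<mu> (- (N \<union> atoms)) A + ?\<mu> (N - atoms) A)"
      proof
        fix A
        show "density_charge m u A = ?\<mu> atoms A + ?\<mu> (- (N \<union> atoms)) A + ?\<mu> (N - atoms) A"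
        proof (cases "A \<in> bounded_borel")
          case True
          have I: "integrable m (\<lambda>x. indicator A x *\<^sub>R (indicator E x * u x))" if "E \<in> sets borel" for E
          proof -
            interpret r: bounded_density m "\<lambda>x. indicator E x * u x" U by (rule restrict(1)[OF that])
            show ?thesis using r.locally_integrable[OF True] by (simp add: set_integrable_def)
          qed
          have "density_charge m u A = (LINT x|m. indicator A x *\<^sub>R (indicator atoms x * u x)
              + indicator A x *\<^sub>R (indicator (- (N \<union> atoms)) x * u x) + indicator A x *\<^sub>R (indicator (N - atoms) x * u x))"
            unfolding density_charge_def set_lebesgue_integral_def using True
            by (auto intro!: Bochner_Integration.integral_cong split: split_indicator)
          also have "\<dots> = ?\<mu> atoms A + ?\<mu> (- (N \<union> atoms)) A + ?\<mu> (N - atoms) A"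
            unfolding density_charge_def set_lebesgue_integral_def using True
            by (simp only: if_True Bochner_Integration.integral_add Bochner_Integration.integrable_add I borel_atoms Em)
          finally show ?thesis .
        qed (simp add: density_charge_def)
      qed
    qed
  qed
qed

section \<open>Tempered distributions with a translation bounded Fourier transform\<close>

lemma schwartz_diff: "f \<in> schwartz \<Longrightarrow> g \<in> schwartz \<Longrightarrow> (\<lambda>x. f x - g x) \<in> schwartz"
  using schwartz_add[of f "\<lambda>x. (-1) * g x"] schwartz_cmult[of g "-1"] by simp

lemma schwartz_seminorm_0 [simp]: "schwartz_seminorm k js (\<lambda>x. 0) = 0"
proof -
  have "pderivatives js (\<lambda>x. 0) = (\<lambda>x. 0 :: complex)"
  proof (induction js)
    case (Cons i js)
    then show ?case using pderivative_eq[OF has_derivative_const[of 0], of i] by auto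
  qed simp
  then show ?thesis by (simp add: schwartz_seminorm_def)
qed

lemma topspace_schwartz_topology: "topspace schwartz_topology = schwartz"
  unfolding schwartz_topology_def topology_generated_by_topspace
proof (intro equalityI subsetI)
  fix f :: "'n::finite cfun" assume f: "f \<in> schwartz"
  then show "f \<in> \<Union>{{g \<in> schwartz. schwartz_seminorm k js (\<lambda>x. g x - f x) < e} | f k js e. f \<in> schwartz \<and> 0 < e}"
    by (intro UnionI[of "{g \<in> schwartz. schwartz_seminorm 0 [] (\<lambda>x. g x - f x) < 1}"])
      (blast intro: zero_less_one, simp)
qed auto

text \<open>A subbasic set of \<open>schwartz_topology\<close> restricts a single seminorm of the distance to a point; the
  finitely many seminorms in \<open>P\<close> give finitely many such sets around \<open>f\<close>, on whose intersection
  \<open>\<omega>\<close> differs from \<open>\<omega> f\<close> by less than \<open>e\<close>.\<close>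
lemma continuous_map_schwartz:
  fixes \<omega> :: "'n::finite distr"
  assumes add: "\<And>f g. f \<in> schwartz \<Longrightarrow> g \<in> schwartz \<Longrightarrow> \<omega> (\<lambda>x. f x + g x) = \<omega> f + \<omega> g"
    and P: "finite P" and bound: "\<And>f. f \<in> schwartz \<Longrightarrow> cmod (\<omega> f) \<le> C * (\<Sum>(k, js)\<in>P. schwartz_seminorm k js f)"
    and C: "0 \<le> C"
  shows "continuous_map schwartz_topology euclidean \<omega>"
  unfolding continuous_map_def
proof (intro conjI allI impI)
  fix U :: "complex set" assume U: "openin euclidean U"
  show "openin schwartz_topology {f \<in> topspace schwartz_topology. \<omega> f \<in> U}"
  proof (subst openin_subopen, intro ballI)
    fix f assume "f \<in> {f \<in> topspace schwartz_topology. \<omega> f \<in> U}"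
    then have f: "f \<in> schwartz" "\<omega> f \<in> U" by (auto simp: topspace_schwartz_topology)
    obtain e where e: "0 < e" "ball (\<omega> f) e \<subseteq> U" using U f(2) by (auto simp: open_contains_ball)
    define d where "d = e / (C * card P + 1)"
    have d: "0 < d" "C * card P * d < e"
    proof -
      have pos: "0 < C * card P + 1" using C by (simp add: add_nonneg_pos)
      then show "0 < d" using e by (simp add: d_def)
      have "C * card P * e < e * (C * card P + 1)" using e by (simp add: algebra_simps)
      then show "C * card P * d < e" unfolding d_def using pos by (simp add: pos_divide_less_eq)
    qed
    let ?V = "\<lambda>p. {g \<in> schwartz. schwartz_seminorm (fst p) (snd p) (\<lambda>x. g x - f x) < d}"
    let ?T = "(\<Inter>p\<in>P. ?V p) \<inter> topspace schwartz_topology"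
    have "openin schwartz_topology (?V p)" for p
      unfolding schwartz_topology_def by (rule topology_generated_by_Basis) (use f d in blast)
    then have "openin schwartz_topology ?T" by (intro openin_INT P)
    moreover have "f \<in> ?T" using f d by (simp add: topspace_schwartz_topology)
    moreover have "?T \<subseteq> {f \<in> topspace schwartz_topology. \<omega> f \<in> U}"
    proof
      fix g assume g: "g \<in> ?T"
      then have gs: "g \<in> schwartz" by (simp add: topspace_schwartz_topology)
      have df: "(\<lambda>x. g x - f x) \<in> schwartz" by (rule schwartz_diff[OF gs f(1)])
      have "\<omega> g = \<omega> (\<lambda>x. g x - f x) + \<omega> f" using add[OF df f(1)] by simp
      then have "dist (\<omega> f) (\<omega> g) = cmod (\<omega> (\<lambda>x. g x - f x))" by (simp add: dist_norm norm_minus_commute)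
      also have "\<dots> \<le> C * (\<Sum>(k, js)\<in>P. schwartz_seminorm k js (\<lambda>x. g x - f x))" by (rule bound[OF df])
      also have "\<dots> \<le> C * (\<Sum>p\<in>P. d)"
        using g C by (intro mult_left_mono sum_mono) (auto simp: case_prod_beta less_imp_le)
      also have "\<dots> < e" using d(2) by (simp add: mult.assoc)
      finally show "g \<in> {f \<in> topspace schwartz_topology. \<omega> f \<in> U}"
        using e gs by (auto simp: topspace_schwartz_topology)
    qed
    ultimately show "\<exists>T. openin schwartz_topology T \<and> f \<in> T \<and> T \<subseteq> {f \<in> topspace schwartz_topology. \<omega> f \<in> U}" by blast
  qed
qed auto

lemma funpow_pderivative_schwartz: "f \<in> schwartz \<Longrightarrow> (pderivative i ^^ n) f \<in> schwartz"
  by (induction n) (auto intro: schwartz_pderivative)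

lemma funpow_pderivative_eq: "(pderivative i ^^ n) f = pderivatives (replicate n i) f"
  by (induction n) auto

lemma weight_norm_pderivatives:
  fixes f :: "'n::finite cfun"
  shows "weight_norm (pderivatives js f) = 2 ^ CARD('n) * (schwartz_seminorm 0 js f + schwartz_seminorm (2 * CARD('n)) js f)"
  by (simp add: weight_norm_def schwartz_seminorm_def)

lemma fourier_funpow_pderivative:
  "f \<in> schwartz \<Longrightarrow> fourier ((pderivative i ^^ n) f) x = (2 * pi * \<i> * x $ i) ^ n * fourier f x"
  by (induction n) (simp_all add: fourier_pderivative funpow_pderivative_schwartz)

lemma inv_fourier_pderivative_2d:
  fixes f :: "'n::finite cfun"
  assumes "f \<in> schwartz"
  shows "inv_fourier ((pderivative i ^^ (2 * CARD('n))) f) k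
    = (- 1) ^ CARD('n) * of_real ((2 * pi * k $ i) ^ (2 * CARD('n))) * inv_fourier f k"
proof -
  have "(2 * pi * \<i> * (- k) $ i) ^ (2 * CARD('n)) = ((2 * pi * \<i> * (- k) $ i)\<^sup>2) ^ CARD('n)"
    by (simp only: power_mult)
  also have "(2 * pi * \<i> * (- k) $ i)\<^sup>2 = (-1) * of_real ((2 * pi * k $ i)\<^sup>2)"
    by (simp add: power_mult_distrib)
  also have "\<dots> ^ CARD('n) = (-1) ^ CARD('n) * of_real ((2 * pi * k $ i) ^ (2 * CARD('n)))"
    by (subst power_mult_distrib) (simp only: of_real_power power_mult)
  finally show ?thesis
    unfolding inv_fourier_def fourier_funpow_pderivative[OF assms] by simp
qed

text \<open>The symbol of \<open>Psi\<close>. Divided by \<open>Psi_symbol k\<close>, the identity bounds \<open>inv_fourier f\<close> by \<open>weight\<close>;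
  integrated against a measure, it gives the representation of a distribution by \<open>Psi\<close>.\<close>
lemma inv_fourier_Psi:
  fixes f :: "'n::finite cfun"
  assumes "f \<in> schwartz"
  shows "(\<Sum>i\<in>UNIV. inv_fourier ((pderivative i ^^ (2 * CARD('n))) f) k) + (- 1) ^ CARD('n) * inv_fourier f k
    = (- 1) ^ CARD('n) * of_real (Psi_symbol k) * inv_fourier f k"
  unfolding inv_fourier_pderivative_2d[OF assms] Psi_symbol_def
  by (simp add: distrib_left distrib_right sum_distrib_left sum_distrib_right add.commute)

lemma cmod_inv_fourier_le: "f \<in> schwartz \<Longrightarrow> cmod (inv_fourier f x) \<le> (LINT y|lborel. cmod (f y))"
  unfolding inv_fourier_def by (rule cmod_fourier_le)

text \<open>The constant is chosen to expand into finitely many Schwartz seminorms, as the continuity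
  of \<open>inv_distr\<close> requires.\<close>
definition fourier_decay_norm :: "'n::finite cfun \<Rightarrow> real" where
  "fourier_decay_norm f = 2 ^ CARD('n) * (LINT x|lborel. weight (x::real^'n)) *
     (weight_norm f + (\<Sum>i\<in>UNIV. weight_norm (pderivatives (replicate (2 * CARD('n)) i) f)))"

lemma inv_fourier_le_weight:
  fixes f :: "'n::finite cfun"
  assumes f: "f \<in> schwartz"
  shows "cmod (inv_fourier f k) \<le> fourier_decay_norm f * weight k"
proof -
  let ?W = "LINT x|lborel. weight (x::real^'n)" and ?D = "\<lambda>i. pderivatives (replicate (2 * CARD('n)) i) f"
  have le: "cmod (inv_fourier g k) \<le> ?W * weight_norm g" if "g \<in> schwartz" for g
    using cmod_inv_fourier_le[OF that] integral_schwartz_le[OF that] by (rule order_trans)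
  have "Psi_symbol k * cmod (inv_fourier f k) = cmod ((- 1) ^ CARD('n) * of_real (Psi_symbol k) * inv_fourier f k)"
    using Psi_symbol_ge_1[of k] by (simp add: norm_mult norm_power)
  also have "\<dots> \<le> (\<Sum>i\<in>UNIV. cmod (inv_fourier (?D i) k)) + cmod (inv_fourier f k)"
    unfolding inv_fourier_Psi[OF f, symmetric] funpow_pderivative_eq
    by (rule order_trans[OF norm_triangle_ineq]) (intro add_mono norm_sum, simp add: norm_mult norm_power)
  also have "\<dots> \<le> (\<Sum>i\<in>UNIV. ?W * weight_norm (?D i)) + ?W * weight_norm f"
    by (intro add_mono sum_mono le schwartz_pderivatives f)
  also have "\<dots> = ?W * (weight_norm f + (\<Sum>i\<in>UNIV. weight_norm (?D i)))"
    by (simp add: distrib_left sum_distrib_left)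
  finally have 1: "Psi_symbol k * cmod (inv_fourier f k) \<le> ?W * (weight_norm f + (\<Sum>i\<in>UNIV. weight_norm (?D i)))" .
  have "inverse (weight k) * cmod (inv_fourier f k) \<le> 2 ^ CARD('n) * Psi_symbol k * cmod (inv_fourier f k)"
    by (intro mult_right_mono inverse_weight_le_Psi_symbol) simp
  also have "\<dots> \<le> fourier_decay_norm f"
    unfolding fourier_decay_norm_def mult.assoc by (intro mult_left_mono 1[unfolded mult.assoc]) simp
  finally show ?thesis using weight_pos[of k] by (simp add: field_simps)
qed

context bounded_density begin

lemma integrable_weight_bound:
  assumes [measurable]: "g \<in> borel_measurable borel" and g: "\<And>k. cmod (g k) \<le> C * weight k"
  shows "integrable m (\<lambda>k. g k * u k)"
proof (rule Bochner_Integration.integrable_bound)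
  show "integrable m (\<lambda>k. C * U * weight k)" using integrable_weight_m by simp
  show "AE k in m. norm (g k * u k) \<le> norm (C * U * weight k)"
  proof (rule AE_I2)
    fix k
    have "cmod (g k) * cmod (u k) \<le> (C * weight k) * U"
      by (intro mult_mono g u_bound order_trans[OF norm_ge_zero g]) simp
    also have "\<dots> \<le> norm (C * U * weight k)" using abs_ge_self[of "C * U * weight k"] by (simp add: mult_ac)
    finally show "norm (g k * u k) \<le> norm (C * U * weight k)" by (simp add: norm_mult)
  qed
qed measurable

lemma integrable_schwartz_density: "f \<in> schwartz \<Longrightarrow> integrable m (\<lambda>k. f k * u k)"
  by (rule integrable_weight_bound[OF measurable_schwartz schwartz_le_weight])

text \<open>The distribution whose Fourier transform is \<open>density_charge m u\<close>.\<close>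
definition inv_distr :: "'n distr" where
  "inv_distr f = (if f \<in> schwartz then (LINT k|m. inv_fourier f k * u k) else 0)"

lemma inv_distr_tempered: "inv_distr \<in> tempered"
proof -
  note S = integrable_schwartz_density[OF inv_fourier_schwartz]
  have add: "inv_distr (\<lambda>x. f x + g x) = inv_distr f + inv_distr g" if "f \<in> schwartz" "g \<in> schwartz" for f g
    using that S by (simp add: inv_distr_def schwartz_add inv_fourier_def fourier_add distrib_right)
  have mult: "inv_distr (\<lambda>x. c * f x) = c * inv_distr f" if "f \<in> schwartz" for f c
    using that by (simp add: inv_distr_def schwartz_cmult inv_fourier_def fourier_cmult mult.assoc)
  let ?d = "CARD('n)"
  let ?W = "LINT x|lborel. weight (x::real^'n)" and ?V = "LINT x|m. weight x"
  define J where "J = insert [] (range (\<lambda>i::'n. replicate (2 * ?d) i))"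
  define C where "C = 2 ^ ?d * ?W * (2 ^ ?d) * U * ?V"
  have W: "0 \<le> ?W" "0 \<le> ?V" by (auto intro!: Bochner_Integration.integral_nonneg less_imp_le[OF weight_pos])
  have C: "0 \<le> C" unfolding C_def using W U_nonneg by simp
  have bound: "cmod (inv_distr f) \<le> C * (\<Sum>(k, js)\<in>{0, 2 * ?d} \<times> J. schwartz_seminorm k js f)" if f: "f \<in> schwartz" for f
  proof -
    have d: "2 * ?d \<noteq> 0" by simp
    have inj: "inj (\<lambda>i::'n. replicate (2 * ?d) i)"
    proof (rule injI)
      fix i j :: 'n assume "replicate (2 * ?d) i = replicate (2 * ?d) j"
      then show "i = j" using d by (metis replicate_eq_replicate)
    qed
    have notin: "[] \<notin> range (\<lambda>i::'n. replicate (2 * ?d) i)" by auto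
    have "weight_norm f + (\<Sum>i\<in>UNIV. weight_norm (pderivatives (replicate (2 * ?d) i) f)) = (\<Sum>js\<in>J. weight_norm (pderivatives js f))"
      unfolding J_def by (subst sum.insert) (use notin in \<open>simp_all add: sum.reindex[OF inj]\<close>)
    also have "\<dots> = 2 ^ ?d * (\<Sum>js\<in>J. \<Sum>k\<in>{0, 2 * ?d}. schwartz_seminorm k js f)"
      unfolding weight_norm_pderivatives by (simp add: sum_distrib_left)
    also have "(\<Sum>js\<in>J. \<Sum>k\<in>{0, 2 * ?d}. schwartz_seminorm k js f) = (\<Sum>(k, js)\<in>{0, 2 * ?d} \<times> J. schwartz_seminorm k js f)"
      by (subst sum.swap) (rule sum.cartesian_product)
    finally have dn: "fourier_decay_norm f = 2 ^ ?d * ?W * (2 ^ ?d * (\<Sum>(k, js)\<in>{0, 2 * ?d} \<times> J. schwartz_seminorm k js f))"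
      unfolding fourier_decay_norm_def by simp
    have "cmod (inv_distr f) \<le> (LINT k|m. (fourier_decay_norm f * weight k) * U)"
      unfolding inv_distr_def if_P[OF f]
    proof (rule Bochner_Integration.integral_norm_bound_integral)
      fix k :: "real^'n"
      have "0 \<le> fourier_decay_norm f * weight k" by (rule order_trans[OF norm_ge_zero inv_fourier_le_weight[OF f]])
      then show "norm (inv_fourier f k * u k) \<le> fourier_decay_norm f * weight k * U"
        unfolding norm_mult by (intro mult_mono inv_fourier_le_weight f u_bound) auto
    qed (use S[OF f] integrable_weight_m in auto)
    also have "\<dots> = C * (\<Sum>(k, js)\<in>{0, 2 * ?d} \<times> J. schwartz_seminorm k js f)"
      unfolding dn C_def by (simp add: mult_ac)
    finally show ?thesis .
  qed
  have "finite ({0, 2 * ?d} \<times> J)" by (simp add: J_def)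
  from continuous_map_schwartz[OF add this bound C]
  have cont: "continuous_map schwartz_topology euclidean inv_distr" .
  show ?thesis
    unfolding tempered_def mem_Collect_eq
    by (intro conjI ballI allI impI add mult cont) (simp_all only: inv_distr_def if_False)
qed

lemma distr_fourier_inv_distr: "distr_fourier inv_distr = distr_of_cmeas (density_charge m u)"
proof
  fix f show "distr_fourier inv_distr f = distr_of_cmeas (density_charge m u) f"
    by (auto simp: distr_fourier_def distr_of_cmeas_def inv_distr_def fourier_schwartz inv_fourier_fourier
      cmeas_integral_density_charge measurable_schwartz integrable_schwartz_density)
qed

lemma inv_distr_DTBM: "inv_distr \<in> DTBM"
  unfolding DTBM_def using inv_distr_tempered distr_fourier_inv_distr density_charge_translation_bounded by auto

end

text \<open>By inversion every Schwartz function is the Fourier transform of a Schwartz function.\<close>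
lemma distr_fourier_inject:
  assumes "\<omega> \<in> tempered" "\<omega>' \<in> tempered" "distr_fourier \<omega> = distr_fourier \<omega>'"
  shows "\<omega> = \<omega>'"
proof
  fix f show "\<omega> f = \<omega>' f"
  proof (cases "f \<in> schwartz")
    case True
    then have i: "inv_fourier f \<in> schwartz" by (rule inv_fourier_schwartz)
    have "distr_fourier \<omega> (inv_fourier f) = distr_fourier \<omega>' (inv_fourier f)" using assms(3) by simp
    then show ?thesis using i True by (simp add: distr_fourier_def fourier_inv_fourier)
  next
    case False then show ?thesis using assms by (simp add: tempered_def)
  qed
qed

text \<open>The inverse transform of \<open>\<lambda>y. f (x - y)\<close> at \<open>k\<close> is \<open>ee (k \<bullet> x) * fourier f k\<close>. So smoothing by \<open>f\<close>
  turns \<open>inv_distr\<close> into a superposition of characters, to which the theory of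
  Fourier--Stieltjes transforms of finite measures applies.\<close>
lemma (in bounded_density) distr_conv_inv_distr:
  assumes f: "f \<in> schwartz"
  shows "distr_conv f inv_distr x = (LINT k|m. ee (k \<bullet> x) * fourier f k * u k)"
proof -
  have "inv_fourier (\<lambda>y. f (x - y)) k = ee (k \<bullet> x) * fourier f k" for k
  proof -
    have [measurable]: "(\<lambda>y. f (x - y)) \<in> borel_measurable borel" by (rule measurable_schwartz[OF schwartz_reflect[OF f]])
    have "inv_fourier (\<lambda>y. f (x - y)) k = (LINT y|lborel. ee (k \<bullet> (x + (-1) *\<^sub>R y)) * f (x - (x + (-1) *\<^sub>R y)))"
      unfolding inv_fourier_eq
      using integral_lborel_affine[of "\<lambda>y. ee (k \<bullet> y) * f (x - y)" "-1" x] by simp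
    also have "\<dots> = (LINT y|lborel. ee (k \<bullet> x) * (ee (- (k \<bullet> y)) * f y))"
      by (intro Bochner_Integration.integral_cong) (auto simp: inner_diff_right ee_diff)
    finally show ?thesis by (simp add: fourier_eq)
  qed
  then show ?thesis by (simp add: distr_conv_def inv_distr_def schwartz_reflect[OF f])
qed

section \<open>The representation by the differential operator\<close>

lemma funpow_distr_pderivative:
  "f \<in> schwartz \<Longrightarrow> (distr_pderivative i ^^ n) \<omega> f = (- 1) ^ n * \<omega> ((pderivative i ^^ n) f)"
proof (induction n arbitrary: f)
  case (Suc n)
  have "(distr_pderivative i ^^ Suc n) \<omega> f = - (distr_pderivative i ^^ n) \<omega> (pderivative i f)"
    using Suc.prems unfolding funpow.simps o_apply by (subst distr_pderivative_def) simp
  also have "\<dots> = (- 1) ^ Suc n * \<omega> ((pderivative i ^^ n) (pderivative i f))"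
    using Suc.IH[OF schwartz_pderivative[OF Suc.prems]] by simp
  finally show ?case by (simp only: funpow_Suc_right o_apply)
qed simp

lemma Psi_schwartz:
  fixes \<omega> :: "'n::finite distr"
  assumes "f \<in> schwartz"
  shows "Psi \<omega> f = (\<Sum>i\<in>UNIV. \<omega> ((pderivative i ^^ (2 * CARD('n))) f)) + (- 1) ^ CARD('n) * \<omega> f"
  unfolding Psi_def funpow_distr_pderivative[OF assms] by simp

lemma Psi_not_schwartz:
  fixes \<omega> :: "'n::finite distr"
  assumes "f \<notin> schwartz" "\<omega> f = 0"
  shows "Psi \<omega> f = 0"
proof -
  obtain k where "2 * CARD('n) = Suc k" using not0_implies_Suc[of "2 * CARD('n)"] by auto
  then have "(distr_pderivative i ^^ (2 * CARD('n))) \<omega> f = 0" for i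
    using assms by (simp add: distr_pderivative_def)
  then show ?thesis using assms by (simp add: Psi_def)
qed

lemma radon_measure_lborel: "radon_measure (lborel :: (real^'n::finite) measure)"
proof
  show "emeasure lborel A < \<infinity>" if "A \<in> bounded_borel" for A :: "(real^'n) set"
    by (rule emeasure_bounded_finite) (use that in \<open>simp add: bounded_borel_def\<close>)
qed simp

text \<open>The functions of \<open>fourier_stieltjes\<close> have a negative sign in the exponent, hence the reflection of
  \<open>m\<close> and \<open>q\<close>.\<close>
lemma (in radon_measure) transform_fourier_stieltjes:
  assumes [measurable]: "q \<in> borel_measurable borel" and qi: "integrable m q"
  shows "(\<lambda>x. LINT k|m. ee (x \<bullet> k) * q k) \<in> fourier_stieltjes"
proof -
  let ?m = "distr m borel uminus" and ?q = "\<lambda>y. q (- y)"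
  have un: "uminus \<in> borel_measurable (borel :: (real^'n) measure)" by measurable
  have iq: "integrable ?m ?q" by (subst integrable_distr_eq) (auto simp: qi)
  interpret r: radon_density ?m ?q
  proof
    show "emeasure ?m A < \<infinity>" if "A \<in> bounded_borel" for A :: "(real^'n) set"
    proof -
      have [measurable]: "A \<in> sets borel" using that by (rule bounded_borelD)
      have "uminus -` A = uminus ` A" by (auto intro: image_eqI[of _ uminus, OF minus_minus[symmetric]])
      moreover have "bounded (uminus ` A)" using that by (auto simp: bounded_borel_def bounded_uminus)
      moreover have "uminus -` A \<in> sets borel" using measurable_sets[OF un, of A] by simp
      ultimately have "uminus -` A \<in> bounded_borel" by (simp add: bounded_borel_def)
      from finite_bounded[OF this] show ?thesis by (subst emeasure_distr) auto
    qed
    show "set_integrable ?m A ?q" if "A \<in> bounded_borel" for A :: "(real^'n) set"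
      unfolding set_integrable_def using bounded_borelD[OF that] by (intro integrable_mult_indicator iq) simp
  qed auto
  have "total_variation (density_charge ?m ?q) UNIV \<le> (\<integral>\<^sup>+x\<in>UNIV. cmod (?q x) \<partial>?m)"
    by (rule r.total_variation_density_charge) simp
  also have "\<dots> < \<infinity>" using iq by (simp add: integrable_iff_bounded)
  finally have "density_charge ?m ?q \<in> finite_radon"
    by (simp add: finite_radon_def r.density_charge_radon)
  moreover have "(\<lambda>x. LINT k|m. ee (x \<bullet> k) * q k)
    = (\<lambda>x. cmeas_integral (density_charge ?m ?q) (\<lambda>y. exp (- 2 * complex_of_real pi * \<i> * complex_of_real (x \<bullet> y))))"
  proof
    fix x
    have "integrable ?m (\<lambda>y. ee (- (x \<bullet> y)) * ?q y)"
      by (rule Bochner_Integration.integrable_bound[OF iq]) (auto simp: norm_mult)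
    then have "cmeas_integral (density_charge ?m ?q) (\<lambda>y. ee (- (x \<bullet> y))) = (LINT y|?m. ee (- (x \<bullet> y)) * ?q y)"
      by (intro r.cmeas_integral_density_charge) auto
    also have "\<dots> = (LINT k|m. ee (x \<bullet> k) * q k)" by (subst integral_distr) auto
    finally show "(LINT k|m. ee (x \<bullet> k) * q k)
      = cmeas_integral (density_charge ?m ?q) (\<lambda>y. exp (- 2 * complex_of_real pi * \<i> * complex_of_real (x \<bullet> y)))"
      unfolding exp_eq_ee by simp
  qed
  ultimately show ?thesis unfolding fourier_stieltjes_def by blast
qed

text \<open>Fubini's theorem, with the product of \<open>cmod \<circ> g\<close> and \<open>cmod \<circ> q\<close> as dominating function.\<close>
lemma (in radon_measure) distr_of_transform:
  assumes qm [measurable]: "q \<in> borel_measurable borel" and qi: "integrable m q" and g: "g \<in> schwartz"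
  shows "distr_of_cmeas (density_cmeas (\<lambda>x. LINT k|m. ee (x \<bullet> k) * q k)) g = (LINT k|m. inv_fourier g k * q k)"
    and "integrable m (\<lambda>k. inv_fourier g k * q k)"
proof -
  interpret sigma_finite_measure m by (rule sigma_finite)
  interpret L: radon_measure "lborel :: (real^'n) measure" by (rule radon_measure_lborel)
  note [measurable] = measurable_schwartz[OF g]
  define h where "h x = (LINT k|m. ee (x \<bullet> k) * q k)" for x
  have hm [measurable]: "h \<in> borel_measurable borel"
  proof -
    have "(\<lambda>x. LINT k|m. ee (x \<bullet> k) * q k) \<in> borel_measurable (borel :: (real^'n) measure)"
      by (rule borel_measurable_lebesgue_integral) measurable
    then show ?thesis by (simp add: h_def[abs_def])
  qed
  have hb: "cmod (h x) \<le> (LINT k|m. cmod (q k))" for x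
    unfolding h_def by (rule order_trans[OF integral_norm_bound]) (simp add: norm_mult)
  have hint: "integrable lborel (\<lambda>x. f x * h x)" if "integrable lborel f" for f :: "'n cfun"
  proof (rule Bochner_Integration.integrable_bound)
    show "integrable lborel (\<lambda>x. cmod (f x) * (LINT k|m. cmod (q k)))" using that by simp
    show "AE x in lborel. norm (f x * h x) \<le> norm (cmod (f x) * (LINT k|m. cmod (q k)))"
      using hb by (auto simp: norm_mult abs_mult intro!: AE_I2 mult_left_mono intro: order_trans abs_ge_self)
  qed (use that in auto)
  interpret H: radon_density "lborel :: (real^'n) measure" h
  proof
    show "set_integrable lborel A h" if A: "A \<in> bounded_borel" for A :: "(real^'n) set"
    proof -
      have "integrable lborel (\<lambda>x. complex_of_real (indicator A x) * h x)"
        using bounded_borelD[OF A] L.finite_bounded[OF A]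
        by (intro hint integrable_of_real integrable_real_indicator) auto
      then show ?thesis by (simp add: set_integrable_def scaleR_conv_of_real)
    qed
  qed (rule hm)
  have "distr_of_cmeas (density_cmeas h) g = (LINT x|lborel. g x * h x)"
    unfolding distr_of_cmeas_def density_cmeas_eq using g
    by (simp add: H.cmeas_integral_density_charge measurable_schwartz hint integrable_schwartz)
  also have "\<dots> = (LINT x|lborel. LINT k|m. g x * (ee (x \<bullet> k) * q k))" by (simp add: h_def)
  also have "\<dots> = (LINT k|m. LINT x|lborel. g x * (ee (x \<bullet> k) * q k))"
    by (rule Fubini_dominated[OF sigma_finite_lborel sigma_finite_measure_axioms _ integrable_norm[OF integrable_schwartz[OF g]] integrable_norm[OF qi]])
      (auto simp: norm_mult)
  also have "\<dots> = (LINT k|m. inv_fourier g k * q k)"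
  proof (rule Bochner_Integration.integral_cong[OF refl])
    fix k
    have "(LINT x|lborel. g x * (ee (x \<bullet> k) * q k)) = (LINT x|lborel. (ee (k \<bullet> x) * g x) * q k)"
      by (intro Bochner_Integration.integral_cong) (auto simp: inner_commute)
    then show "(LINT x|lborel. g x * (ee (x \<bullet> k) * q k)) = inv_fourier g k * q k" by (simp add: inv_fourier_eq)
  qed
  finally show "distr_of_cmeas (density_cmeas (\<lambda>x. LINT k|m. ee (x \<bullet> k) * q k)) g = (LINT k|m. inv_fourier g k * q k)"
    unfolding h_def[abs_def] .
  show "integrable m (\<lambda>k. inv_fourier g k * q k)"
  proof (rule Bochner_Integration.integrable_bound)
    show "integrable m (\<lambda>k. (LINT y|lborel. cmod (g y)) * cmod (q k))" using qi by simp
    show "AE k in m. norm (inv_fourier g k * q k) \<le> norm ((LINT y|lborel. cmod (g y)) * cmod (q k))"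
    proof (rule AE_I2)
      fix k
      have "cmod (inv_fourier g k) \<le> \<bar>LINT y|lborel. cmod (g y)\<bar>"
        using cmod_inv_fourier_le[OF g] abs_ge_self by (rule order_trans)
      then show "norm (inv_fourier g k * q k) \<le> norm ((LINT y|lborel. cmod (g y)) * cmod (q k))"
        by (simp add: norm_mult abs_mult mult_right_mono)
    qed
  qed (use measurable_schwartz[OF inv_fourier_schwartz[OF g]] in measurable)
qed

text \<open>Divide the density \<open>u\<close> by the symbol of \<open>Psi\<close>. The quotient is bounded by a multiple of \<open>weight\<close>, hence
  integrable, so its transform is a function of \<open>fourier_stieltjes\<close>; applying \<open>Psi\<close> multiplies the
  density by the symbol again.\<close>
lemma (in bounded_density) Psi_representation:
  "\<exists>h\<in>fourier_stieltjes. inv_distr = Psi (distr_of_cmeas (density_cmeas h))"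
proof -
  let ?d = "CARD('n)"
  \<comment> \<open>As \<open>(-1) ^ d\<close> is its own inverse, this divides \<open>u\<close> by \<open>(-1) ^ d * Psi_symbol k\<close>.\<close>
  define q where "q k = (- 1) ^ ?d * u k / of_real (Psi_symbol k)" for k
  have [measurable]: "Psi_symbol \<in> borel_measurable (borel :: (real^'n) measure)"
    unfolding Psi_symbol_def[abs_def] cart_eq_inner_axis by measurable
  have qm [measurable]: "q \<in> borel_measurable borel" unfolding q_def[abs_def] by measurable
  have qu: "q k * ((- 1) ^ ?d * of_real (Psi_symbol k)) = u k" for k
  proof -
    have "Psi_symbol k \<noteq> 0" using Psi_symbol_ge_1[of k] by auto
    then show ?thesis by (simp add: q_def power_mult_distrib[symmetric] mult_ac)
  qed
  have qb: "cmod (q k) \<le> U * 2 ^ ?d * weight k" for k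
  proof -
    have "cmod (q k) = cmod (u k) / Psi_symbol k"
      using Psi_symbol_ge_1[of k] by (simp add: q_def norm_divide norm_mult norm_power)
    also have "\<dots> \<le> U / Psi_symbol k" using u_bound Psi_symbol_ge_1[of k] by (intro divide_right_mono) auto
    also have "\<dots> \<le> U * (2 ^ ?d * weight k)"
      unfolding divide_inverse
    proof (intro mult_left_mono U_nonneg)
      show "inverse (Psi_symbol k) \<le> 2 ^ ?d * weight k"
        using inverse_weight_le_Psi_symbol[of k] weight_pos[of k] Psi_symbol_ge_1[of k] by (simp add: field_simps)
    qed
    finally show ?thesis by simp
  qed
  have qi: "integrable m q"
    by (rule Bochner_Integration.integrable_bound[of _ "\<lambda>k. U * 2 ^ ?d * weight k"])
      (use integrable_weight_m qb in \<open>auto intro!: AE_I2 intro: order_trans abs_ge_self\<close>)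
  let ?h = "\<lambda>x. LINT k|m. ee (x \<bullet> k) * q k"
  note D = distr_of_transform(1)[OF qm qi] and I = distr_of_transform(2)[OF qm qi]
  have eq: "inv_distr f = Psi (distr_of_cmeas (density_cmeas ?h)) f" for f
  proof (cases "f \<in> schwartz")
    case False
    then show ?thesis by (subst Psi_not_schwartz) (auto simp: inv_distr_def distr_of_cmeas_def)
  next
    case True
    note G = funpow_pderivative_schwartz[OF True]
    have "Psi (distr_of_cmeas (density_cmeas ?h)) f =
      (\<Sum>i\<in>UNIV. LINT k|m. inv_fourier ((pderivative i ^^ (2 * ?d)) f) k * q k) + (- 1) ^ ?d * (LINT k|m. inv_fourier f k * q k)"
      unfolding Psi_schwartz[OF True] D[OF G] D[OF True] ..
    also have "\<dots> = (LINT k|m. (\<Sum>i\<in>UNIV. inv_fourier ((pderivative i ^^ (2 * ?d)) f) k * q k) + (- 1) ^ ?d * (inv_fourier f k * q k))"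
      using I[OF G] I[OF True] by (simp add: Bochner_Integration.integral_sum)
    also have "\<dots> = (LINT k|m. inv_fourier f k * u k)"
    proof (rule Bochner_Integration.integral_cong[OF refl])
      fix k
      have "(\<Sum>i\<in>UNIV. inv_fourier ((pderivative i ^^ (2 * ?d)) f) k * q k) + (- 1) ^ ?d * (inv_fourier f k * q k)
        = ((\<Sum>i\<in>UNIV. inv_fourier ((pderivative i ^^ (2 * ?d)) f) k) + (- 1) ^ ?d * inv_fourier f k) * q k"
        by (simp add: distrib_right sum_distrib_right)
      also have "\<dots> = inv_fourier f k * u k"
        unfolding inv_fourier_Psi[OF True] using qu[of k] by (simp add: mult_ac)
      finally show "(\<Sum>i\<in>UNIV. inv_fourier ((pderivative i ^^ (2 * ?d)) f) k * q k) + (- 1) ^ ?d * (inv_fourier f k * q k) = inv_fourier f k * u k" .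
    qed
    finally show ?thesis using True by (simp add: inv_distr_def)
  qed
  have "inv_distr = Psi (distr_of_cmeas (density_cmeas ?h))" by (rule ext) (rule eq)
  then show ?thesis using transform_fourier_stieltjes[OF qm qi] by (rule bexI)
qed

section \<open>Weak compactness of the translates of a Fourier--Stieltjes transform\<close>

lemma quadratic_nonneg_discriminant:
  fixes A B C :: real
  assumes nn: "\<And>s. 0 \<le> A * s\<^sup>2 + 2 * B * s + C" and A: "0 \<le> A"
  shows "B\<^sup>2 \<le> A * C"
proof (cases "A = 0")
  case True
  have "B = 0"
  proof (rule ccontr)
    assume "B \<noteq> 0"
    then have "2 * B * (- (C + 1) / (2 * B)) = - (C + 1)" by simp
    then show False using nn[of "- (C + 1) / (2 * B)"] True by simp
  qed
  then show ?thesis using True by simp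
next
  case False
  then have A: "0 < A" using A by simp
  have "A * (A * (- B / A)\<^sup>2 + 2 * B * (- B / A) + C) = A * C - B\<^sup>2"
    using A by (simp add: power2_eq_square field_simps)
  moreover have "0 \<le> A * (A * (- B / A)\<^sup>2 + 2 * B * (- B / A) + C)"
    using A nn[of "- B / A"] by simp
  ultimately show ?thesis by simp
qed

lemma unit_rotation:
  obtains c where "cmod c = 1" "c * z = of_real (cmod z)"
proof (cases "z = 0")
  case True then show ?thesis using that[of 1] by simp
next
  case False
  have "(cnj z / of_real (cmod z)) * z = of_real ((cmod z)\<^sup>2) / of_real (cmod z)"
    by (simp only: complex_norm_square times_divide_eq_left times_divide_eq_right mult.commute)
  also have "\<dots> = of_real (cmod z)" using False by (simp add: power2_eq_square)
  finally show ?thesis using False by (intro that[of "cnj z / of_real (cmod z)"]) (simp_all add: norm_divide)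
qed

definition character :: "real^'n::finite \<Rightarrow> 'n cfun" where "character x = (\<lambda>k. ee (k \<bullet> x))"

text \<open>Bounded Borel functions take the place of square integrable ones. Over a finite measure they
  form a pre-Hilbert space with the seminorm \<open>l2\<close> below, which contains the characters and is
  closed under products and conjugation. It is not complete, so functionals on it are
  represented by its elements only approximately.\<close>
definition bounded_meas :: "'n::finite cfun set" where
  "bounded_meas = {f \<in> borel_measurable borel. \<exists>B. \<forall>x. cmod (f x) \<le> B}"

lemma bounded_meas_I: "f \<in> borel_measurable borel \<Longrightarrow> (\<And>x. cmod (f x) \<le> B) \<Longrightarrow> f \<in> bounded_meas"
  by (auto simp: bounded_meas_def)

lemma bounded_meas_measurable [measurable_dest]: "f \<in> bounded_meas \<Longrightarrow> f \<in> borel_measurable borel"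
  by (simp add: bounded_meas_def)

lemma bounded_meas_bound: "f \<in> bounded_meas \<Longrightarrow> \<exists>B. \<forall>x. cmod (f x) \<le> B"
  by (simp add: bounded_meas_def)

lemma bounded_meas_add: assumes "f \<in> bounded_meas" "g \<in> bounded_meas" shows "(\<lambda>x. f x + g x) \<in> bounded_meas"
proof -
  obtain A B where "\<forall>x. cmod (f x) \<le> A" "\<forall>x. cmod (g x) \<le> B" using bounded_meas_bound assms by meson
  then show ?thesis using assms[THEN bounded_meas_measurable]
    by (intro bounded_meas_I[of _ "A + B"] norm_triangle_le add_mono) auto
qed

lemma bounded_meas_mult: assumes "f \<in> bounded_meas" "g \<in> bounded_meas" shows "(\<lambda>x. f x * g x) \<in> bounded_meas"
proof -
  obtain A B where AB: "\<forall>x. cmod (f x) \<le> A" "\<forall>x. cmod (g x) \<le> B" using bounded_meas_bound assms by meson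
  then have "0 \<le> A" using order_trans[OF norm_ge_zero] by blast
  then show ?thesis using assms[THEN bounded_meas_measurable] AB unfolding norm_mult
    by (intro bounded_meas_I[of _ "A * B"]) (auto simp: norm_mult intro: mult_mono)
qed

lemma bounded_meas_const: "(\<lambda>x. c) \<in> bounded_meas"
  by (rule bounded_meas_I[of _ "cmod c"]) auto

lemma bounded_meas_cmult: "f \<in> bounded_meas \<Longrightarrow> (\<lambda>x. c * f x) \<in> bounded_meas"
  by (rule bounded_meas_mult[OF bounded_meas_const])

lemma bounded_meas_cnj: "f \<in> bounded_meas \<Longrightarrow> (\<lambda>x. cnj (f x)) \<in> bounded_meas"
proof -
  assume f: "f \<in> bounded_meas"
  obtain B where "\<forall>x. cmod (f x) \<le> B" using bounded_meas_bound[OF f] by blast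
  moreover have "cnj \<in> borel_measurable borel" by (intro borel_measurable_continuous_onI continuous_intros)
  ultimately show ?thesis
    by (intro bounded_meas_I[of _ B] measurable_compose[OF bounded_meas_measurable[OF f]]) auto
qed

lemma bounded_meas_character: "character x \<in> bounded_meas"
  by (rule bounded_meas_I[of _ 1]) (auto simp: character_def)

lemma apply_Bcontfun:
  assumes "continuous_on UNIV f" "\<And>x. norm (f x) \<le> B"
  shows "apply_bcontfun (Bcontfun f) = f"
  using bcontfun_normI[OF assms] by (simp add: Bcontfun_inverse)

lemma Cu_diff: "f \<in> Cu \<Longrightarrow> g \<in> Cu \<Longrightarrow> f - g \<in> Cu"
  by (auto simp: Cu_def minus_bcontfun.rep_eq intro: uniformly_continuous_on_diff)

locale finite_borel = finite_measure M for M :: "(real^'n::finite) measure" +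
  assumes sets_M [measurable_cong, simp]: "sets M = sets borel"
begin

lemma space_M [simp]: "space M = UNIV"
  using sets_eq_imp_space_eq[OF sets_M] by simp

lemma integrable_bounded_meas: assumes "f \<in> bounded_meas" shows "integrable M f"
proof -
  obtain B where "\<forall>x. cmod (f x) \<le> B" using bounded_meas_bound[OF assms] by blast
  then show ?thesis using bounded_meas_measurable[OF assms] by (intro integrable_const_bound[of _ B]) auto
qed

definition l2 :: "'n cfun \<Rightarrow> real" where "l2 f = sqrt (LINT x|M. (cmod (f x))\<^sup>2)"

lemma l2_nonneg: "0 \<le> l2 f" by (simp add: l2_def)

lemma l2_power2: "(l2 f)\<^sup>2 = (LINT x|M. (cmod (f x))\<^sup>2)"
  by (simp add: l2_def)

lemma integrable_l2: assumes "f \<in> bounded_meas" shows "integrable M (\<lambda>x. (cmod (f x))\<^sup>2)"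
proof -
  have "integrable M (\<lambda>x. Re (f x * cnj (f x)))"
    by (intro integrable_Re integrable_bounded_meas bounded_meas_mult bounded_meas_cnj assms)
  then show ?thesis by (simp add: complex_mult_cnj cmod_power2)
qed

lemma l2_cmult: "l2 (\<lambda>x. c * f x) = cmod c * l2 f"
  by (simp add: l2_def norm_mult power_mult_distrib real_sqrt_mult)

definition bounded_functional :: "('n cfun \<Rightarrow> complex) \<Rightarrow> real \<Rightarrow> bool" where
  "bounded_functional l K \<longleftrightarrow> (\<forall>f\<in>bounded_meas. \<forall>g\<in>bounded_meas. l (\<lambda>x. f x + g x) = l f + l g) \<and>
     (\<forall>c. \<forall>f\<in>bounded_meas. l (\<lambda>x. c * f x) = c * l f) \<and> (\<forall>f\<in>bounded_meas. cmod (l f) \<le> K * l2 f)"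

lemma bounded_functionalD:
  assumes "bounded_functional l K"
  shows "f \<in> bounded_meas \<Longrightarrow> g \<in> bounded_meas \<Longrightarrow> l (\<lambda>x. f x + g x) = l f + l g"
    "f \<in> bounded_meas \<Longrightarrow> l (\<lambda>x. c * f x) = c * l f" "f \<in> bounded_meas \<Longrightarrow> cmod (l f) \<le> K * l2 f"
  using assms by (auto simp: bounded_functional_def)

text \<open>In a Hilbert space the representing vector minimises \<open>J f = (l2 f)\<^sup>2 - 2 * Re (l f)\<close>. Here \<open>q\<close> is taken
  with \<open>J q\<close> within \<open>e\<^sup>2\<close> of the infimum. Then \<open>J (q + s * f) - J q + e\<^sup>2\<close> is a quadratic
  polynomial in \<open>s\<close> without negative values, and its discriminant gives the
  estimate for the real parts; a rotation of \<open>f\<close> extends it to the modulus.\<close>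
lemma riesz_approx:
  assumes l: "bounded_functional l K" and e: "0 < e"
  obtains q where "q \<in> bounded_meas" "\<And>f. f \<in> bounded_meas \<Longrightarrow> cmod (l f - (LINT x|M. f x * q x)) \<le> e * l2 f"
proof -
  note add = bounded_functionalD(1)[OF l] and mult = bounded_functionalD(2)[OF l] and bd = bounded_functionalD(3)[OF l]
  define J where "J f = (l2 f)\<^sup>2 - 2 * Re (l f)" for f
  have below: "- K\<^sup>2 \<le> J f" if "f \<in> bounded_meas" for f
  proof -
    have "Re (l f) \<le> K * l2 f" using bd[OF that] complex_Re_le_cmod[of "l f"] by simp
    moreover have "0 \<le> (l2 f - K)\<^sup>2" by simp
    ultimately show ?thesis unfolding J_def by (simp add: power2_diff algebra_simps)
  qed
  have bdd: "bdd_below (J ` bounded_meas)" using below by (rule bdd_belowI2)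
  have ne: "J ` bounded_meas \<noteq> {}" using bounded_meas_const by auto
  have "Inf (J ` bounded_meas) < Inf (J ` bounded_meas) + e\<^sup>2" using e by simp
  from cInf_lessD[OF ne this] obtain q where q: "q \<in> bounded_meas" and Jq: "J q < Inf (J ` bounded_meas) + e\<^sup>2"
    by auto
  have near: "J q \<le> J f + e\<^sup>2" if "f \<in> bounded_meas" for f
    using cInf_lower[OF imageI[OF that] bdd] Jq by simp
  have real_part: "\<bar>Re (LINT x|M. f x * cnj (q x)) - Re (l f)\<bar> \<le> e * l2 f" if f: "f \<in> bounded_meas" for f
  proof -
    let ?B = "Re (LINT x|M. f x * cnj (q x)) - Re (l f)"
    have fq: "integrable M (\<lambda>x. f x * cnj (q x))" by (intro integrable_bounded_meas bounded_meas_mult bounded_meas_cnj f q)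
    have "?B\<^sup>2 \<le> (l2 f)\<^sup>2 * e\<^sup>2"
    proof (rule quadratic_nonneg_discriminant)
      fix s :: real
      let ?g = "\<lambda>x. q x + of_real s * f x"
      have sf: "(\<lambda>x. of_real s * f x) \<in> bounded_meas" by (rule bounded_meas_cmult[OF f])
      have pt: "(cmod (?g x))\<^sup>2 = (cmod (q x))\<^sup>2 + 2 * s * Re (f x * cnj (q x)) + s\<^sup>2 * (cmod (f x))\<^sup>2" for x
        unfolding cmod_power2 by (simp add: power2_eq_square algebra_simps)
      have "(l2 ?g)\<^sup>2 = (l2 q)\<^sup>2 + 2 * s * Re (LINT x|M. f x * cnj (q x)) + s\<^sup>2 * (l2 f)\<^sup>2"
        unfolding l2_power2 pt integral_Re[OF fq, symmetric]
        using integrable_l2[OF q] integrable_l2[OF f] integrable_Re[OF fq] by simp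
      moreover have "l ?g = l q + of_real s * l f" using add[OF q sf] mult[OF f] by simp
      ultimately have "J ?g = J q + 2 * s * ?B + s\<^sup>2 * (l2 f)\<^sup>2" unfolding J_def by (simp add: algebra_simps)
      then show "0 \<le> (l2 f)\<^sup>2 * s\<^sup>2 + 2 * ?B * s + e\<^sup>2"
        using near[OF bounded_meas_add[OF q sf]] by (simp add: algebra_simps)
    qed simp
    then have "sqrt (?B\<^sup>2) \<le> sqrt ((e * l2 f)\<^sup>2)" by (intro real_sqrt_le_mono) (simp add: power_mult_distrib mult.commute)
    then show ?thesis using e l2_nonneg by simp
  qed
  show thesis
  proof
    show "(\<lambda>x. cnj (q x)) \<in> bounded_meas" by (rule bounded_meas_cnj[OF q])
    fix f :: "'n cfun" assume f: "f \<in> bounded_meas"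
    let ?z = "(LINT x|M. f x * cnj (q x)) - l f"
    obtain c where c: "cmod c = 1" and cz: "c * ?z = of_real (cmod ?z)" by (rule unit_rotation)
    have "cmod ?z = Re (c * ?z)" by (simp add: cz)
    also have "c * ?z = (LINT x|M. (c * f x) * cnj (q x)) - l (\<lambda>x. c * f x)"
      by (simp add: mult[OF f] right_diff_distrib mult.assoc)
    also have "Re \<dots> \<le> e * l2 (\<lambda>x. c * f x)" using real_part[OF bounded_meas_cmult[OF f], of c] by simp
    also have "\<dots> = e * l2 f" by (simp add: l2_cmult c)
    finally show "cmod (l f - (LINT x|M. f x * cnj (q x))) \<le> e * l2 f" by (simp add: norm_minus_commute)
  qed
qed

lemma l2_character: "l2 (character x) = sqrt (measure M UNIV)"
  by (simp add: l2_def character_def)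

lemma l2_character_diff:
  assumes "(\<lambda>n. x n - y n) \<longlonglongrightarrow> 0"
  shows "(\<lambda>n::nat. l2 (\<lambda>k. character (x n) k + (- 1) * character (y n) k)) \<longlonglongrightarrow> 0"
proof -
  have "(\<lambda>n. LINT k|M. (cmod (ee (k \<bullet> (x n - y n)) - 1))\<^sup>2) \<longlonglongrightarrow> (LINT k|M. 0)"
  proof (rule integral_dominated_convergence[where w="\<lambda>_. 4"])
    show "AE k in M. (\<lambda>n. (cmod (ee (k \<bullet> (x n - y n)) - 1))\<^sup>2) \<longlonglongrightarrow> 0"
    proof (rule AE_I2)
      fix k
      have "(\<lambda>n. k \<bullet> (x n - y n)) \<longlonglongrightarrow> 0" using tendsto_inner[OF tendsto_const[of k] assms] by simp
      moreover have "isCont ee 0" using continuous_ee[of UNIV] by (simp add: continuous_on_eq_continuous_at)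
      ultimately have "(\<lambda>n. ee (k \<bullet> (x n - y n))) \<longlonglongrightarrow> ee 0" by (rule isCont_tendsto_compose[rotated])
      then show "(\<lambda>n. (cmod (ee (k \<bullet> (x n - y n)) - 1))\<^sup>2) \<longlonglongrightarrow> 0"
        by (auto intro!: tendsto_eq_intros)
    qed
    show "AE k in M. norm ((cmod (ee (k \<bullet> (x n - y n)) - 1))\<^sup>2) \<le> 4" for n
    proof (rule AE_I2)
      fix k
      have "cmod (ee (k \<bullet> (x n - y n)) - 1) \<le> 2" by (rule order_trans[OF norm_triangle_ineq4]) simp
      then have "(cmod (ee (k \<bullet> (x n - y n)) - 1))\<^sup>2 \<le> 2\<^sup>2" by (intro power_mono) auto
      then show "norm ((cmod (ee (k \<bullet> (x n - y n)) - 1))\<^sup>2) \<le> 4" by simp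
    qed
  qed auto
  moreover have "cmod (character (x n) k + (- 1) * character (y n) k) = cmod (ee (k \<bullet> (x n - y n)) - 1)" for n k
  proof -
    have "character (x n) k + (- 1) * character (y n) k = ee (k \<bullet> y n) * (ee (k \<bullet> (x n - y n)) - 1)"
      unfolding character_def right_diff_distrib ee_add[symmetric] by (simp add: inner_diff_right)
    then show ?thesis by (simp add: norm_mult)
  qed
  ultimately have "(\<lambda>n. sqrt (LINT k|M. (cmod (character (x n) k + (- 1) * character (y n) k))\<^sup>2)) \<longlonglongrightarrow> sqrt 0"
    by (intro tendsto_real_sqrt) simp
  then show ?thesis by (simp add: l2_def)
qed

text \<open>For \<open>l f = \<integral> f * v \<partial>M\<close> this is the inverse Fourier--Stieltjes transform of \<open>v\<close> with respect to \<open>M\<close>.\<close>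
definition transform :: "('n cfun \<Rightarrow> complex) \<Rightarrow> ((real^'n) \<Rightarrow>\<^sub>C complex)" where
  "transform l = Bcontfun (\<lambda>x. l (character x))"

lemma transform:
  assumes l: "bounded_functional l K"
  shows apply_transform: "apply_bcontfun (transform l) x = l (character x)"
    and transform_Cu: "transform l \<in> Cu"
proof -
  have uc: "uniformly_continuous_on UNIV (\<lambda>x. l (character x))"
    unfolding uniformly_continuous_on_sequentially
  proof (intro allI impI)
    fix x y :: "nat \<Rightarrow> real^'n" assume "(\<forall>n. x n \<in> UNIV) \<and> (\<forall>n. y n \<in> UNIV) \<and> (\<lambda>n. dist (x n) (y n)) \<longlonglongrightarrow> 0"
    then have "(\<lambda>n. norm (x n - y n)) \<longlonglongrightarrow> 0" by (simp add: dist_norm)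
    then have "(\<lambda>n. x n - y n) \<longlonglongrightarrow> 0" by (rule tendsto_norm_zero_cancel)
    from tendsto_mult_right_zero[OF l2_character_diff[OF this], of K]
    show "(\<lambda>n. dist (l (character (x n))) (l (character (y n)))) \<longlonglongrightarrow> 0"
    proof (rule Lim_null_comparison[rotated], intro always_eventually allI)
      fix n
      have "l (character (x n)) - l (character (y n)) = l (\<lambda>k. character (x n) k + (- 1) * character (y n) k)"
        unfolding bounded_functionalD(1)[OF l bounded_meas_character bounded_meas_cmult[OF bounded_meas_character]] bounded_functionalD(2)[OF l bounded_meas_character] by simp
      then have "norm (dist (l (character (x n))) (l (character (y n)))) = cmod (l (\<lambda>k. character (x n) k + (- 1) * character (y n) k))"
        by (simp only: dist_norm real_norm_def abs_norm_cancel)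
      also have "\<dots> \<le> K * l2 (\<lambda>k. character (x n) k + (- 1) * character (y n) k)"
        by (rule bounded_functionalD(3)[OF l bounded_meas_add[OF bounded_meas_character bounded_meas_cmult[OF bounded_meas_character]]])
      finally show "norm (dist (l (character (x n))) (l (character (y n)))) \<le> K * l2 (\<lambda>k. character (x n) k + (- 1) * character (y n) k)" .
    qed
  qed
  have ap: "apply_bcontfun (transform l) = (\<lambda>x. l (character x))"
    unfolding transform_def
  proof (rule apply_Bcontfun[OF uniformly_continuous_imp_continuous[OF uc]])
    show "cmod (l (character x)) \<le> K * sqrt (measure M UNIV)" for x
      using bounded_functionalD(3)[OF l bounded_meas_character] by (simp add: l2_character)
  qed
  show "apply_bcontfun (transform l) x = l (character x)" by (simp add: ap)
  show "transform l \<in> Cu" by (simp add: Cu_def ap uc)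
qed

lemma functional_of_density:
  assumes h: "h \<in> bounded_meas"
  shows "bounded_functional (\<lambda>f. LINT x|M. f x * h x) (l2 h)"
  unfolding bounded_functional_def
proof (intro conjI ballI allI)
  fix f g :: "'n cfun" and c assume f: "f \<in> bounded_meas"
  show "(LINT x|M. (c * f x) * h x) = c * (LINT x|M. f x * h x)" by (simp add: mult.assoc)
  show "cmod (LINT x|M. f x * h x) \<le> l2 h * l2 f"
  proof -
    have i: "integrable M (\<lambda>x. cmod (f x) * cmod (h x))"
      using integrable_norm[OF integrable_bounded_meas[OF bounded_meas_mult[OF f h]]] by (simp add: norm_mult)
    have "(LINT x|M. cmod (f x) * cmod (h x))\<^sup>2 \<le> (l2 f)\<^sup>2 * (l2 h)\<^sup>2"
    proof (rule quadratic_nonneg_discriminant)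
      fix s
      have "0 \<le> (LINT x|M. (s * cmod (f x) + cmod (h x))\<^sup>2)" by (intro Bochner_Integration.integral_nonneg) simp
      also have "\<dots> = (LINT x|M. s\<^sup>2 * (cmod (f x))\<^sup>2 + 2 * s * (cmod (f x) * cmod (h x)) + (cmod (h x))\<^sup>2)"
        by (simp add: power2_sum power_mult_distrib algebra_simps)
      also have "\<dots> = (l2 f)\<^sup>2 * s\<^sup>2 + 2 * (LINT x|M. cmod (f x) * cmod (h x)) * s + (l2 h)\<^sup>2"
        using integrable_l2[OF f] integrable_l2[OF h] i by (simp add: l2_power2)
      finally show "0 \<le> (l2 f)\<^sup>2 * s\<^sup>2 + 2 * (LINT x|M. cmod (f x) * cmod (h x)) * s + (l2 h)\<^sup>2" .
    qed simp
    then have "sqrt ((LINT x|M. cmod (f x) * cmod (h x))\<^sup>2) \<le> sqrt ((l2 h * l2 f)\<^sup>2)"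
      by (intro real_sqrt_le_mono) (simp add: power_mult_distrib mult.commute)
    moreover have "cmod (LINT x|M. f x * h x) \<le> (LINT x|M. cmod (f x) * cmod (h x))"
      using integral_norm_bound[of M "\<lambda>x. f x * h x"] by (simp add: norm_mult)
    ultimately show ?thesis using l2_nonneg by (simp add: abs_mult)
  qed
  assume g: "g \<in> bounded_meas"
  show "(LINT x|M. (f x + g x) * h x) = (LINT x|M. f x * h x) + (LINT x|M. g x * h x)"
    by (simp add: distrib_right integrable_bounded_meas bounded_meas_mult f g h)
qed

text \<open>Composed with the transform of densities \<open>h\<close>, the functional \<open>\<phi>\<close> becomes a functional of \<open>h\<close> that is
  bounded by \<open>l2 h\<close>, so it is nearly \<open>h \<mapsto> \<integral> h * q \<partial>M\<close> for a bounded \<open>q\<close>. A functional \<open>l\<close> is itself nearly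
  given by a density \<open>h\<close>, and then \<open>\<phi> (transform l)\<close> is near \<open>\<integral> h * q \<partial>M\<close>, which is near \<open>l q\<close>. The error
  depends on the bound \<open>K\<close> of \<open>l\<close> only: on a ball of functionals \<open>\<phi> \<circ> transform\<close> is a uniform
  limit of evaluations.\<close>
lemma Cu_dual_transform_approx:
  fixes \<phi> :: "((real^'n) \<Rightarrow>\<^sub>C complex) \<Rightarrow> complex"
  assumes phi: "\<phi> \<in> Cu_dual" and d: "0 < d" and K: "0 \<le> K"
  obtains q where "q \<in> bounded_meas" "\<And>l. bounded_functional l K \<Longrightarrow> cmod (\<phi> (transform l) - l q) \<le> d * K"
proof -
  define S where "S h = transform (\<lambda>f. LINT x|M. f x * h x)" for h
  note fd = functional_of_density
  have "\<exists>C. \<forall>f\<in>Cu. cmod (\<phi> f) \<le> C * norm f" using phi by (simp add: Cu_dual_def)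
  then obtain C where C: "\<And>f. f \<in> Cu \<Longrightarrow> cmod (\<phi> f) \<le> C * norm f" by blast
  have padd: "\<phi> (f + g) = \<phi> f + \<phi> g" if "f \<in> Cu" "g \<in> Cu" for f g using phi that by (auto simp: Cu_dual_def)
  have pscale: "\<phi> (cscale c f) = c * \<phi> f" if "f \<in> Cu" for c f using phi that by (auto simp: Cu_dual_def)
  have pdiff: "\<phi> f - \<phi> g = \<phi> (f - g)" if "f \<in> Cu" "g \<in> Cu" for f g
    using padd[OF Cu_diff[OF that] that(2)] by simp
  define C' where "C' = max C 0"
  have C': "cmod (\<phi> f) \<le> C' * norm f" "0 \<le> C'" if "f \<in> Cu" for f
    using C[OF that] mult_right_mono[of C C' "norm f"] by (auto simp: C'_def)
  have SCu: "S h \<in> Cu" and Sap: "apply_bcontfun (S h) x = (LINT k|M. character x k * h k)" if "h \<in> bounded_meas" for h x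
    unfolding S_def using transform_Cu[OF fd[OF that]] apply_transform[OF fd[OF that]] by auto
  have C'0: "0 \<le> C'" by (simp add: C'_def)
  let ?s = "sqrt (measure M UNIV)"
  have "bounded_functional (\<lambda>h. \<phi> (S h)) (C' * ?s)"
    unfolding bounded_functional_def
  proof (intro conjI ballI allI)
    fix f g :: "'n cfun" and c assume f: "f \<in> bounded_meas"
    have "S (\<lambda>x. c * f x) = cscale c (S f)"
      by (rule bcontfun_eqI) (simp add: Sap f bounded_meas_cmult mult.left_commute)
    then show "\<phi> (S (\<lambda>x. c * f x)) = c * \<phi> (S f)" by (simp add: pscale SCu f)
    have "norm (S f) \<le> l2 f * ?s"
      using bounded_functionalD(3)[OF fd[OF f] bounded_meas_character] by (intro norm_bound) (simp add: Sap f l2_character)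
    then have "cmod (\<phi> (S f)) \<le> C' * (l2 f * ?s)"
      using C'(1)[OF SCu[OF f]] mult_left_mono[OF _ C'0] by (meson order_trans)
    then show "cmod (\<phi> (S f)) \<le> C' * ?s * l2 f" by (simp add: mult_ac)
    assume g: "g \<in> bounded_meas"
    have "S (\<lambda>x. f x + g x) = S f + S g"
      by (rule bcontfun_eqI) (simp add: Sap f g bounded_meas_add plus_bcontfun.rep_eq distrib_left integrable_bounded_meas bounded_meas_mult bounded_meas_character)
    then show "\<phi> (S (\<lambda>x. f x + g x)) = \<phi> (S f) + \<phi> (S g)" by (simp add: padd SCu f g)
  qed
  from riesz_approx[OF this d] obtain q where q: "q \<in> bounded_meas"
    and qa: "\<And>h. h \<in> bounded_meas \<Longrightarrow> cmod (\<phi> (S h) - (LINT x|M. h x * q x)) \<le> d * l2 h" by metis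
  show thesis
  proof (rule that[OF q])
    fix l assume l: "bounded_functional l K"
    show "cmod (\<phi> (transform l) - l q) \<le> d * K"
    proof (rule field_le_epsilon)
      fix r :: real assume r: "0 < r"
      \<comment> \<open>The accuracy for \<open>l\<close>, chosen after \<open>q\<close>: only \<open>d * K\<close> has to remain of the total error.\<close>
      define e where "e = r / (C' * ?s + d + l2 q + 1)"
      have den: "0 < C' * ?s + d + l2 q + 1" using C'0 d l2_nonneg[of q] by (simp add: add_nonneg_pos)
      have e: "0 < e" using r den by (simp add: e_def)
      have er: "e * (C' * ?s + d + l2 q) \<le> r"
      proof -
        have "e * (C' * ?s + d + l2 q) \<le> e * (C' * ?s + d + l2 q + 1)" using e by simp
        also have "\<dots> = r" using den by (simp add: e_def)
        finally show ?thesis .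
      qed
      obtain h where h: "h \<in> bounded_meas" and ha: "\<And>f. f \<in> bounded_meas \<Longrightarrow> cmod (l f - (LINT x|M. f x * h x)) \<le> e * l2 f"
        using riesz_approx[OF l e] by metis
      \<comment> \<open>Testing the approximation with \<open>cnj h\<close> bounds the density by the norm of \<open>l\<close>.\<close>
      have lh: "l2 h \<le> K + e"
      proof (cases "l2 h = 0")
        case True then show ?thesis using K e by simp
      next
        case False
        have "(l2 h)\<^sup>2 = cmod (LINT x|M. cnj (h x) * h x)"
        proof -
          have "(LINT x|M. cnj (h x) * h x) = (LINT x|M. complex_of_real ((cmod (h x))\<^sup>2))"
            by (simp add: complex_norm_square mult.commute del: of_real_power)
          then show ?thesis by (simp add: l2_power2 del: of_real_power)
        qed
        also have "\<dots> \<le> cmod (l (\<lambda>x. cnj (h x))) + cmod (l (\<lambda>x. cnj (h x)) - (LINT x|M. cnj (h x) * h x))"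
          by (metis norm_triangle_sub norm_minus_commute)
        also have "\<dots> \<le> K * l2 (\<lambda>x. cnj (h x)) + e * l2 (\<lambda>x. cnj (h x))"
          by (intro add_mono ha bounded_functionalD(3)[OF l] bounded_meas_cnj h)
        also have "\<dots> = (K + e) * l2 h" by (simp add: l2_def distrib_right)
        finally show ?thesis using False l2_nonneg[of h] by (simp add: power2_eq_square)
      qed
      have "norm (transform l - S h) \<le> e * ?s"
        using ha[OF bounded_meas_character] by (intro norm_bound) (simp add: minus_bcontfun.rep_eq apply_transform[OF l] Sap[OF h] l2_character)
      then have 1: "cmod (\<phi> (transform l) - \<phi> (S h)) \<le> C' * (e * ?s)"
        unfolding pdiff[OF transform_Cu[OF l] SCu[OF h]]
        using C'(1)[OF Cu_diff[OF transform_Cu[OF l] SCu[OF h]]] mult_left_mono[OF _ C'0] by (meson order_trans)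
      have 2: "cmod (\<phi> (S h) - (LINT x|M. h x * q x)) \<le> d * (K + e)"
        using qa[OF h] mult_left_mono[OF lh less_imp_le[OF d]] by (rule order_trans)
      have 3: "cmod ((LINT x|M. h x * q x) - l q) \<le> e * l2 q"
        using ha[OF q] by (simp add: norm_minus_commute mult.commute)
      have "cmod (\<phi> (transform l) - l q) \<le> C' * (e * ?s) + d * (K + e) + e * l2 q"
      proof -
        have "\<phi> (transform l) - l q = (\<phi> (transform l) - \<phi> (S h)) + (\<phi> (S h) - (LINT x|M. h x * q x)) + ((LINT x|M. h x * q x) - l q)" by simp
        then show ?thesis using 1 2 3 by (metis (no_types, lifting) add_mono norm_triangle_le)
      qed
      also have "\<dots> = d * K + e * (C' * ?s + d + l2 q)" by (simp add: algebra_simps)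
      also have "\<dots> \<le> d * K + r" using er by simp
      finally show "cmod (\<phi> (transform l) - l q) \<le> d * K + r" .
    qed
  qed
qed

text \<open>The values outside \<open>bounded_meas\<close> are fixed to \<open>0\<close>, so that a ball is compact in the product
  topology on all functions.\<close>
definition functional_ball :: "real \<Rightarrow> ('n cfun \<Rightarrow> complex) set" where
  "functional_ball K = {l. (\<forall>f. f \<notin> bounded_meas \<longrightarrow> l f = 0) \<and> bounded_functional l K}"

text \<open>As in the Banach--Alaoglu theorem: a closed subset of a product of compact discs.\<close>
lemma compact_functional_ball: "compact (functional_ball K)"
proof -
  let ?P = "PiE UNIV (\<lambda>f. if f \<in> bounded_meas then cball (0::complex) (K * l2 f) else {0})"
  have "compact ?P"
  proof -
    have "compactin (product_topology (\<lambda>_. euclidean) UNIV) ?P"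
      unfolding compactin_PiE by auto
    then show ?thesis by (simp add: euclidean_product_topology)
  qed
  moreover have "closed (functional_ball K)"
  proof -
    have c: "continuous_on UNIV (\<lambda>l :: 'n cfun \<Rightarrow> complex. l f)" for f by simp
    show ?thesis
      unfolding functional_ball_def bounded_functional_def Ball_def
      by (intro closed_Collect_conj closed_Collect_all closed_Collect_imp closed_Collect_eq closed_Collect_le
        open_Collect_const continuous_intros c)
  qed
  moreover have "functional_ball K \<subseteq> ?P"
    by (auto simp: functional_ball_def bounded_functional_def)
  ultimately show ?thesis using compact_Int_closed[of ?P "functional_ball K"] by (simp add: Int_absorb1)
qed

lemma topspace_Cu_weak_topology: "topspace (Cu_weak_topology :: ((real^'n) \<Rightarrow>\<^sub>C complex) topology) = Cu"
proof -
  have "(\<lambda>f :: (real^'n) \<Rightarrow>\<^sub>C complex. 0) \<in> Cu_dual" by (auto simp: Cu_dual_def intro: exI[of _ 0])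
  then have "\<exists>\<phi> U. (Cu :: ((real^'n) \<Rightarrow>\<^sub>C complex) set) = {f \<in> Cu. \<phi> f \<in> U} \<and> \<phi> \<in> Cu_dual \<and> open U"
    by (intro exI[of _ "\<lambda>_. 0"] exI[of _ UNIV]) auto
  then show ?thesis unfolding Cu_weak_topology_def topology_generated_by_topspace by blast
qed

lemma eval_Cu_dual: "(\<lambda>f :: (real^'n) \<Rightarrow>\<^sub>C complex. apply_bcontfun f x) \<in> Cu_dual"
  unfolding Cu_dual_def
proof (intro CollectI conjI ballI allI exI[of _ 1])
  fix f :: "(real^'n) \<Rightarrow>\<^sub>C complex"
  show "cmod (apply_bcontfun f x) \<le> 1 * norm f" by (simp add: norm_bounded)
qed (simp_all add: plus_bcontfun.rep_eq)

text \<open>Point evaluations are bounded functionals and separate functions. A compact set in the weak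
  topology is therefore closed and contains the weak closure of each of its subsets.\<close>
lemma Hausdorff_Cu_weak: "Hausdorff_space (Cu_weak_topology :: ((real^'n) \<Rightarrow>\<^sub>C complex) topology)"
  unfolding Hausdorff_space_def topspace_Cu_weak_topology
proof (intro allI impI)
  fix f g :: "(real^'n) \<Rightarrow>\<^sub>C complex" assume fg: "f \<in> Cu \<and> g \<in> Cu \<and> f \<noteq> g"
  then obtain x where ne: "apply_bcontfun f x \<noteq> apply_bcontfun g x" by (metis bcontfun_eqI)
  then obtain U V where UV: "open U" "open V" "apply_bcontfun f x \<in> U" "apply_bcontfun g x \<in> V" "U \<inter> V = {}"
    using hausdorff[OF ne] by auto
  have op: "openin Cu_weak_topology {f \<in> Cu. apply_bcontfun f x \<in> W}" if "open W" for W
    unfolding Cu_weak_topology_def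
  proof (rule topology_generated_by_Basis)
    show "{f \<in> Cu. apply_bcontfun f x \<in> W} \<in> {{f \<in> Cu. \<phi> f \<in> U} | \<phi> U. \<phi> \<in> Cu_dual \<and> open U}"
      by (intro CollectI exI[of _ "\<lambda>f. apply_bcontfun f x"] exI[of _ W] conjI refl eval_Cu_dual that)
  qed
  show "\<exists>U V. openin Cu_weak_topology U \<and> openin Cu_weak_topology V \<and> f \<in> U \<and> g \<in> V \<and> disjnt U V"
    by (rule exI[of _ "{f \<in> Cu. apply_bcontfun f x \<in> U}"], rule exI[of _ "{f \<in> Cu. apply_bcontfun f x \<in> V}"])
      (use UV fg op in \<open>auto simp: disjnt_def\<close>)
qed

lemma continuous_transform:
  assumes K: "0 \<le> K"
  shows "continuous_map (top_of_set (functional_ball K)) Cu_weak_topology transform"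
  unfolding Cu_weak_topology_def
proof (rule continuous_on_generated_topo)
  have Cu: "transform l \<in> Cu" if "l \<in> functional_ball K" for l
    using that transform_Cu by (auto simp: functional_ball_def)
  show "transform ` topspace (top_of_set (functional_ball K)) \<subseteq> \<Union>{{f \<in> Cu. \<phi> f \<in> U} | \<phi> U. \<phi> \<in> Cu_dual \<and> open U}"
    using Cu topspace_Cu_weak_topology unfolding Cu_weak_topology_def topology_generated_by_topspace by auto
  fix W :: "((real^'n) \<Rightarrow>\<^sub>C complex) set" assume "W \<in> {{f \<in> Cu. \<phi> f \<in> U} | \<phi> U. \<phi> \<in> Cu_dual \<and> open (U :: complex set)}"
  then obtain \<phi> and U :: "complex set" where W: "W = {f \<in> Cu. \<phi> f \<in> U}" "\<phi> \<in> Cu_dual" "open U" by blast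
  have "\<exists>q\<in>bounded_meas. \<forall>l. bounded_functional l K \<longrightarrow> cmod (\<phi> (transform l) - l q) \<le> inverse (real (Suc n)) * K" for n
    using Cu_dual_transform_approx[OF W(2) _ K, of "inverse (real (Suc n))"] by (metis inverse_positive_iff_positive of_nat_0_less_iff zero_less_Suc)
  then obtain q where q: "\<And>n l. bounded_functional l K \<Longrightarrow> cmod (\<phi> (transform l) - l (q n)) \<le> inverse (real (Suc n)) * K" by metis
  have "uniform_limit (functional_ball K) (\<lambda>n l. l (q n)) (\<lambda>l. \<phi> (transform l)) sequentially"
  proof (rule uniform_limitI)
    fix e :: real assume e: "0 < e"
    have "(\<lambda>n. inverse (real (Suc n)) * K) \<longlonglongrightarrow> 0" by (rule tendsto_mult_left_zero[OF LIMSEQ_inverse_real_of_nat])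
    then have "\<forall>\<^sub>F n in sequentially. inverse (real (Suc n)) * K < e" using e by (rule order_tendstoD)
    then show "\<forall>\<^sub>F n in sequentially. \<forall>l\<in>functional_ball K. dist (l (q n)) (\<phi> (transform l)) < e"
    proof eventually_elim
      case (elim n)
      show ?case
      proof
        fix l assume "l \<in> functional_ball K"
        then show "dist (l (q n)) (\<phi> (transform l)) < e"
          using q[of l n] elim by (simp add: functional_ball_def dist_norm norm_minus_commute)
      qed
    qed
  qed
  then have "continuous_on (functional_ball K) (\<lambda>l. \<phi> (transform l))"
    by (rule uniform_limit_theorem[rotated])
      (auto intro!: always_eventually continuous_on_subset[OF continuous_on_product_coordinates])
  then have "openin (top_of_set (functional_ball K)) (functional_ball K \<inter> (\<lambda>l. \<phi> (transform l)) -` U)"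
    using W(3) by (rule continuous_openin_preimage_gen)
  moreover have "transform -` W \<inter> topspace (top_of_set (functional_ball K)) = functional_ball K \<inter> (\<lambda>l. \<phi> (transform l)) -` U"
    using Cu by (auto simp: W)
  ultimately show "openin (top_of_set (functional_ball K)) (transform -` W \<inter> topspace (top_of_set (functional_ball K)))" by simp
qed

text \<open>A translation multiplies the density \<open>v\<close> by a character and leaves \<open>l2 v\<close> unchanged. So all
  translates are transforms of functionals in one ball; this ball is compact, and its image
  under the weakly continuous map \<open>transform\<close> is weakly compact.\<close>
theorem Fourier_Stieltjes_WAP:
  assumes v: "v \<in> bounded_meas"
  shows "(\<lambda>x. LINT k|M. ee (k \<bullet> x) * v k) \<in> WAP_fun"
proof -
  define L where "L t f = (if f \<in> bounded_meas then (LINT k|M. f k * (character (- t) k * v k)) else 0)" for t f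
  let ?K = "l2 v"
  have l2eq: "l2 (\<lambda>k. character (- t) k * v k) = ?K" for t by (simp add: l2_def norm_mult character_def)
  have bf: "bounded_functional (L t) ?K" for t
    using functional_of_density[OF bounded_meas_mult[OF bounded_meas_character v], of "- t"]
    unfolding l2eq bounded_functional_def L_def by (simp add: bounded_meas_add bounded_meas_cmult)
  have ball: "L t \<in> functional_ball ?K" for t by (simp add: functional_ball_def bf) (simp add: L_def)
  have ap: "apply_bcontfun (transform (L t)) x = (LINT k|M. ee (k \<bullet> (x - t)) * v k)" for t x
    by (simp add: apply_transform[OF bf] L_def bounded_meas_character) (simp add: character_def inner_diff_right ee_diff mult_ac)
  let ?G = "transform (L 0)"
  have tr: "translate t ?G = transform (L t)" for t by (rule bcontfun_eqI) (simp add: ap)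
  have cpt: "compactin Cu_weak_topology (transform ` functional_ball ?K)"
  proof (rule image_compactin[OF _ continuous_transform[OF l2_nonneg]])
    show "compactin (top_of_set (functional_ball ?K)) (functional_ball ?K)"
      using compact_functional_ball by (simp add: compactin_subtopology)
  qed
  have "Cu_weak_topology closure_of range (\<lambda>t. translate t ?G) \<subseteq> transform ` functional_ball ?K"
    by (rule closure_of_minimal) (auto simp: tr ball intro!: compactin_imp_closedin Hausdorff_Cu_weak cpt)
  then have "relatively_compact_in Cu_weak_topology (range (\<lambda>t. translate t ?G))"
    unfolding relatively_compact_in_def by (rule closed_compactin[OF cpt]) simp
  then show ?thesis
    unfolding WAP_fun_def using transform_Cu[OF bf[of 0]] ap[of 0]
    by (intro CollectI exI[of _ ?G]) (auto simp: fun_eq_iff)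
qed

end

section \<open>Bohr almost periodicity from a pure point spectrum\<close>

lemma closed_Cu: "closed (Cu :: ((real^'n::finite) \<Rightarrow>\<^sub>C complex) set)"
  unfolding closure_subset_eq[symmetric]
proof
  fix f :: "(real^'n) \<Rightarrow>\<^sub>C complex" assume "f \<in> closure Cu"
  then have f: "\<forall>e>0. \<exists>g\<in>Cu. dist g f < e" by (simp add: closure_approachable)
  show "f \<in> Cu"
    unfolding Cu_def mem_Collect_eq uniformly_continuous_on_def
  proof (intro allI impI)
    fix e :: real assume "0 < e"
    then have e: "0 < e / 3" by simp
    then obtain g where g: "g \<in> Cu" "dist g f < e / 3" using f by blast
    then obtain d where d: "0 < d" "\<And>x y. dist y x < d \<Longrightarrow> dist (apply_bcontfun g y) (apply_bcontfun g x) < e / 3"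
      using e unfolding Cu_def uniformly_continuous_on_def by blast
    have gf: "dist (apply_bcontfun g x) (apply_bcontfun f x) < e / 3" for x
      using dist_bounded[of g x f] g(2) by simp
    have "dist (apply_bcontfun f y) (apply_bcontfun f x) < e" if "dist y x < d" for x y
      using d(2)[OF that] gf[of x] gf[of y]
        dist_triangle[of "apply_bcontfun f y" "apply_bcontfun f x" "apply_bcontfun g y"]
        dist_triangle[of "apply_bcontfun g y" "apply_bcontfun f x" "apply_bcontfun g x"]
      by (simp add: dist_commute)
    then show "\<exists>d>0. \<forall>x\<in>UNIV. \<forall>y\<in>UNIV. dist y x < d \<longrightarrow> dist (apply_bcontfun f y) (apply_bcontfun f x) < e"
      using d(1) by blast
  qed
qed

lemma closure_of_Cu: "S \<subseteq> Cu \<Longrightarrow> top_of_set Cu closure_of S = closure S"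
  unfolding closure_of_subtopology
  by (simp add: Int_absorb1 Int_absorb2 closure_minimal closed_Cu)

lemma translate_Cu: "F \<in> Cu \<Longrightarrow> translate t F \<in> Cu"
  unfolding Cu_def mem_Collect_eq uniformly_continuous_on_def
proof (intro allI impI)
  fix e :: real assume F: "\<forall>e>0. \<exists>d>0. \<forall>x\<in>UNIV. \<forall>y\<in>UNIV. dist y x < d \<longrightarrow> dist (apply_bcontfun F y) (apply_bcontfun F x) < e" and "0 < e"
  then obtain d where d: "0 < d" "\<And>x y. dist y x < d \<Longrightarrow> dist (apply_bcontfun F y) (apply_bcontfun F x) < e" by blast
  have "dist (y - t) (x - t) = dist y x" for x y by (simp add: dist_norm)
  then show "\<exists>d>0. \<forall>x\<in>UNIV. \<forall>y\<in>UNIV. dist y x < d \<longrightarrow> dist (apply_bcontfun (translate t F) y) (apply_bcontfun (translate t F) x) < e"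
    using d by (intro exI[of _ d]) simp
qed

text \<open>The space \<open>Cu\<close> is closed in the complete space of bounded continuous functions, so that relative
  compactness in it is total boundedness.\<close>
lemma translates_totally_bounded_imp:
  assumes F: "F \<in> Cu" and tb: "\<And>e. 0 < e \<Longrightarrow> \<exists>T. finite T \<and> (\<forall>t. \<exists>s\<in>T. dist (translate t F) (translate s F) < e)"
  shows "relatively_compact_in (top_of_set Cu) (range (\<lambda>t. translate t F))"
proof -
  let ?S = "range (\<lambda>t. translate t F)"
  have sub: "?S \<subseteq> Cu" using translate_Cu[OF F] by auto
  have "compact (closure ?S)"
    unfolding compact_eq_totally_bounded complete_eq_closed
  proof (intro conjI allI impI closed_closure)
    fix e :: real assume e: "0 < e"
    then obtain T where T: "finite T" "\<And>t. \<exists>s\<in>T. dist (translate t F) (translate s F) < e / 2"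
      using tb[of "e / 2"] by auto
    have "?S \<subseteq> (\<Union>x\<in>(\<lambda>s. translate s F) ` T. cball x (e / 2))"
    proof
      fix y assume "y \<in> ?S"
      then obtain t where y: "y = translate t F" by auto
      obtain s where "s \<in> T" "dist (translate t F) (translate s F) < e / 2" using T(2) by blast
      then show "y \<in> (\<Union>x\<in>(\<lambda>s. translate s F) ` T. cball x (e / 2))"
        unfolding y by (auto simp: dist_commute intro: less_imp_le)
    qed
    then have "closure ?S \<subseteq> (\<Union>x\<in>(\<lambda>s. translate s F) ` T. cball x (e / 2))"
      by (rule closure_minimal) (use T(1) in \<open>auto intro!: closed_UN\<close>)
    also have "\<dots> \<subseteq> (\<Union>x\<in>(\<lambda>s. translate s F) ` T. ball x e)"
      using e by (intro UN_mono) auto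
    finally show "\<exists>k. finite k \<and> closure ?S \<subseteq> (\<Union>x\<in>k. ball x e)" using T(1) by blast
  qed
  then show ?thesis
    unfolding relatively_compact_in_def closure_of_Cu[OF sub]
    using closure_minimal[OF sub closed_Cu] by (simp add: compactin_subtopology)
qed

lemma translates_totally_bounded:
  assumes F: "F \<in> Cu" and rc: "relatively_compact_in (top_of_set Cu) (range (\<lambda>t. translate t F))" and e: "0 < e"
  shows "\<exists>T. finite T \<and> (\<forall>t. \<exists>s\<in>T. dist (translate t F) (translate s F) < e)"
proof -
  let ?S = "range (\<lambda>t. translate t F)"
  have sub: "?S \<subseteq> Cu" using translate_Cu[OF F] by auto
  have "compact (closure ?S)"
    using rc unfolding relatively_compact_in_def closure_of_Cu[OF sub] by (simp add: compactin_subtopology)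
  moreover have "closure ?S \<subseteq> (\<Union>t\<in>UNIV. ball (translate t F) e)"
  proof
    fix y assume "y \<in> closure ?S"
    then obtain z where "z \<in> ?S" "dist z y < e" using e by (meson closure_approachable)
    then show "y \<in> (\<Union>t\<in>UNIV. ball (translate t F) e)" by auto
  qed
  ultimately obtain T where "finite T" "closure ?S \<subseteq> (\<Union>t\<in>T. ball (translate t F) e)"
    using compactE_image[of "closure ?S" UNIV "\<lambda>t. ball (translate t F) e"] by (metis open_ball)
  show ?thesis
  proof (intro exI[of _ T] conjI allI \<open>finite T\<close>)
    fix t
    have "translate t F \<in> closure ?S" using closure_subset[of ?S] by blast
    then obtain s where "s \<in> T" "translate t F \<in> ball (translate s F) e"
      using \<open>closure ?S \<subseteq> (\<Union>t\<in>T. ball (translate t F) e)\<close> by blast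
    then show "\<exists>s\<in>T. dist (translate t F) (translate s F) < e" by (auto simp: dist_commute)
  qed
qed

lemma finite_representatives:
  assumes "finite (range c)" shows "\<exists>T. finite T \<and> (\<forall>t. \<exists>s\<in>T. c s = c t)"
proof -
  obtain T where T: "finite T" "range c = c ` T"
    using finite_subset_image[OF assms, of c UNIV] by blast
  have "\<exists>s\<in>T. c s = c t" for t
  proof -
    have "c t \<in> c ` T" unfolding T(2)[symmetric] by simp
    then show ?thesis by fastforce
  qed
  with T(1) show ?thesis by blast
qed

text \<open>The values of the finitely many characters are rounded to a grid of mesh \<open>1 / N = e / 2\<close>. As
  only finitely many patterns of rounded values occur, one \<open>t\<close> per pattern suffices.\<close>
lemma characters_totally_bounded:
  fixes F :: "(real^'n::finite) set"
  assumes F: "finite F" and e: "0 < e"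
  shows "\<exists>T. finite T \<and> (\<forall>t. \<exists>s\<in>T. \<forall>k\<in>F. cmod (ee (k \<bullet> t) - ee (k \<bullet> s)) < e)"
proof -
  define N where "N = 2 / e"
  have N: "0 < N" using e by (simp add: N_def)
  define c where "c t = (\<lambda>k\<in>F. (\<lfloor>N * Re (ee (k \<bullet> t))\<rfloor>, \<lfloor>N * Im (ee (k \<bullet> t))\<rfloor>))" for t
  let ?I = "{\<lfloor>- N\<rfloor>..\<lfloor>N\<rfloor>}"
  have rng: "\<lfloor>N * a\<rfloor> \<in> ?I" if "\<bar>a\<bar> \<le> 1" for a
  proof -
    have "- N \<le> N * a" "N * a \<le> N" using that N by (auto simp: abs_le_iff mult_left_le intro: order_trans[OF _ mult_left_mono[of "-1" a N]])
    then show ?thesis by (auto intro: floor_mono)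
  qed
  have "range c \<subseteq> PiE F (\<lambda>_. ?I \<times> ?I)"
    using rng abs_Re_le_cmod[of "ee _"] abs_Im_le_cmod[of "ee _"] by (auto simp: c_def)
  then have "finite (range c)" by (rule finite_subset) (intro finite_PiE F, simp)
  from finite_representatives[OF this] obtain T where T: "finite T" "\<And>t. \<exists>s\<in>T. c s = c t" by blast
  have close: "cmod (ee (k \<bullet> t) - ee (k \<bullet> s)) < e" if cs: "c s = c t" and k: "k \<in> F" for s t k
  proof -
    have fl: "\<bar>a - b\<bar> < 1 / N" if "\<lfloor>N * a\<rfloor> = \<lfloor>N * b\<rfloor>" for a b :: real
    proof -
      have "\<bar>N * a - N * b\<bar> < 1" using that by linarith
      then have "N * \<bar>a - b\<bar> < 1" using N by (simp add: abs_mult right_diff_distrib[symmetric])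
      then show ?thesis using N by (simp add: pos_less_divide_eq mult.commute)
    qed
    have "c s k = c t k" using cs by simp
    then have "\<bar>Re (ee (k \<bullet> t)) - Re (ee (k \<bullet> s))\<bar> < 1 / N" "\<bar>Im (ee (k \<bullet> t)) - Im (ee (k \<bullet> s))\<bar> < 1 / N"
      using k by (auto simp: c_def intro!: fl)
    then have "cmod (ee (k \<bullet> t) - ee (k \<bullet> s)) < 1 / N + 1 / N"
      using cmod_le[of "ee (k \<bullet> t) - ee (k \<bullet> s)"] by simp
    also have "\<dots> = e" by (simp add: N_def)
    finally show ?thesis .
  qed
  have "\<exists>s\<in>T. \<forall>k\<in>F. cmod (ee (k \<bullet> t) - ee (k \<bullet> s)) < e" for t
    using T(2)[of t] close by blast
  with T(1) show ?thesis by blast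
qed

context finite_borel begin

lemma exists_finite_support_approx:
  assumes C: "countable C" and e: "0 < e"
  shows "\<exists>F. finite F \<and> F \<subseteq> C \<and> measure M (C - F) < e"
proof (cases "C = {}")
  case True then show ?thesis using e by auto
next
  case False
  have Cb: "A \<in> sets borel" if "A \<subseteq> C" for A
    by (rule sets.countable[OF _ countable_subset[OF that C]]) simp
  define F where "F n = from_nat_into C ` {..n}" for n
  have FC: "F n \<subseteq> C" for n using from_nat_into[OF False] by (auto simp: F_def)
  have lim: "(\<lambda>n. measure M (C - F n)) \<longlonglongrightarrow> measure M (\<Inter>n. C - F n)"
  proof (rule finite_Lim_measure_decseq)
    show "range (\<lambda>n. C - F n) \<subseteq> sets M" by (auto intro!: Cb)
    show "decseq (\<lambda>n. C - F n)" by (auto simp: decseq_def F_def)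
  qed
  have empty: "(\<Inter>n. C - F n) = {}"
  proof -
    have "x \<in> (\<Union>n. F n)" if x: "x \<in> C" for x
    proof -
      obtain n where "from_nat_into C n = x" using from_nat_into_surj[OF C x] by blast
      then show ?thesis by (auto simp: F_def)
    qed
    then show ?thesis by blast
  qed
  have "(\<lambda>n. measure M (C - F n)) \<longlonglongrightarrow> 0" using lim unfolding empty by simp
  then have "\<forall>\<^sub>F n in sequentially. measure M (C - F n) < e" using e by (rule order_tendstoD)
  then obtain n where "measure M (C - F n) < e" by (auto simp: eventually_sequentially)
  then show ?thesis using FC by (intro exI[of _ "F n"]) (auto simp: F_def)
qed

text \<open>The inverse Fourier--Stieltjes transform as a bounded continuous function.\<close>
definition stieltjes :: "'n cfun \<Rightarrow> ((real^'n) \<Rightarrow>\<^sub>C complex)" where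
  "stieltjes v = transform (\<lambda>f. LINT k|M. f k * v k)"

lemma stieltjes:
  assumes v: "v \<in> bounded_meas"
  shows stieltjes_Cu: "stieltjes v \<in> Cu"
    and apply_stieltjes: "apply_bcontfun (stieltjes v) x = (LINT k|M. ee (k \<bullet> x) * v k)"
  using transform_Cu[OF functional_of_density[OF v]] apply_transform[OF functional_of_density[OF v]]
  by (simp_all add: stieltjes_def character_def)

text \<open>Up to a small mass, \<open>v\<close> is concentrated on finitely many points. On these the translates by \<open>t\<close> and
  \<open>s\<close> differ little as soon as finitely many characters are close at \<open>t\<close> and \<open>s\<close>, and the values of
  finitely many characters are totally bounded.\<close>
theorem pure_point_SAP:
  assumes v: "v \<in> bounded_meas" and C: "countable C" and supp: "\<And>k. k \<notin> C \<Longrightarrow> v k = 0"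
  shows "(\<lambda>x. LINT k|M. ee (k \<bullet> x) * v k) \<in> SAP_fun"
proof -
  let ?G = "stieltjes v"
  obtain V where V: "\<And>k. cmod (v k) \<le> V" using bounded_meas_bound[OF v] by blast
  have V0: "0 \<le> V" using order_trans[OF norm_ge_zero V] .
  have "relatively_compact_in (top_of_set Cu) (range (\<lambda>t. translate t ?G))"
  proof (rule translates_totally_bounded_imp[OF stieltjes_Cu[OF v]])
    fix e :: real assume e: "0 < e"
    \<comment> \<open>Using \<open>V + 1\<close> instead of \<open>V\<close> keeps the denominator positive; the summand \<open>2\<close> accounts for the mass outside \<open>F\<close>.\<close>
    define \<eta> where "\<eta> = e / (2 * (V + 1) * (measure M UNIV + 2))"
    have mp: "0 < 2 * (V + 1) * (measure M UNIV + 2)" using V0 by (simp add: add_nonneg_pos)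
    have \<eta>: "0 < \<eta>" using e mp by (simp add: \<eta>_def)
    obtain F where F: "finite F" "F \<subseteq> C" "measure M (C - F) < \<eta>" using exists_finite_support_approx[OF C \<eta>] by blast
    obtain T where T: "finite T" "\<And>t. \<exists>s\<in>T. \<forall>k\<in>F. cmod (ee (k \<bullet> t) - ee (k \<bullet> s)) < \<eta>"
      using characters_totally_bounded[OF F(1) \<eta>] by blast
    have Cb: "A \<in> sets borel" if "A \<subseteq> C" for A
      by (rule sets.countable[OF _ countable_subset[OF that C]]) simp
    have "\<exists>s\<in>T. dist (translate t ?G) (translate s ?G) < e" for t
    proof -
      obtain s where s: "s \<in> T" "\<And>k. k \<in> F \<Longrightarrow> cmod (ee (k \<bullet> - t) - ee (k \<bullet> - s)) < \<eta>"
      proof -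
        have cn: "cmod (ee (k \<bullet> - t) - ee (k \<bullet> - s)) = cmod (ee (k \<bullet> t) - ee (k \<bullet> s))" for k s
          using complex_mod_cnj[of "ee (k \<bullet> t) - ee (k \<bullet> s)"] by (simp add: cnj_ee)
        show ?thesis using T(2)[of t] that unfolding cn by blast
      qed
      have "dist (translate t ?G) (translate s ?G) \<le> V * (\<eta> * measure M UNIV + 2 * \<eta>)"
      proof (rule dist_bound)
        fix x
        have i: "integrable M (\<lambda>k. ee (k \<bullet> y) * v k)" for y
          using integrable_bounded_meas[OF bounded_meas_mult[OF bounded_meas_character v]] by (simp add: character_def)
        have [measurable]: "F \<in> sets borel" "C - F \<in> sets borel" by (intro Cb F(2) Diff_subset)+
        have bi: "integrable M (\<lambda>k. V * (indicator F k * \<eta> + indicator (C - F) k * 2))"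
          by (intro integrable_mult_right Bochner_Integration.integrable_add integrable_mult_left integrable_real_indicator)
            (auto simp: emeasure_finite less_top[symmetric])
        have "dist (apply_bcontfun (translate t ?G) x) (apply_bcontfun (translate s ?G) x)
            = cmod (LINT k|M. ee (k \<bullet> x) * ((ee (k \<bullet> - t) - ee (k \<bullet> - s)) * v k))"
        proof -
          have "(LINT k|M. ee (k \<bullet> (x - t)) * v k) - (LINT k|M. ee (k \<bullet> (x - s)) * v k)
            = (LINT k|M. ee (k \<bullet> (x - t)) * v k - ee (k \<bullet> (x - s)) * v k)" by (simp add: i)
          also have "\<dots> = (LINT k|M. ee (k \<bullet> x) * ((ee (k \<bullet> - t) - ee (k \<bullet> - s)) * v k))"
            by (intro Bochner_Integration.integral_cong) (auto simp: inner_diff_right ee_diff algebra_simps)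
          finally show ?thesis by (simp add: apply_stieltjes[OF v] dist_norm)
        qed
        also have "\<dots> \<le> (LINT k|M. V * (indicator F k * \<eta> + indicator (C - F) k * 2))"
        proof (rule Bochner_Integration.integral_norm_bound_integral[OF _ bi])
          show "integrable M (\<lambda>k. ee (k \<bullet> x) * ((ee (k \<bullet> - t) - ee (k \<bullet> - s)) * v k))"
            using Bochner_Integration.integrable_diff[OF i[of "x - t"] i[of "x - s"]]
            by (rule Bochner_Integration.integrable_cong[THEN iffD1, rotated 2]) (auto simp: inner_diff_right ee_diff algebra_simps)
          fix k
          show "norm (ee (k \<bullet> x) * ((ee (k \<bullet> - t) - ee (k \<bullet> - s)) * v k)) \<le> V * (indicator F k * \<eta> + indicator (C - F) k * 2)"
          proof (cases "k \<in> F")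
            case True
            have "cmod (ee (k \<bullet> - t) - ee (k \<bullet> - s)) * cmod (v k) \<le> \<eta> * V"
              using s(2)[OF True] V[of k] \<eta> by (intro mult_mono) auto
            then show ?thesis using True by (simp add: norm_mult mult.commute)
          next
            case kF: False
            show ?thesis
            proof (cases "k \<in> C")
              case True
              have "cmod (ee (k \<bullet> - t) - ee (k \<bullet> - s)) \<le> 2" by (rule order_trans[OF norm_triangle_ineq4]) simp
              then have "cmod (ee (k \<bullet> - t) - ee (k \<bullet> - s)) * cmod (v k) \<le> 2 * V"
                using V[of k] by (intro mult_mono) auto
              then show ?thesis using True kF by (simp add: norm_mult mult.commute)
            qed (use kF V0 supp in simp)
          qed
        qed
        also have "\<dots> = V * (\<eta> * measure M F + 2 * measure M (C - F))"
          by (simp add: emeasure_finite less_top[symmetric] mult.commute)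
        also have "\<dots> \<le> V * (\<eta> * measure M UNIV + 2 * \<eta>)"
          using V0 \<eta> F(3) finite_measure_mono[of F UNIV]
          by (intro mult_left_mono add_mono) auto
        finally show "dist (apply_bcontfun (translate t ?G) x) (apply_bcontfun (translate s ?G) x) \<le> V * (\<eta> * measure M UNIV + 2 * \<eta>)" .
      qed
      also have "\<dots> = V * (\<eta> * (measure M UNIV + 2))" by (simp add: algebra_simps)
      also have "\<dots> \<le> (V + 1) * (\<eta> * (measure M UNIV + 2))"
        using \<eta> by (intro mult_right_mono) (auto intro!: mult_nonneg_nonneg add_nonneg_nonneg)
      also have "\<dots> = e / 2"
        unfolding \<eta>_def using mp V0 by (simp add: field_simps)
      also have "\<dots> < e" using e by simp
      finally show ?thesis using s(1) by blast
    qed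
    then show "\<exists>T. finite T \<and> (\<forall>t. \<exists>s\<in>T. dist (translate t ?G) (translate s ?G) < e)" using T(1) by blast
  qed
  then show ?thesis
    unfolding SAP_fun_def using stieltjes[OF v]
    by (intro CollectI exI[of _ ?G]) (auto simp: fun_eq_iff)
qed

end

section \<open>Wiener's lemma: a continuous spectrum has mean zero\<close>

abbreviation cube :: "nat \<Rightarrow> real^'n::finite \<Rightarrow> (real^'n) set" where
  "cube n s \<equiv> cbox (s - vec (real n)) (s + vec (real n))"

text \<open>A bound for the modulus of the average of \<open>ee (a * x)\<close> over an interval of length \<open>2 * n\<close>, whatever
  its centre.\<close>
definition sinc_bound :: "nat \<Rightarrow> real \<Rightarrow> real" where
  "sinc_bound n a = (if a = 0 then 1 else min 1 (1 / (2 * real n * pi * \<bar>a\<bar>)))"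

lemma sinc_bound_range: "0 \<le> sinc_bound n a" "sinc_bound n a \<le> 1"
  by (auto simp: sinc_bound_def)

lemma measurable_sinc_bound [measurable]: "sinc_bound n \<in> borel_measurable borel"
  unfolding sinc_bound_def[abs_def] by measurable

lemma sinc_bound_tendsto: "a \<noteq> 0 \<Longrightarrow> (\<lambda>n. sinc_bound n a) \<longlonglongrightarrow> 0"
proof -
  assume a: "a \<noteq> 0"
  have "(\<lambda>n. inverse (2 * pi * \<bar>a\<bar>) * inverse (real n)) \<longlonglongrightarrow> 0"
    by (rule tendsto_mult_right_zero[OF lim_inverse_n])
  then show ?thesis
  proof (rule Lim_null_comparison[rotated], intro always_eventually allI)
    fix n
    have "norm (sinc_bound n a) = sinc_bound n a" by (simp add: sinc_bound_range)
    also have "\<dots> \<le> 1 / (2 * real n * pi * \<bar>a\<bar>)" unfolding sinc_bound_def if_not_P[OF a] by (rule min.cobounded2)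
    also have "\<dots> = inverse (2 * pi * \<bar>a\<bar>) * inverse (real n)"
      unfolding divide_inverse inverse_mult_distrib by (simp only: mult_1_left mult_ac)
    finally show "norm (sinc_bound n a) \<le> inverse (2 * pi * \<bar>a\<bar>) * inverse (real n)" .
  qed
qed

lemma cmod_integral_ee_interval:
  fixes a s :: real and n :: nat
  assumes n: "0 < n"
  shows "integrable lborel (\<lambda>x. indicator {s - n..s + n} x *\<^sub>R ee (a * x))"
    and "cmod (LINT x|lborel. indicator {s - n..s + n} x *\<^sub>R ee (a * x)) \<le> 2 * n * sinc_bound n a"
proof -
  have ind: "integrable lborel (\<lambda>x. indicator {s - n..s + n} x :: real)" by (rule integrable_real_indicator) auto
  show i: "integrable lborel (\<lambda>x. indicator {s - n..s + n} x *\<^sub>R ee (a * x))"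
    by (rule Bochner_Integration.integrable_bound[OF ind]) (auto split: split_indicator)
  have triv: "cmod (LINT x|lborel. indicator {s - n..s + n} x *\<^sub>R ee (a * x)) \<le> 2 * n"
  proof -
    have "cmod (LINT x|lborel. indicator {s - n..s + n} x *\<^sub>R ee (a * x)) \<le> (LINT x|lborel. indicator {s - n..s + n} x)"
      by (rule Bochner_Integration.integral_norm_bound_integral[OF i ind]) (auto split: split_indicator)
    also have "\<dots> = 2 * n" by simp
    finally show ?thesis .
  qed
  show "cmod (LINT x|lborel. indicator {s - n..s + n} x *\<^sub>R ee (a * x)) \<le> 2 * n * sinc_bound n a"
  proof (cases "a = 0")
    case True then show ?thesis using triv by (simp add: sinc_bound_def)
  next
    case False
    let ?c = "2 * pi * \<i> * a"
    have c: "?c \<noteq> 0" using False by simp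
    have "(LINT x|lborel. indicator {s - n..s + n} x *\<^sub>R ee (a * x)) = ee (a * (s + n)) / ?c - ee (a * (s - n)) / ?c"
    proof (rule integral_FTC_Icc)
      show "((\<lambda>x. ee (a * x) / ?c) has_vector_derivative ee (a * x)) (at x within {s - n..s + n})" for x
      proof -
        have "((\<lambda>x. exp (?c * complex_of_real x) / ?c) has_vector_derivative exp (?c * complex_of_real x)) (at x within {s - n..s + n})"
          using c by (auto intro!: derivative_eq_intros has_vector_derivative_real_field)
        moreover have "exp (?c * complex_of_real x) = ee (a * x)" for x by (simp add: ee_def cis_conv_exp mult_ac)
        ultimately show ?thesis by simp
      qed
      show "continuous_on {s - n..s + n} (\<lambda>x. ee (a * x))"
        by (intro continuous_on_compose2[OF continuous_ee[of UNIV]] continuous_intros) auto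
    qed simp
    then have "cmod (LINT x|lborel. indicator {s - n..s + n} x *\<^sub>R ee (a * x)) \<le> 1 / cmod ?c + 1 / cmod ?c"
      by (simp add: norm_divide order_trans[OF norm_triangle_ineq4])
    also have "\<dots> = 2 * n * (1 / (2 * n * pi * \<bar>a\<bar>))" using n False by (simp add: norm_mult field_simps)
    finally show ?thesis using triv False n by (auto simp: sinc_bound_def min_def)
  qed
qed

definition cube_bound :: "nat \<Rightarrow> real^'n::finite \<Rightarrow> real" where
  "cube_bound n q = (\<Prod>i\<in>UNIV. sinc_bound n (q $ i))"

lemma cube_bound_range: "0 \<le> cube_bound n q" "cube_bound n q \<le> 1"
  unfolding cube_bound_def by (auto intro!: prod_nonneg prod_le_1 simp: sinc_bound_range)

lemma measurable_cube_bound [measurable]: "cube_bound n \<in> borel_measurable borel"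
  unfolding cube_bound_def[abs_def] by measurable

text \<open>The limit is the indicator of the origin, which in a double integral over \<open>k - l\<close> selects the
  diagonal and with it the atoms.\<close>
lemma cube_bound_tendsto:
  fixes q :: "real^'n::finite"
  shows "(\<lambda>n. cube_bound n q) \<longlonglongrightarrow> (if q = 0 then 1 else 0)"
proof (cases "q = 0")
  case True then show ?thesis by (simp add: cube_bound_def sinc_bound_def)
next
  case False
  then obtain i where i: "q $ i \<noteq> 0" by (auto simp: vec_eq_iff)
  have "(\<lambda>n. cube_bound n q) \<longlonglongrightarrow> 0"
  proof (rule Lim_null_comparison[OF _ sinc_bound_tendsto[OF i]], intro always_eventually allI)
    fix n
    have "cube_bound n q = sinc_bound n (q $ i) * (\<Prod>j\<in>UNIV - {i}. sinc_bound n (q $ j))"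
      unfolding cube_bound_def by (rule prod.remove) auto
    also have "\<dots> \<le> sinc_bound n (q $ i) * 1"
      by (intro mult_left_mono prod_le_1) (auto simp: sinc_bound_range)
    finally show "norm (cube_bound n q) \<le> sinc_bound n (q $ i)" by (simp add: cube_bound_range)
  qed
  then show ?thesis using False by simp
qed

lemma ee_sum: "finite A \<Longrightarrow> ee (\<Sum>i\<in>A. f i) = (\<Prod>i\<in>A. ee (f i))"
  by (induction A rule: finite_induct) (simp_all add: ee_add)

lemma cmod_integral_ee_cube:
  fixes q s :: "real^'n::finite"
  assumes n: "0 < n"
  shows "cmod (LINT x|lborel. indicator (cube n s) x *\<^sub>R ee (q \<bullet> x)) \<le> (2 * real n) ^ CARD('n) * cube_bound n q"
proof -
  let ?f = "\<lambda>i t. indicator {s $ i - real n..s $ i + real n} t *\<^sub>R ee (q $ i * t)"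
  have pt: "indicator (cube n s) x *\<^sub>R ee (q \<bullet> x) = (\<Prod>i\<in>UNIV. ?f i (x $ i))" for x
  proof (cases "x \<in> cube n s")
    case True
    then have x: "x $ i \<in> {s $ i - real n..s $ i + real n}" for i by (simp add: mem_box_cart)
    have "(\<Prod>i\<in>UNIV. ?f i (x $ i)) = (\<Prod>i\<in>UNIV. ee (q $ i * x $ i))"
      using x by (intro prod.cong refl) simp
    also have "\<dots> = ee (\<Sum>i\<in>UNIV. q $ i * x $ i)" by (rule ee_sum[symmetric]) simp
    also have "(\<Sum>i\<in>UNIV. q $ i * x $ i) = q \<bullet> x" by (simp add: inner_vec_def)
    finally show ?thesis using True by simp
  next
    case False
    then obtain i where i: "x $ i \<notin> {s $ i - real n..s $ i + real n}" by (auto simp: mem_box_cart)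
    have "(\<Prod>i\<in>UNIV. ?f i (x $ i)) = 0"
      by (rule prod_zero[OF finite bexI[of _ i]]) (use i in simp_all)
    then show ?thesis using False by simp
  qed
  have "(LINT x|lborel. indicator (cube n s) x *\<^sub>R ee (q \<bullet> x)) = (\<Prod>i\<in>UNIV. LINT t|lborel. ?f i t)"
    unfolding pt by (rule integral_lborel_prod) (rule cmod_integral_ee_interval(1)[OF n])
  then have "cmod (LINT x|lborel. indicator (cube n s) x *\<^sub>R ee (q \<bullet> x)) = (\<Prod>i\<in>UNIV. cmod (LINT t|lborel. ?f i t))"
    by (simp only: prod_norm)
  also have "\<dots> \<le> (\<Prod>i\<in>UNIV. 2 * n * sinc_bound n (q $ i))"
    by (intro prod_mono conjI cmod_integral_ee_interval(2)[OF n]) simp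
  also have "\<dots> = (2 * real n) ^ CARD('n) * cube_bound n q"
    by (simp add: cube_bound_def prod.distrib)
  finally show ?thesis .
qed

lemma measure_cube: "measure lborel (cube n (s::real^'n::finite)) = (2 * real n) ^ CARD('n)"
proof -
  have "measure lborel (cube n s) = (\<Prod>b\<in>Basis. ((s + vec (real n)) - (s - vec (real n))) \<bullet> b)"
    by (rule measure_lborel_cbox) (auto simp: Basis_real_vec inner_axis)
  also have "\<dots> = (\<Prod>b\<in>(Basis :: (real^'n) set). 2 * real n)"
    by (intro prod.cong) (auto simp: Basis_real_vec inner_axis)
  finally show ?thesis by simp
qed

lemma integrable_cube: "integrable lborel (\<lambda>x. indicator (cube n (s::real^'n::finite)) x :: real)"
  by (rule integrable_real_indicator) (simp, rule emeasure_bounded_finite, rule bounded_cbox)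

context finite_borel begin

text \<open>With \<open>g\<close> the transform of \<open>v\<close>, the square is \<open>g x * cnj (g x)\<close>. Expanding both factors as integrals over
  \<open>M\<close>, in the variables \<open>k\<close> and \<open>l\<close>, and integrating over the cube first leaves the integral of
  \<open>ee ((k - l) \<bullet> x)\<close> over the cube, which is bounded independently of its centre. The two
  factors are expanded one after the other, so that each exchange is dominated by a product.\<close>
lemma integral_square_cube_le:
  assumes v: "v \<in> bounded_meas" and V: "\<And>k. cmod (v k) \<le> V" and n: "0 < n"
  shows "(LINT x|lborel. indicator (cube n s) x * (cmod (LINT k|M. ee (k \<bullet> x) * v k))\<^sup>2)
    \<le> (2 * real n) ^ CARD('n) * (V\<^sup>2 * (LINT l|M. LINT k|M. cube_bound n (k - l)))"
proof -
  let ?d = "CARD('n)" and ?Q = "cube n s"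
  have sf: "sigma_finite_measure M" by standard
  have sfL: "sigma_finite_measure (lborel :: (real^'n) measure)" by (rule sigma_finite_lborel)
  have V0: "0 \<le> V" using order_trans[OF norm_ge_zero V] .
  note [measurable] = bounded_meas_measurable[OF v]
  define g where "g x = (LINT k|M. ee (k \<bullet> x) * v k)" for x
  have gG: "g x = apply_bcontfun (stieltjes v) x" for x by (simp add: g_def apply_stieltjes[OF v])
  have "g = apply_bcontfun (stieltjes v)" by (rule ext) (rule gG)
  then have [measurable]: "g \<in> borel_measurable borel"
    by (simp add: borel_measurable_continuous_onI continuous_on_apply_bcontfun)
  define B where "B = norm (stieltjes v)"
  have gB: "cmod (g x) \<le> B" for x unfolding gG B_def by (rule norm_bounded)
  have B0: "0 \<le> B" by (simp add: B_def)
  have vi: "integrable M (\<lambda>k. V)" by simp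
  have bi: "integrable lborel (\<lambda>x. indicator ?Q x * B)" by (intro integrable_mult_left integrable_cube)
  \<comment> \<open>The first expansion: \<open>g x\<close> as an integral over \<open>k\<close>.\<close>
  have inner: "(LINT x|lborel. (indicator ?Q x *\<^sub>R g x) * ee (- (l \<bullet> x))) = (LINT k|M. v k * (LINT x|lborel. indicator ?Q x *\<^sub>R ee ((k - l) \<bullet> x)))" for l
  proof -
    have "(LINT x|lborel. (indicator ?Q x *\<^sub>R g x) * ee (- (l \<bullet> x))) = (LINT x|lborel. LINT k|M. indicator ?Q x *\<^sub>R (ee ((k - l) \<bullet> x) * v k))"
    proof (rule Bochner_Integration.integral_cong[OF refl])
      fix x :: "real^'n"
      have "(LINT k|M. indicator ?Q x *\<^sub>R (ee ((k - l) \<bullet> x) * v k)) = (LINT k|M. (indicator ?Q x *\<^sub>R ee (- (l \<bullet> x))) * (ee (k \<bullet> x) * v k))"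
        by (intro Bochner_Integration.integral_cong) (auto simp: inner_diff_left ee_diff)
      also have "\<dots> = (indicator ?Q x *\<^sub>R ee (- (l \<bullet> x))) * g x" by (simp add: g_def del: mult_scaleR_left)
      finally have E: "(LINT k|M. indicator ?Q x *\<^sub>R (ee ((k - l) \<bullet> x) * v k)) = (indicator ?Q x *\<^sub>R ee (- (l \<bullet> x))) * g x" .
      show "(indicator ?Q x *\<^sub>R g x) * ee (- (l \<bullet> x)) = (LINT k|M. indicator ?Q x *\<^sub>R (ee ((k - l) \<bullet> x) * v k))"
        unfolding E by (simp add: mult.commute)
    qed
    also have "\<dots> = (LINT k|M. LINT x|lborel. indicator ?Q x *\<^sub>R (ee ((k - l) \<bullet> x) * v k))"
      by (rule Fubini_dominated[OF sfL sf _ integrable_cube[of s n] vi]) (auto simp: norm_mult V V0 split: split_indicator)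
    also have "\<dots> = (LINT k|M. v k * (LINT x|lborel. indicator ?Q x *\<^sub>R ee ((k - l) \<bullet> x)))"
    proof (rule Bochner_Integration.integral_cong[OF refl])
      fix k
      have "(LINT x|lborel. indicator ?Q x *\<^sub>R (ee ((k - l) \<bullet> x) * v k)) = (LINT x|lborel. v k * (indicator ?Q x *\<^sub>R ee ((k - l) \<bullet> x)))"
        by (intro Bochner_Integration.integral_cong) auto
      then show "(LINT x|lborel. indicator ?Q x *\<^sub>R (ee ((k - l) \<bullet> x) * v k)) = v k * (LINT x|lborel. indicator ?Q x *\<^sub>R ee ((k - l) \<bullet> x))"
        by (simp only: integral_mult_right_zero)
    qed
    finally show ?thesis .
  qed
  have Dm: "(\<lambda>(l, k). cube_bound n (k - l)) \<in> borel_measurable (M \<Otimes>\<^sub>M M)" by measurable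
  have Di: "integrable M (\<lambda>k. cube_bound n (k - l))" for l
    by (rule integrable_const_bound[of _ 1]) (auto simp: cube_bound_range)
  interpret sigma_finite_measure M by (rule sf)
  have Dl: "(\<lambda>l. LINT k|M. cube_bound n (k - l)) \<in> borel_measurable M"
    by (rule borel_measurable_lebesgue_integral) measurable
  have Dle: "\<bar>LINT k|M. cube_bound n (k - l)\<bar> \<le> measure M UNIV" for l
  proof -
    have "(LINT k|M. cube_bound n (k - l)) \<le> (LINT k|M. 1)"
      by (intro Bochner_Integration.integral_mono Di) (auto simp: cube_bound_range)
    moreover have "0 \<le> (LINT k|M. cube_bound n (k - l))" by (intro Bochner_Integration.integral_nonneg) (simp add: cube_bound_range)
    ultimately show ?thesis by simp
  qed
  have Dli: "integrable M (\<lambda>l. LINT k|M. cube_bound n (k - l))"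
    by (rule integrable_const_bound[OF _ Dl, of "measure M UNIV"]) (auto simp: Dle)
  have Dnn: "0 \<le> (LINT k|M. cube_bound n (k - l))" for l
    by (intro Bochner_Integration.integral_nonneg) (simp add: cube_bound_range)
  have inner_le: "cmod (LINT x|lborel. (indicator ?Q x *\<^sub>R g x) * ee (- (l \<bullet> x))) \<le> V * (2 * real n) ^ ?d * (LINT k|M. cube_bound n (k - l))" for l
  proof -
    have "cmod (LINT k|M. v k * (LINT x|lborel. indicator ?Q x *\<^sub>R ee ((k - l) \<bullet> x))) \<le> (LINT k|M. V * (2 * real n) ^ ?d * cube_bound n (k - l))"
    proof (rule integral_norm_bound[THEN order_trans], rule integral_mono_AE')
      show "integrable M (\<lambda>k. V * (2 * real n) ^ ?d * cube_bound n (k - l))" using Di by simp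
      show "AE k in M. norm (v k * (LINT x|lborel. indicator ?Q x *\<^sub>R ee ((k - l) \<bullet> x))) \<le> V * (2 * real n) ^ ?d * cube_bound n (k - l)"
        unfolding norm_mult mult.assoc by (intro AE_I2 mult_mono V V0 cmod_integral_ee_cube n) simp
    qed (simp add: V0 cube_bound_range)
    then show ?thesis unfolding inner by simp
  qed
  \<comment> \<open>The second expansion: \<open>cnj (g x)\<close> as an integral over \<open>l\<close>.\<close>
  have "complex_of_real (LINT x|lborel. indicator ?Q x * (cmod (g x))\<^sup>2) = (LINT x|lborel. LINT l|M. ((indicator ?Q x *\<^sub>R g x) * ee (- (l \<bullet> x))) * cnj (v l))"
  proof -
    have "complex_of_real (LINT x|lborel. indicator ?Q x * (cmod (g x))\<^sup>2) = (LINT x|lborel. complex_of_real (indicator ?Q x * (cmod (g x))\<^sup>2))"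
      by (rule integral_complex_of_real[symmetric])
    also have "\<dots> = (LINT x|lborel. LINT l|M. ((indicator ?Q x *\<^sub>R g x) * ee (- (l \<bullet> x))) * cnj (v l))"
    proof (rule Bochner_Integration.integral_cong[OF refl])
      fix x :: "real^'n"
      have "cnj (g x) = (LINT l|M. cnj (ee (l \<bullet> x) * v l))" unfolding g_def by (rule Bochner_Integration.integral_cnj[symmetric])
      also have "\<dots> = (LINT l|M. ee (- (l \<bullet> x)) * cnj (v l))" by (simp add: cnj_ee)
      finally have "complex_of_real (indicator ?Q x * (cmod (g x))\<^sup>2) = (indicator ?Q x *\<^sub>R g x) * (LINT l|M. ee (- (l \<bullet> x)) * cnj (v l))"
        by (simp add: complex_norm_square scaleR_conv_of_real del: of_real_power)
      also have "\<dots> = (LINT l|M. (indicator ?Q x *\<^sub>R g x) * (ee (- (l \<bullet> x)) * cnj (v l)))" by (rule integral_mult_right_zero[symmetric])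
      finally show "complex_of_real (indicator ?Q x * (cmod (g x))\<^sup>2) = (LINT l|M. ((indicator ?Q x *\<^sub>R g x) * ee (- (l \<bullet> x))) * cnj (v l))"
        by (simp only: mult.assoc)
    qed
    finally show ?thesis .
  qed
  also have "\<dots> = (LINT l|M. LINT x|lborel. ((indicator ?Q x *\<^sub>R g x) * ee (- (l \<bullet> x))) * cnj (v l))"
  proof (rule Fubini_dominated[OF sfL sf _ bi vi])
    have [measurable]: "(\<lambda>l. cnj (v l)) \<in> borel_measurable borel" by (rule bounded_meas_measurable[OF bounded_meas_cnj[OF v]])
    show "case_prod (\<lambda>x l. ((indicator ?Q x *\<^sub>R g x) * ee (- (l \<bullet> x))) * cnj (v l)) \<in> borel_measurable (lborel \<Otimes>\<^sub>M M)" by measurable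
    show "norm (((indicator ?Q x *\<^sub>R g x) * ee (- (l \<bullet> x))) * cnj (v l)) \<le> (indicator ?Q x * B) * V" for x l
      by (auto simp: norm_mult intro!: mult_mono gB V V0 B0 split: split_indicator)
  qed
  also have "\<dots> = (LINT l|M. (LINT x|lborel. (indicator ?Q x *\<^sub>R g x) * ee (- (l \<bullet> x))) * cnj (v l))" by (simp only: integral_mult_left_zero)
  finally have eq: "complex_of_real (LINT x|lborel. indicator ?Q x * (cmod (g x))\<^sup>2) = (LINT l|M. (LINT x|lborel. (indicator ?Q x *\<^sub>R g x) * ee (- (l \<bullet> x))) * cnj (v l))" .
  have "(LINT x|lborel. indicator ?Q x * (cmod (g x))\<^sup>2) \<le> cmod (complex_of_real (LINT x|lborel. indicator ?Q x * (cmod (g x))\<^sup>2))" by simp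
  also have "\<dots> \<le> (LINT l|M. (V * (2 * real n) ^ ?d * (LINT k|M. cube_bound n (k - l))) * V)"
    unfolding eq
  proof (rule integral_norm_bound[THEN order_trans], rule integral_mono_AE')
    show "integrable M (\<lambda>l. (V * (2 * real n) ^ ?d * (LINT k|M. cube_bound n (k - l))) * V)" using Dli by simp
    show "AE l in M. norm ((LINT x|lborel. (indicator ?Q x *\<^sub>R g x) * ee (- (l \<bullet> x))) * cnj (v l)) \<le> (V * (2 * real n) ^ ?d * (LINT k|M. cube_bound n (k - l))) * V"
    proof (rule AE_I2)
      fix l
      show "norm ((LINT x|lborel. (indicator ?Q x *\<^sub>R g x) * ee (- (l \<bullet> x))) * cnj (v l)) \<le> (V * (2 * real n) ^ ?d * (LINT k|M. cube_bound n (k - l))) * V"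
        unfolding norm_mult complex_mod_cnj
        by (intro mult_mono inner_le V order_trans[OF norm_ge_zero inner_le]) simp
    qed
  qed (simp add: V0 Dnn)
  also have "\<dots> = (2 * real n) ^ ?d * (V\<^sup>2 * (LINT l|M. LINT k|M. cube_bound n (k - l)))" by (simp add: power2_eq_square mult_ac)
  finally show ?thesis unfolding g_def .
qed

text \<open>Dominated convergence in \<open>k\<close> gives the mass of \<open>{l}\<close>, which is \<open>0\<close>; dominated convergence in \<open>l\<close>
  finishes.\<close>
lemma double_cube_bound_tendsto:
  assumes no_atom: "\<And>k. emeasure M {k} = 0"
  shows "(\<lambda>n. LINT l|M. LINT k|M. cube_bound n (k - l)) \<longlonglongrightarrow> 0"
proof -
  interpret sigma_finite_measure M by standard
  have inner: "(\<lambda>n. LINT k|M. cube_bound n (k - l)) \<longlonglongrightarrow> 0" for l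
  proof -
    have "(\<lambda>n. LINT k|M. cube_bound n (k - l)) \<longlonglongrightarrow> (LINT k|M. indicator {l} k)"
    proof (rule integral_dominated_convergence[where w="\<lambda>_. 1"])
      show "AE k in M. (\<lambda>n. cube_bound n (k - l)) \<longlonglongrightarrow> indicator {l} k"
      proof (rule AE_I2)
        fix k show "(\<lambda>n. cube_bound n (k - l)) \<longlonglongrightarrow> indicator {l} k"
          using cube_bound_tendsto[of "k - l"] by (cases "k = l") simp_all
      qed
    qed (auto simp: cube_bound_range)
    moreover have "(LINT k|M. indicator {l} k) = (0::real)" using no_atom by (simp add: measure_def)
    ultimately show ?thesis by simp
  qed
  have le: "\<bar>LINT k|M. cube_bound n (k - l)\<bar> \<le> measure M UNIV" for n l
  proof -
    have "(LINT k|M. cube_bound n (k - l)) \<le> (LINT k|M. 1)"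
      by (intro Bochner_Integration.integral_mono integrable_const_bound[of _ 1]) (auto simp: cube_bound_range)
    moreover have "0 \<le> (LINT k|M. cube_bound n (k - l))" by (intro Bochner_Integration.integral_nonneg) (simp add: cube_bound_range)
    ultimately show ?thesis by simp
  qed
  have "(\<lambda>n. LINT l|M. LINT k|M. cube_bound n (k - l)) \<longlonglongrightarrow> (LINT l|M. 0)"
  proof (rule integral_dominated_convergence[where w="\<lambda>_. measure M UNIV"])
    show "(\<lambda>l. LINT k|M. cube_bound n (k - l)) \<in> borel_measurable M" for n
      by (rule borel_measurable_lebesgue_integral) measurable
  qed (auto simp: inner le)
  then show ?thesis by simp
qed

text \<open>The mean of the square tends to \<open>0\<close> uniformly in the centre of the cube. The inequality
  \<open>a \<le> e / 2 + a\<^sup>2 / (2 * e)\<close> carries this over to the mean of the modulus.\<close>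
theorem no_atoms_has_mean_0:
  assumes v: "v \<in> bounded_meas" and no_atom: "\<And>k. emeasure M {k} = 0"
  shows "has_mean (\<lambda>x. cmod (LINT k|M. ee (k \<bullet> x) * v k)) 0"
  unfolding has_mean_def
proof (rule uniform_limitI)
  fix e :: real assume e: "0 < e"
  obtain V where V: "\<And>k. cmod (v k) \<le> V" using bounded_meas_bound[OF v] by blast
  let ?g = "\<lambda>x. LINT k|M. ee (k \<bullet> x) * v k"
  have gG: "?g = apply_bcontfun (stieltjes v)" by (rule ext) (simp add: apply_stieltjes[OF v])
  then have gm [measurable]: "?g \<in> borel_measurable borel"
    by (simp add: borel_measurable_continuous_onI continuous_on_apply_bcontfun)
  have gB: "cmod (?g x) \<le> norm (stieltjes v)" for x
    using norm_bounded[of "stieltjes v" x] by (simp add: apply_stieltjes[OF v])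
  let ?D = "\<lambda>n. LINT l|M. LINT k|M. cube_bound n (k - l)"
  have "(\<lambda>n. V\<^sup>2 * ?D n) \<longlonglongrightarrow> 0" by (rule tendsto_mult_right_zero[OF double_cube_bound_tendsto[OF no_atom]])
  then have "\<forall>\<^sub>F n in sequentially. V\<^sup>2 * ?D n < e\<^sup>2" using e by (intro order_tendstoD) auto
  then show "\<forall>\<^sub>F n in sequentially. \<forall>s\<in>UNIV. dist ((LINT x:cube n s|lborel. cmod (?g x)) / (2 * real n) ^ CARD('n)) 0 < e"
    using eventually_gt_at_top[of 0]
  proof eventually_elim
    case (elim n)
    show ?case
    proof
      fix s :: "real^'n"
      let ?L = "(2 * real n) ^ CARD('n)"
      have L: "0 < ?L" using elim by simp
      have i2: "integrable lborel (\<lambda>x. indicator (cube n s) x * (cmod (?g x))\<^sup>2)"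
      proof (rule Bochner_Integration.integrable_bound[OF integrable_mult_left[OF integrable_cube[of s n], of "(norm (stieltjes v))\<^sup>2"]])
        show "AE x in lborel. norm (indicator (cube n s) x * (cmod (?g x))\<^sup>2) \<le> norm (indicator (cube n s) x * (norm (stieltjes v))\<^sup>2)"
          by (intro AE_I2) (auto intro!: power_mono gB split: split_indicator)
      qed measurable
      have "(LINT x:cube n s|lborel. cmod (?g x)) \<le> (LINT x|lborel. e / 2 * indicator (cube n s) x + 1 / (2 * e) * (indicator (cube n s) x * (cmod (?g x))\<^sup>2))"
        unfolding set_lebesgue_integral_def
      proof (rule integral_mono_AE')
        show "integrable lborel (\<lambda>x. e / 2 * indicator (cube n s) x + 1 / (2 * e) * (indicator (cube n s) x * (cmod (?g x))\<^sup>2))"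
          by (intro Bochner_Integration.integrable_add integrable_mult_right integrable_cube i2)
        show "AE x in lborel. indicator (cube n s) x *\<^sub>R cmod (?g x) \<le> e / 2 * indicator (cube n s) x + 1 / (2 * e) * (indicator (cube n s) x * (cmod (?g x))\<^sup>2)"
        proof (rule AE_I2)
          fix x
          have "0 \<le> (cmod (?g x) - e)\<^sup>2" by simp
          then have "2 * e * cmod (?g x) \<le> e\<^sup>2 + (cmod (?g x))\<^sup>2" by (simp add: power2_diff algebra_simps)
          then have "cmod (?g x) \<le> e / 2 + 1 / (2 * e) * (cmod (?g x))\<^sup>2"
            using e by (simp add: field_simps power2_eq_square)
          then show "indicator (cube n s) x *\<^sub>R cmod (?g x) \<le> e / 2 * indicator (cube n s) x + 1 / (2 * e) * (indicator (cube n s) x * (cmod (?g x))\<^sup>2)"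
            by (auto split: split_indicator)
        qed
        show "AE x in lborel. 0 \<le> e / 2 * indicator (cube n s) x + 1 / (2 * e) * (indicator (cube n s) x * (cmod (?g x))\<^sup>2)"
          using e by (intro AE_I2) auto
      qed
      also have "\<dots> = e / 2 * ?L + 1 / (2 * e) * (LINT x|lborel. indicator (cube n s) x * (cmod (?g x))\<^sup>2)"
        using integrable_cube[of s n] i2
        by (subst Bochner_Integration.integral_add) (auto simp: measure_cube)
      also have "\<dots> \<le> e / 2 * ?L + 1 / (2 * e) * (?L * (V\<^sup>2 * ?D n))"
        using e integral_square_cube_le[OF v V, of n s] elim by (intro add_left_mono mult_left_mono) auto
      also have "\<dots> = (e / 2 + 1 / (2 * e) * (V\<^sup>2 * ?D n)) * ?L" by (simp add: algebra_simps)
      also have "\<dots> < e * ?L"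
      proof (rule mult_strict_right_mono[OF _ L])
        have "1 / (2 * e) * (V\<^sup>2 * ?D n) < 1 / (2 * e) * e\<^sup>2" using elim(1) e by (intro mult_strict_left_mono) auto
        also have "\<dots> = e / 2" using e by (simp add: power2_eq_square)
        finally show "e / 2 + 1 / (2 * e) * (V\<^sup>2 * ?D n) < e" by simp
      qed
      finally have "(LINT x:cube n s|lborel. cmod (?g x)) / ?L < e" using L by (simp add: pos_divide_less_eq)
      moreover have "0 \<le> (LINT x:cube n s|lborel. cmod (?g x))"
        unfolding set_lebesgue_integral_def by (intro Bochner_Integration.integral_nonneg) simp
      ultimately show "dist ((LINT x:cube n s|lborel. cmod (?g x)) / ?L) 0 < e" using L by simp
    qed
  qed
qed

end

section \<open>Uniqueness of the Eberlein decomposition\<close>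

lemma integrable_cube_bcontfun:
  fixes F :: "(real^'n::finite) \<Rightarrow>\<^sub>C complex"
  shows "integrable lborel (\<lambda>x. indicator (cube n s) x * cmod (apply_bcontfun F x))"
proof (rule Bochner_Integration.integrable_bound[OF integrable_mult_left[OF integrable_cube[of s n], of "norm F"]])
  have [measurable]: "apply_bcontfun F \<in> borel_measurable borel"
    by (simp add: borel_measurable_continuous_onI continuous_on_apply_bcontfun)
  show "(\<lambda>x. indicator (cube n s) x * cmod (apply_bcontfun F x)) \<in> borel_measurable lborel" by measurable
  show "AE x in lborel. norm (indicator (cube n s) x * cmod (apply_bcontfun F x)) \<le> norm (indicator (cube n s) x * norm F)"
    by (intro AE_I2) (auto simp: norm_bounded split: split_indicator)
qed

text \<open>Let \<open>cmod (H x0) = e > 0\<close>. Total boundedness of the translates of \<open>A\<close> and \<open>B\<close> provides a finite set \<open>T\<close>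
  such that for each \<open>t\<close> the translates of \<open>H\<close> by \<open>t\<close> and by some \<open>s \<in> T\<close> differ by at most \<open>e / 2\<close>;
  hence the functions \<open>\<lambda>x. cmod (H (x0 + s + x))\<close> with \<open>s \<in> T\<close> sum to at least \<open>e / 2\<close> everywhere.
  Over a large cube, however, the average of each of them is small, because the means of \<open>C\<close> and \<open>D\<close>
  vanish uniformly in the centre of the cube. Two differences describe \<open>H\<close> because
  two decompositions of one distribution are to be compared.\<close>
lemma almost_periodic_mean_zero:
  fixes H A B C D :: "(real^'n::finite) \<Rightarrow>\<^sub>C complex"
  assumes A: "A \<in> Cu" "relatively_compact_in (top_of_set Cu) (range (\<lambda>t. translate t A))"
    and B: "B \<in> Cu" "relatively_compact_in (top_of_set Cu) (range (\<lambda>t. translate t B))"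
    and C: "has_mean (\<lambda>x. cmod (apply_bcontfun C x)) 0" and D: "has_mean (\<lambda>x. cmod (apply_bcontfun D x)) 0"
    and AB: "\<And>x. apply_bcontfun H x = apply_bcontfun A x - apply_bcontfun B x"
    and CD: "\<And>x. apply_bcontfun H x = apply_bcontfun C x - apply_bcontfun D x"
  shows "apply_bcontfun H x0 = 0"
proof (rule ccontr)
  let ?h = "apply_bcontfun H"
  assume "?h x0 \<noteq> 0"
  define e where "e = cmod (?h x0)"
  have e: "0 < e" using \<open>?h x0 \<noteq> 0\<close> by (simp add: e_def)
  then have e8: "0 < e / 8" by simp
  obtain TA where TA: "finite TA" "\<And>t. \<exists>s\<in>TA. dist (translate t A) (translate s A) < e / 8"
    using translates_totally_bounded[OF A e8] by blast
  obtain TB where TB: "finite TB" "\<And>t. \<exists>s\<in>TB. dist (translate t B) (translate s B) < e / 8"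
    using translates_totally_bounded[OF B e8] by blast
  obtain ca where ca: "\<And>t. ca t \<in> TA" "\<And>t. dist (translate t A) (translate (ca t) A) < e / 8" using TA(2) by metis
  obtain cb where cb: "\<And>t. cb t \<in> TB" "\<And>t. dist (translate t B) (translate (cb t) B) < e / 8" using TB(2) by metis
  have "range (\<lambda>t. (ca t, cb t)) \<subseteq> TA \<times> TB" using ca cb by auto
  then have "finite (range (\<lambda>t. (ca t, cb t)))" using TA(1) TB(1) by (meson finite_SigmaI finite_subset)
  from finite_representatives[OF this]
  obtain T where T: "finite T" "\<And>t. \<exists>s\<in>T. (ca s, cb s) = (ca t, cb t)" by blast
  \<comment> \<open>The translates of \<open>A\<close>, and of \<open>B\<close>, by \<open>s\<close> and \<open>t\<close> are close if they have the same representatives.\<close>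
  have cover: "\<exists>s\<in>T. e / 2 \<le> cmod (?h (x0 + s - t))" for t
  proof -
    obtain s where s: "s \<in> T" "ca s = ca t" "cb s = cb t" using T(2)[of t] by auto
    have "dist (translate s A) (translate t A) < e / 8 + e / 8"
      using ca(2)[of t] ca(2)[of s] dist_triangle[of "translate s A" "translate t A" "translate (ca s) A"] s(2)
      by (simp add: dist_commute)
    then have a: "cmod (apply_bcontfun A (x0 + s - s) - apply_bcontfun A (x0 + s - t)) < e / 8 + e / 8"
      using dist_bounded[of "translate s A" "x0 + s" "translate t A"] by (simp add: dist_norm)
    have "dist (translate s B) (translate t B) < e / 8 + e / 8"
      using cb(2)[of t] cb(2)[of s] dist_triangle[of "translate s B" "translate t B" "translate (cb s) B"] s(3)
      by (simp add: dist_commute)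
    then have b: "cmod (apply_bcontfun B (x0 + s - s) - apply_bcontfun B (x0 + s - t)) < e / 8 + e / 8"
      using dist_bounded[of "translate s B" "x0 + s" "translate t B"] by (simp add: dist_norm)
    have "cmod (?h x0 - ?h (x0 + s - t)) \<le> cmod (apply_bcontfun A (x0 + s - s) - apply_bcontfun A (x0 + s - t))
       + cmod (apply_bcontfun B (x0 + s - s) - apply_bcontfun B (x0 + s - t))"
    proof -
      have "?h x0 - ?h (x0 + s - t) = (apply_bcontfun A (x0 + s - s) - apply_bcontfun A (x0 + s - t))
        - (apply_bcontfun B (x0 + s - s) - apply_bcontfun B (x0 + s - t))" by (simp add: AB)
      then show ?thesis using norm_triangle_ineq4 by metis
    qed
    also have "\<dots> \<le> e / 2" using a b by simp
    finally have "cmod (?h x0 - ?h (x0 + s - t)) \<le> e / 2" .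
    then have "e / 2 \<le> cmod (?h (x0 + s - t))"
      using norm_triangle_ineq2[of "?h x0" "?h (x0 + s - t)"] by (simp add: e_def)
    then show ?thesis using s(1) by blast
  qed
  have ne: "T \<noteq> {}" using T(2) by blast
  \<comment> \<open>Each of the \<open>card T\<close> shifts has average at most \<open>2 * r\<close>, in total \<open>e / 4 < e / 2\<close>.\<close>
  define r where "r = e / (8 * card T)"
  have cT: "0 < card T" using T(1) ne by (simp add: card_gt_0_iff)
  then have r: "0 < r" using e by (simp add: r_def)
  let ?avg = "\<lambda>F n s. (LINT x:cube n s|lborel. cmod (apply_bcontfun F x)) / (2 * real n) ^ CARD('n)"
  have "\<forall>\<^sub>F n in sequentially. \<forall>s\<in>UNIV. dist (?avg C n s) 0 < r"
    using uniform_limitD[OF C[unfolded has_mean_def] r] .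
  moreover have "\<forall>\<^sub>F n in sequentially. \<forall>s\<in>UNIV. dist (?avg D n s) 0 < r"
    using uniform_limitD[OF D[unfolded has_mean_def] r] .
  moreover have "\<forall>\<^sub>F n :: nat in sequentially. 0 < n" by (rule eventually_gt_at_top)
  ultimately have "\<forall>\<^sub>F n in sequentially. (\<forall>s\<in>UNIV. dist (?avg C n s) 0 < r) \<and> (\<forall>s\<in>UNIV. dist (?avg D n s) 0 < r) \<and> 0 < n"
    by eventually_elim auto
  then obtain n where n: "\<And>s. dist (?avg C n s) 0 < r" "\<And>s. dist (?avg D n s) 0 < r" "0 < n"
    by (auto simp: eventually_sequentially)
  let ?L = "(2 * real n) ^ CARD('n)"
  have L: "0 < ?L" using n(3) by simp
  have small: "(LINT x|lborel. indicator (cube n s) x * cmod (?h x)) \<le> 2 * r * ?L" for s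
  proof -
    have "(LINT x|lborel. indicator (cube n s) x * cmod (?h x))
      \<le> (LINT x|lborel. indicator (cube n s) x * cmod (apply_bcontfun C x) + indicator (cube n s) x * cmod (apply_bcontfun D x))"
      by (intro Bochner_Integration.integral_mono Bochner_Integration.integrable_add integrable_cube_bcontfun)
        (auto simp: CD norm_triangle_ineq4 split: split_indicator)
    also have "\<dots> = (LINT x:cube n s|lborel. cmod (apply_bcontfun C x)) + (LINT x:cube n s|lborel. cmod (apply_bcontfun D x))"
      by (simp add: set_lebesgue_integral_def integrable_cube_bcontfun)
    also have "\<dots> \<le> r * ?L + r * ?L"
    proof (intro add_mono)
      have le: "I \<le> r * ?L" if "dist (I / ?L) 0 < r" for I :: real
      proof -
        have "I / ?L < r" using that unfolding dist_real_def diff_0_right by linarith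
        then show ?thesis using L by (simp add: pos_divide_less_eq less_imp_le)
      qed
      show "(LINT x:cube n s|lborel. cmod (apply_bcontfun C x)) \<le> r * ?L" by (rule le[OF n(1)])
      show "(LINT x:cube n s|lborel. cmod (apply_bcontfun D x)) \<le> r * ?L" by (rule le[OF n(2)])
    qed
    also have "\<dots> = 2 * r * ?L" by (simp only: mult_2[symmetric] mult.assoc)
    finally show ?thesis .
  qed
  have [measurable]: "?h \<in> borel_measurable borel"
    by (simp add: borel_measurable_continuous_onI continuous_on_apply_bcontfun)
  have shift: "(LINT x|lborel. indicator (cube n 0) x * cmod (?h (p + x))) = (LINT x|lborel. indicator (cube n p) x * cmod (?h x))"
    and shift_int: "integrable lborel (\<lambda>x. indicator (cube n 0) x * cmod (?h (p + x)))" for p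
  proof -
    let ?f = "\<lambda>x. indicator (cube n p) x * cmod (?h x)"
    have f: "?f \<in> borel_measurable borel" by measurable
    have eq: "?f (p + 1 *\<^sub>R x) = indicator (cube n 0) x * cmod (?h (p + x))" for x
      by (auto simp: mem_box_cart split: split_indicator)
    show "integrable lborel (\<lambda>x. indicator (cube n 0) x * cmod (?h (p + x)))"
      using integrable_lborel_affine[OF f, of 1 p] integrable_cube_bcontfun[of p n H] unfolding eq by simp
    show "(LINT x|lborel. indicator (cube n 0) x * cmod (?h (p + x))) = (LINT x|lborel. ?f x)"
      using integral_lborel_affine[OF f, of 1 p] unfolding eq by simp
  qed
  have "e / 2 * ?L = (LINT x|lborel. indicator (cube n (0::real^'n)) x * (e / 2))"
    using measure_cube[of "0::real^'n" n] by (simp add: mult.commute)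
  also have "\<dots> \<le> (LINT x|lborel. (\<Sum>s\<in>T. indicator (cube n 0) x * cmod (?h ((x0 + s) + x))))"
  proof (intro Bochner_Integration.integral_mono Bochner_Integration.integrable_sum shift_int integrable_mult_left integrable_cube)
    fix x
    obtain s where s: "s \<in> T" "e / 2 \<le> cmod (?h (x0 + s - (- x)))" using cover[of "- x"] by blast
    have "indicator (cube n 0) x * (e / 2) \<le> indicator (cube n 0) x * cmod (?h ((x0 + s) + x))"
      using s(2) by (intro mult_left_mono) auto
    also have "\<dots> \<le> (\<Sum>s\<in>T. indicator (cube n 0) x * cmod (?h ((x0 + s) + x)))"
      by (rule member_le_sum[OF s(1) _ T(1)]) auto
    finally show "indicator (cube n 0) x * (e / 2) \<le> (\<Sum>s\<in>T. indicator (cube n 0) x * cmod (?h ((x0 + s) + x)))" .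
  qed
  also have "\<dots> = (\<Sum>s\<in>T. LINT x|lborel. indicator (cube n (x0 + s)) x * cmod (?h x))"
    unfolding shift[symmetric] by (rule Bochner_Integration.integral_sum) (rule shift_int)
  also have "\<dots> \<le> (\<Sum>s\<in>T. 2 * r * ?L)" by (intro sum_mono small)
  also have "\<dots> = e / 4 * ?L" using cT by (simp add: r_def)
  finally have "e / 2 * ?L \<le> e / 4 * ?L" .
  then have "e / 2 \<le> e / 4" by (rule mult_right_le_imp_le[OF _ L])
  then show False using e by simp
qed

text \<open>For a Schwartz function \<open>f\<close>, the convolutions of its reflection with two decompositions are
  compared; the value at \<open>0\<close> of such a convolution is the value of the distribution at \<open>f\<close>.\<close>
theorem eberlein_decomposition_unique:
  fixes \<omega> :: "'n::finite distr"
  assumes 1: "eberlein_decomposition \<omega> \<omega>1 \<omega>2" and 2: "eberlein_decomposition \<omega> \<omega>1' \<omega>2'"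
  shows "\<omega>1' = \<omega>1 \<and> \<omega>2' = \<omega>2"
proof -
  have S: "\<omega>1 \<in> SAP" "\<omega>1' \<in> SAP" and Z: "\<omega>2 \<in> WAP0" "\<omega>2' \<in> WAP0"
    and eq: "\<omega>1 f + \<omega>2 f = \<omega>1' f + \<omega>2' f" for f
    using 1 2 unfolding eberlein_decomposition_def by (auto dest!: fun_cong[of _ _ f])
  have schw: "\<omega>1 f = \<omega>1' f" if f: "f \<in> schwartz" for f
  proof -
    let ?f = "\<lambda>y. f (0 - y)"
    have f': "?f \<in> schwartz" by (rule schwartz_reflect[OF f])
    obtain A where A: "distr_conv ?f \<omega>1 = apply_bcontfun A" "A \<in> Cu" "relatively_compact_in (top_of_set Cu) (range (\<lambda>t. translate t A))"
      using S(1) f' unfolding SAP_def SAP_fun_def by auto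
    obtain B where B: "distr_conv ?f \<omega>1' = apply_bcontfun B" "B \<in> Cu" "relatively_compact_in (top_of_set Cu) (range (\<lambda>t. translate t B))"
      using S(2) f' unfolding SAP_def SAP_fun_def by auto
    have "distr_conv ?f \<omega>2' \<in> WAP0_fun" "distr_conv ?f \<omega>2 \<in> WAP0_fun"
      using Z f' unfolding WAP0_def by auto
    then obtain C D where C: "distr_conv ?f \<omega>2' = apply_bcontfun C" "has_mean (\<lambda>x. cmod (apply_bcontfun C x)) 0"
      and D: "distr_conv ?f \<omega>2 = apply_bcontfun D" "has_mean (\<lambda>x. cmod (apply_bcontfun D x)) 0"
      unfolding WAP0_fun_def WAP_fun_def by auto
    have "apply_bcontfun (A - B) 0 = 0"
    proof (rule almost_periodic_mean_zero[OF A(2,3) B(2,3) C(2) D(2)])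
      fix x
      show "apply_bcontfun (A - B) x = apply_bcontfun A x - apply_bcontfun B x" by (simp add: minus_bcontfun.rep_eq)
      have "distr_conv ?f \<omega>1 x - distr_conv ?f \<omega>1' x = distr_conv ?f \<omega>2' x - distr_conv ?f \<omega>2 x"
        using eq[of "\<lambda>y. f (0 - (x - y))"] by (simp add: distr_conv_def algebra_simps)
      then show "apply_bcontfun (A - B) x = apply_bcontfun C x - apply_bcontfun D x"
        unfolding minus_bcontfun.rep_eq A(1)[symmetric] B(1)[symmetric] C(1)[symmetric] D(1)[symmetric] .
    qed
    then have "distr_conv ?f \<omega>1 0 = distr_conv ?f \<omega>1' 0"
      unfolding minus_bcontfun.rep_eq A(1)[symmetric] B(1)[symmetric] by simp
    then show ?thesis by (simp add: distr_conv_def)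
  qed
  have e1: "\<omega>1 f = \<omega>1' f" for f
    using schw[of f] S by (cases "f \<in> schwartz") (auto simp: SAP_def tempered_def)
  moreover have "\<omega>2 f = \<omega>2' f" for f using eq[of f] e1[of f] by simp
  ultimately show ?thesis by auto
qed

section \<open>Almost periodicity of the parts\<close>

context bounded_density begin

text \<open>Since \<open>fourier f\<close> decays like \<open>weight\<close>, the integrand over \<open>m\<close> can be moved to the finite measure
  \<open>weighted\<close>, with a bounded density.\<close>
lemma distr_conv_inv_distr_weighted:
  assumes f: "f \<in> schwartz"
  defines "v \<equiv> \<lambda>k. fourier f k * u k / of_real (weight k)"
  shows "v \<in> bounded_meas" "distr_conv f inv_distr = (\<lambda>x. LINT k|weighted. ee (k \<bullet> x) * v k)"
proof -
  note F = fourier_schwartz[OF f]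
  note [measurable] = measurable_schwartz[OF F]
  have vm [measurable]: "v \<in> borel_measurable borel" unfolding v_def by measurable
  show "v \<in> bounded_meas"
  proof (rule bounded_meas_I[OF vm])
    fix k
    have "cmod (v k) = cmod (fourier f k) * cmod (u k) / weight k"
      using weight_pos[of k] by (simp add: v_def norm_divide norm_mult)
    also have "\<dots> \<le> (weight_norm (fourier f) * weight k) * U / weight k"
      using schwartz_le_weight[OF F, of k] weight_pos[of k] weight_norm_nonneg[OF F]
      by (intro divide_right_mono mult_mono u_bound) (auto intro: less_imp_le mult_nonneg_nonneg)
    also have "\<dots> = weight_norm (fourier f) * U" using weight_pos[of k] by simp
    finally show "cmod (v k) \<le> weight_norm (fourier f) * U" .
  qed
  show "distr_conv f inv_distr = (\<lambda>x. LINT k|weighted. ee (k \<bullet> x) * v k)"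
  proof
    fix x
    have "(LINT k|weighted. ee (k \<bullet> x) * v k) = (LINT k|m. weight k *\<^sub>R (ee (k \<bullet> x) * v k))"
      unfolding weighted_def by (rule integral_density) (auto simp: less_imp_le[OF weight_pos])
    also have "\<dots> = (LINT k|m. ee (k \<bullet> x) * fourier f k * u k)"
    proof (rule Bochner_Integration.integral_cong[OF refl])
      fix k show "weight k *\<^sub>R (ee (k \<bullet> x) * v k) = ee (k \<bullet> x) * fourier f k * u k"
        using weight_pos[of k] by (simp add: v_def scaleR_conv_of_real)
    qed
    finally show "distr_conv f inv_distr x = (LINT k|weighted. ee (k \<bullet> x) * v k)"
      by (simp add: distr_conv_inv_distr[OF f])
  qed
qed

lemma finite_borel_weighted: "finite_borel weighted"
  using finite_weighted by (simp add: finite_borel_def finite_borel_axioms_def)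

lemma inv_distr_WAP: "inv_distr \<in> WAP"
  unfolding WAP_def
proof (intro CollectI conjI ballI inv_distr_tempered)
  fix f :: "'n cfun" assume f: "f \<in> schwartz"
  show "distr_conv f inv_distr \<in> WAP_fun"
    unfolding distr_conv_inv_distr_weighted(2)[OF f]
    by (rule finite_borel.Fourier_Stieltjes_WAP[OF finite_borel_weighted distr_conv_inv_distr_weighted(1)[OF f]])
qed

lemma inv_distr_SAP:
  assumes supp: "\<And>k. k \<notin> atoms \<Longrightarrow> u k = 0"
  shows "inv_distr \<in> SAP"
  unfolding SAP_def
proof (intro CollectI conjI ballI inv_distr_tempered)
  fix f :: "'n cfun" assume f: "f \<in> schwartz"
  show "distr_conv f inv_distr \<in> SAP_fun"
    unfolding distr_conv_inv_distr_weighted(2)[OF f]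
    by (rule finite_borel.pure_point_SAP[OF finite_borel_weighted distr_conv_inv_distr_weighted(1)[OF f] countable_atoms])
      (simp add: supp)
qed

text \<open>As \<open>u\<close> vanishes on the atoms, \<open>weighted\<close> may be replaced by its restriction to their complement,
  which has no atoms.\<close>
lemma inv_distr_WAP0:
  assumes supp: "\<And>k. k \<in> atoms \<Longrightarrow> u k = 0"
  shows "inv_distr \<in> WAP0"
  unfolding WAP0_def
proof (intro CollectI conjI ballI inv_distr_tempered)
  fix f :: "'n cfun" assume f: "f \<in> schwartz"
  let ?v = "\<lambda>k. fourier f k * u k / of_real (weight k)"
  note v = distr_conv_inv_distr_weighted[OF f]
  let ?M = "density weighted (\<lambda>k. ennreal (indicator (- atoms) k))"
  interpret w: finite_borel weighted by (rule finite_borel_weighted)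
  have em: "emeasure ?M A = emeasure weighted (A \<inter> - atoms)" if [measurable]: "A \<in> sets borel" for A
  proof -
    have "emeasure ?M A = (\<integral>\<^sup>+k. indicator (A \<inter> - atoms) k \<partial>weighted)"
      by (subst emeasure_density, measurable, rule nn_integral_cong) (auto split: split_indicator)
    then show ?thesis by simp
  qed
  have "finite_measure ?M"
  proof (rule finite_measureI)
    have "emeasure ?M (space ?M) = emeasure weighted (- atoms)" using em[of UNIV] by simp
    then show "emeasure ?M (space ?M) \<noteq> \<infinity>" by (simp add: w.emeasure_finite)
  qed
  then interpret c: finite_borel ?M by (simp add: finite_borel_def finite_borel_axioms_def)
  have "emeasure ?M {k} = 0" for k
  proof (cases "k \<in> atoms")
    case False
    then have "emeasure weighted {k} = 0" by (subst emeasure_weighted_eq_0) (auto simp: atoms_def)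
    then show ?thesis using em[of "{k}"] False by simp
  qed (use em[of "{k}"] in simp)
  note mean = c.no_atoms_has_mean_0[OF v(1) this]
  have "(LINT k|?M. ee (k \<bullet> x) * ?v k) = (LINT k|weighted. ee (k \<bullet> x) * ?v k)" for x
  proof -
    note [measurable] = measurable_schwartz[OF fourier_schwartz[OF f]]
    have "(LINT k|?M. ee (k \<bullet> x) * ?v k) = (LINT k|weighted. indicator (- atoms) k *\<^sub>R (ee (k \<bullet> x) * ?v k))"
      by (rule integral_density) auto
    also have "\<dots> = (LINT k|weighted. ee (k \<bullet> x) * ?v k)"
      by (intro Bochner_Integration.integral_cong) (auto simp: supp split: split_indicator)
    finally show ?thesis .
  qed
  then have "has_mean (\<lambda>x. cmod (distr_conv f inv_distr x)) 0" using mean unfolding v(2) by simp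
  moreover have "distr_conv f inv_distr \<in> WAP_fun" using inv_distr_WAP f by (simp add: WAP_def)
  ultimately show "distr_conv f inv_distr \<in> WAP0_fun" by (simp add: WAP0_fun_def)
qed

end

theorem proposition4p1:
  fixes \<omega> :: "'n::finite distr" and \<mu> :: "'n cmeas"
  assumes "\<omega> \<in> DTBM"
    and "\<mu> \<in> translation_bounded" and "distr_fourier \<omega> = distr_of_cmeas \<mu>"
  shows "\<exists>\<omega>s \<omega>0a \<omega>0s.
     spectral_decomposition \<omega> \<mu> \<omega>s \<omega>0a \<omega>0s \<and>
     (\<forall>\<omega>s' \<omega>0a' \<omega>0s'. spectral_decomposition \<omega> \<mu> \<omega>s' \<omega>0a' \<omega>0s' \<longrightarrow>
        \<omega>s' = \<omega>s \<and> \<omega>0a' = \<omega>0a \<and> \<omega>0s' = \<omega>0s) \<and>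
     (\<exists>hs\<in>fourier_stieltjes. \<exists>h0a\<in>fourier_stieltjes. \<exists>h0s\<in>fourier_stieltjes.
        \<omega>s = Psi (distr_of_cmeas (density_cmeas hs)) \<and>
        \<omega>0a = Psi (distr_of_cmeas (density_cmeas h0a)) \<and>
        \<omega>0s = Psi (distr_of_cmeas (density_cmeas h0s))) \<and>
     \<omega> \<in> WAP \<and>
     eberlein_decomposition \<omega> \<omega>s (\<lambda>f. \<omega>0a f + \<omega>0s f) \<and>
     (\<forall>\<omega>s' \<omega>0'. eberlein_decomposition \<omega> \<omega>s' \<omega>0' \<longrightarrow>
        \<omega>s' = \<omega>s \<and> \<omega>0' = (\<lambda>f. \<omega>0a f + \<omega>0s f))"
proof -
  obtain m u where mu: "bounded_density m u 4" "\<mu> = density_charge m u"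
    using translation_bounded_obtain_density[OF assms(2)] by blast
  interpret bounded_density m u 4 by (rule mu(1))
  obtain N where N: "N \<in> sets borel"
    and dec: "lebesgue_decomposition (density_charge m u) (density_charge m (\<lambda>x. indicator atoms x * u x))
      (density_charge m (\<lambda>x. indicator (- (N \<union> atoms)) x * u x)) (density_charge m (\<lambda>x. indicator (N - atoms) x * u x))"
    using lebesgue_decomposition_restrict by blast
  have E: "atoms \<in> sets borel" "- (N \<union> atoms) \<in> sets borel" "N - atoms \<in> sets borel" "- atoms \<in> sets borel"
    using N borel_atoms by auto
  interpret s: bounded_density m "\<lambda>x. indicator atoms x * u x" 4 by (rule restrict(1)[OF E(1)])
  interpret a: bounded_density m "\<lambda>x. indicator (- (N \<union> atoms)) x * u x" 4 by (rule restrict(1)[OF E(2)])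
  interpret c: bounded_density m "\<lambda>x. indicator (N - atoms) x * u x" 4 by (rule restrict(1)[OF E(3)])
  \<comment> \<open>The continuous part as a whole, absolutely and singular continuous together.\<close>
  interpret z: bounded_density m "\<lambda>x. indicator (- atoms) x * u x" 4 by (rule restrict(1)[OF E(4)])
  have "\<omega> \<in> tempered" using assms(1) by (simp add: DTBM_def)
  then have \<omega>: "\<omega> = inv_distr"
    by (rule distr_fourier_inject[OF _ inv_distr_tempered]) (simp only: assms(3) distr_fourier_inv_distr mu(2))
  have z_eq: "z.inv_distr = (\<lambda>f. a.inv_distr f + c.inv_distr f)"
  proof
    fix f show "z.inv_distr f = a.inv_distr f + c.inv_distr f"
    proof (cases "f \<in> schwartz")
      case True
      note S = inv_fourier_schwartz[OF True]
      have "z.inv_distr f = (LINT k|m. inv_fourier f k * (indicator (- (N \<union> atoms)) k * u k) + inv_fourier f k * (indicator (N - atoms) k * u k))"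
        unfolding z.inv_distr_def if_P[OF True]
        by (intro Bochner_Integration.integral_cong) (auto split: split_indicator)
      then show ?thesis
        unfolding a.inv_distr_def c.inv_distr_def if_P[OF True]
        using a.integrable_schwartz_density[OF S] c.integrable_schwartz_density[OF S] by simp
    next
      case False
      show ?thesis unfolding z.inv_distr_def a.inv_distr_def c.inv_distr_def if_not_P[OF False] by simp
    qed
  qed
  have sum: "inv_distr = (\<lambda>f. s.inv_distr f + z.inv_distr f)"
  proof
    fix f show "inv_distr f = s.inv_distr f + z.inv_distr f"
    proof (cases "f \<in> schwartz")
      case True
      note S = inv_fourier_schwartz[OF True]
      have "inv_distr f = (LINT k|m. inv_fourier f k * (indicator atoms k * u k) + inv_fourier f k * (indicator (- atoms) k * u k))"
        unfolding inv_distr_def if_P[OF True]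
        by (intro Bochner_Integration.integral_cong) (auto split: split_indicator)
      then show ?thesis
        unfolding s.inv_distr_def z.inv_distr_def if_P[OF True]
        using s.integrable_schwartz_density[OF S] z.integrable_schwartz_density[OF S] by simp
    next
      case False
      show ?thesis unfolding inv_distr_def s.inv_distr_def z.inv_distr_def if_not_P[OF False] by simp
    qed
  qed
  have spec: "spectral_decomposition \<omega> \<mu> s.inv_distr a.inv_distr c.inv_distr"
    unfolding spectral_decomposition_def mu(2) parts_eq[OF dec]
    by (intro conjI s.inv_distr_DTBM a.inv_distr_DTBM c.inv_distr_DTBM s.distr_fourier_inv_distr
      a.distr_fourier_inv_distr c.distr_fourier_inv_distr) (simp add: \<omega> sum z_eq add.assoc)
  have uniq: "\<omega>s' = s.inv_distr \<and> \<omega>0a' = a.inv_distr \<and> \<omega>0s' = c.inv_distr"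
    if "spectral_decomposition \<omega> \<mu> \<omega>s' \<omega>0a' \<omega>0s'" for \<omega>s' \<omega>0a' \<omega>0s'
  proof -
    have t: "\<omega>s' \<in> tempered" "\<omega>0a' \<in> tempered" "\<omega>0s' \<in> tempered"
      using that by (simp_all add: spectral_decomposition_def DTBM_def)
    have F: "distr_fourier \<omega>s' = distr_fourier s.inv_distr" "distr_fourier \<omega>0a' = distr_fourier a.inv_distr"
      "distr_fourier \<omega>0s' = distr_fourier c.inv_distr"
      using that spec unfolding spectral_decomposition_def by (simp_all only:)
    show ?thesis
      using distr_fourier_inject[OF t(1) s.inv_distr_tempered F(1)] distr_fourier_inject[OF t(2) a.inv_distr_tempered F(2)]
        distr_fourier_inject[OF t(3) c.inv_distr_tempered F(3)] by blast
  qed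
  have eb: "eberlein_decomposition \<omega> s.inv_distr (\<lambda>f. a.inv_distr f + c.inv_distr f)"
    unfolding eberlein_decomposition_def z_eq[symmetric] \<omega>
    by (intro conjI s.inv_distr_SAP z.inv_distr_WAP0 sum) auto
  have W: "\<omega> \<in> WAP" unfolding \<omega> by (rule inv_distr_WAP)
  show ?thesis
  proof (rule exI[of _ s.inv_distr], rule exI[of _ a.inv_distr], rule exI[of _ c.inv_distr], intro conjI spec W eb)
    show "\<forall>\<omega>s' \<omega>0a' \<omega>0s'. spectral_decomposition \<omega> \<mu> \<omega>s' \<omega>0a' \<omega>0s' \<longrightarrow>
        \<omega>s' = s.inv_distr \<and> \<omega>0a' = a.inv_distr \<and> \<omega>0s' = c.inv_distr"
      using uniq by blast
    show "\<exists>hs\<in>fourier_stieltjes. \<exists>h0a\<in>fourier_stieltjes. \<exists>h0s\<in>fourier_stieltjes.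
        s.inv_distr = Psi (distr_of_cmeas (density_cmeas hs)) \<and>
        a.inv_distr = Psi (distr_of_cmeas (density_cmeas h0a)) \<and>
        c.inv_distr = Psi (distr_of_cmeas (density_cmeas h0s))"
      using s.Psi_representation a.Psi_representation c.Psi_representation by blast
    show "\<forall>\<omega>s' \<omega>0'. eberlein_decomposition \<omega> \<omega>s' \<omega>0' \<longrightarrow>
        \<omega>s' = s.inv_distr \<and> \<omega>0' = (\<lambda>f. a.inv_distr f + c.inv_distr f)"
      using eberlein_decomposition_unique[OF eb] by blast
  qed
qed

end
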